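(* Let $\phi:(\mathbb{P}^1)^3\dashrightarrow\mathbb{P}^3$ be a general trilinear birational map of type $(2,2,2)$. Then $\phi$ is tripod. Moreover, with $s,t,u$ and $C$ the lines and the plane conic in the definition of tripod, $$\Sigma_0\cap\Sigma_1=t\cup u\cup C,\qquad T_0\cap T_1=s\cup u\cup C,\qquad Y_0\cap Y_1=s\cup t\cup C.$$
   Context: Setting. $\mathbb{P}^n$ is complex projective $n$-space. A trilinear rational map $\phi:\mathbb{P}^1\times\mathbb{P}^1\times\mathbb{P}^1\dashrightarrow\mathbb{P}^3$ is one given by $$\mathbf{f}=(f_0,f_1,f_2,f_3)=\sum_{0\le i,j,k\le 1} w_{ijk}\,\mathbf{P}_{ijk}\,s_it_ju_k,$$ with control points $\mathbf{P}_{ijk}=(1,x_{ijk},y_{ijk},z_{ijk})\in\mathbb{R}^4$ (identified with points of $\mathbb{P}^3$) and weights $w_{ijk}\in\mathbb{R}$. Boundary surfaces. $\Sigma_0$ (resp. $\Sigma_1$) is the closure of the image of $\phi$ restricted to $(s_0:s_1)=(1:0)$ (resp. $(0:1)$). $T_0,T_1$ and $Y_0,Y_1$ are defined in the same way using $(t_0:t_1)$ and $(u_0:u_1)$. Boundary lines: the boundary $s$-line $s_{jk}$ joins $\mathbf{P}_{0jk},\mathbf{P}_{1jk}$; the $t$-line $t_{ik}$ joins $\mathbf{P}_{i0k},\mathbf{P}_{i1k}$; the $u$-line $u_{ij}$ joins $\mathbf{P}_{ij0},\mathbf{P}_{ij1}$ (images of the corresponding coordinate lines). $\phi$ is tripod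 if all the boundary surfaces are quadrics and: (1) the four boundary $s$-lines (resp. $t$-lines and $u$-lines) intersect a line $s$ (resp. $t$ and $u$); (2) the three lines $s,t,u$ intersect at a point $\mathbf{A}$; (3) all the boundary lines intersect a plane conic $C$ which intersects the three lines $s,t$, and $u$. Type. If $\phi$ is birational, its inverse is $\mathbf{x}\mapsto(A_0:A_1)\times(B_0:B_1)\times(C_0:C_1)$ with $A_0,A_1$ (resp. $B_0,B_1$; $C_0,C_1$) homogeneous of the same degree in $\mathbf{x}=(x_0,\dots,x_3)$ without common factor; the type of $\phi$ is $(\deg A_i,\deg B_j,\deg C_k)$. The trilinear birational maps of a fixed type form an irreducible locus in the projective space $\mathbb{P}^{31}$ of trilinear rational maps (quadruples of trilinear forms up to scalar). "General" means belonging to a suitable nonempty Zariski-open subset of that locus; a general such map satisfies the nondegeneracy property that $\Sigma_i,T_j,Y_k$ are smooth surfaces, pairwise distinct, and $s_{jk},t_{ik},u_{ij}$ are lines, pairwise distinct. *)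

theory Defs
  imports "HOL-Analysis.Analysis" "HOL-Library.Numeral_Type"
begin

text \<open>
  Complex projective space with homogeneous coordinates indexed by a finite type: the elements of
  type \<open>n proj\<close> for the numeral type \<open>n\<close> are the points of projective (n-1)-space.  The numeral
  types 2 and 4 have the elements 0, 1 and 0, 1, 2, 3.  The point with homogeneous coordinates \<open>v\<close>
  is \<open>pt v\<close>, which is meaningful only for \<open>v \<noteq> 0\<close>.
\<close>

definition proj_rel :: "complex ^ 'n::finite \<Rightarrow> complex ^ 'n \<Rightarrow> bool" where
  "proj_rel v w \<longleftrightarrow> v \<noteq> 0 \<and> w \<noteq> 0 \<and> (\<exists>c. w = c *s v)"

lemma part_equivp_proj_rel: "part_equivp (proj_rel :: complex ^ 'n::finite \<Rightarrow> _)"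
proof (rule part_equivpI)
  have "proj_rel (axis undefined 1) (axis undefined 1 :: complex ^ 'n)"
    unfolding proj_rel_def by (auto simp: axis_eq_0_iff intro!: exI[of _ 1])
  then show "\<exists>x :: complex ^ 'n. proj_rel x x" by blast
  show "symp (proj_rel :: complex ^ 'n \<Rightarrow> _)"
  proof (rule sympI)
    fix v w :: "complex ^ 'n"
    assume vw: "proj_rel v w"
    then obtain c where c: "w = c *s v" by (auto simp: proj_rel_def)
    then have "c \<noteq> 0" using vw by (auto simp: proj_rel_def)
    then have "v = inverse c *s w" using c by (simp add: vector_smult_assoc)
    then show "proj_rel w v" using vw by (auto simp: proj_rel_def)
  qed
  show "transp (proj_rel :: complex ^ 'n \<Rightarrow> _)"
    by (rule transpI) (auto simp: proj_rel_def vector_smult_assoc)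
qed

quotient_type ('n) proj = "complex ^ 'n::finite" / partial: proj_rel
  by (rule part_equivp_proj_rel)

abbreviation pt :: "complex ^ 'n::finite \<Rightarrow> 'n proj" where
  "pt v \<equiv> abs_proj v"

lemma pt_eq_iff:
  assumes "v \<noteq> 0" "w \<noteq> 0"
  shows "pt v = pt w \<longleftrightarrow> (\<exists>c. w = c *s v)"
proof -
  have refl: "proj_rel x x" if "x \<noteq> 0" for x :: "complex ^ 'n"
    using that unfolding proj_rel_def by (auto intro!: exI[of _ 1])
  have "proj_rel v w \<longleftrightarrow> pt v = pt w"
    using Quotient3_rel[OF Quotient3_proj, of v w] refl[OF assms(1)] refl[OF assms(2)] by simp
  then show ?thesis using assms by (simp add: proj_rel_def)
qed

lemma proj_cases:
  obtains v where "v \<noteq> 0" "p = pt v"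
  using Quotient3_rep_reflp[OF Quotient3_proj, of p] Quotient3_abs_rep[OF Quotient3_proj, of p]
  by (metis proj_rel_def)

text \<open>
  Homogeneous polynomials, represented by the functions they induce; this is faithful because the
  ground field is infinite.  The zero polynomial is a form of every degree.
\<close>

definition form :: "nat \<Rightarrow> (complex ^ 'n::finite \<Rightarrow> complex) \<Rightarrow> bool" where
  "form d p \<longleftrightarrow> (\<exists>c :: ('n \<Rightarrow> nat) \<Rightarrow> complex. \<forall>x.
     p x = (\<Sum>e | (\<Sum>i\<in>UNIV. e i) = d. c e * (\<Prod>i\<in>UNIV. (x $ i) ^ e i)))"

text \<open>
  Factors of a form are forms, so it suffices to exclude common factors of positive degree among
  forms.
\<close>

definition no_common_factor ::
    "(complex ^ 'n::finite \<Rightarrow> complex) \<Rightarrow> (complex ^ 'n \<Rightarrow> complex) \<Rightarrow> bool" where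
  "no_common_factor p q \<longleftrightarrow> \<not> (\<exists>k m g p' q'. k \<ge> 1 \<and> form k g \<and> form m p' \<and> form m q' \<and>
     p = (\<lambda>x. g x * p' x) \<and> q = (\<lambda>x. g x * q' x))"

text \<open>
  Forms in the coordinates of a product of three projective lines, homogeneous of degrees
  \<open>a\<close>, \<open>b\<close>, \<open>c\<close> in the three groups of variables.  A function that is polynomial of bounded degree in
  each group separately is polynomial in all variables.
\<close>

definition triform :: "nat \<Rightarrow> nat \<Rightarrow> nat \<Rightarrow>
    (complex ^ 2 \<Rightarrow> complex ^ 2 \<Rightarrow> complex ^ 2 \<Rightarrow> complex) \<Rightarrow> bool" where
  "triform a b c p \<longleftrightarrow>
     (\<forall>t u. form a (\<lambda>s. p s t u)) \<and> (\<forall>s u. form b (\<lambda>t. p s t u)) \<and> (\<forall>s t. form c (\<lambda>u. p s t u))"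

definition zero_locus :: "(complex ^ 'n::finite \<Rightarrow> complex) set \<Rightarrow> 'n proj set" where
  "zero_locus S = {pt v | v. v \<noteq> 0 \<and> (\<forall>p\<in>S. p v = 0)}"

definition zariski_closed :: "'n::finite proj set \<Rightarrow> bool" where
  "zariski_closed X \<longleftrightarrow> (\<exists>S. (\<forall>p\<in>S. \<exists>d. form d p) \<and> X = zero_locus S)"

definition zariski_open :: "'n::finite proj set \<Rightarrow> bool" where
  "zariski_open U \<longleftrightarrow> zariski_closed (- U)"

definition zariski_closure :: "'n::finite proj set \<Rightarrow> 'n proj set" where
  "zariski_closure X = \<Inter> {Z. zariski_closed Z \<and> X \<subseteq> Z}"

definition zariski_closed3 :: "(2 proj \<times> 2 proj \<times> 2 proj) set \<Rightarrow> bool" where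
  "zariski_closed3 X \<longleftrightarrow> (\<exists>S. (\<forall>p\<in>S. \<exists>a b c. triform a b c p) \<and>
     X = {(pt s, pt t, pt u) | s t u. s \<noteq> 0 \<and> t \<noteq> 0 \<and> u \<noteq> 0 \<and> (\<forall>p\<in>S. p s t u = 0)})"

definition zariski_open3 :: "(2 proj \<times> 2 proj \<times> 2 proj) set \<Rightarrow> bool" where
  "zariski_open3 U \<longleftrightarrow> zariski_closed3 (- U)"

definition projectivization :: "(complex ^ 'n::finite) set \<Rightarrow> 'n proj set" where
  "projectivization W = {pt v | v. v \<in> W \<and> v \<noteq> 0}"

definition is_line :: "'n::finite proj set \<Rightarrow> bool" where
  "is_line L \<longleftrightarrow> (\<exists>W. vec.subspace W \<and> vec.dim W = 2 \<and> L = projectivization W)"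

text \<open>Conics are understood to be irreducible, that is, smooth.\<close>

definition plane_conic :: "4 proj set \<Rightarrow> bool" where
  "plane_conic C \<longleftrightarrow> (\<exists>W q. vec.subspace W \<and> vec.dim W = 3 \<and> form 2 q \<and>
     \<not> (\<exists>g h. form 1 g \<and> form 1 h \<and> (\<forall>v\<in>W. q v = g v * h v)) \<and>
     C = projectivization W \<inter> zero_locus {q})"

text \<open>
  Quadrics are understood to be irreducible, as the boundary surfaces are; in particular a (double)
  plane is not a quadric.
\<close>

definition quadric_surface :: "4 proj set \<Rightarrow> bool" where
  "quadric_surface X \<longleftrightarrow> (\<exists>q. form 2 q \<and>
     \<not> (\<exists>g h. form 1 g \<and> form 1 h \<and> q = (\<lambda>v. g v * h v)) \<and> X = zero_locus {q})"

definition smooth_surface :: "4 proj set \<Rightarrow> bool" where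
  "smooth_surface X \<longleftrightarrow> (\<exists>d p. d \<ge> 1 \<and> form d p \<and> X = zero_locus {p} \<and>
     (\<forall>v. v \<noteq> 0 \<and> p v = 0 \<longrightarrow> (\<exists>i. deriv (\<lambda>z. p (v + z *s axis i 1)) 0 \<noteq> 0)))"

text \<open>
  A quadruple of trilinear forms is given by the vector \<open>F\<close> of its 32 coefficients: \<open>F $ (l, i, j, k)\<close>
  is the coefficient of \<open>s\<^sub>i t\<^sub>j u\<^sub>k\<close> in the \<open>l\<close>-th form.  For \<open>F \<noteq> 0\<close>, the trilinear rational map is
  the point \<open>pt F\<close> of projective 31-space.  The vector \<open>ctrl F i j k\<close> is the weighted control point
  \<open>w\<^sub>i\<^sub>j\<^sub>k P\<^sub>i\<^sub>j\<^sub>k\<close>; when it is nonzero it represents the same projective point as \<open>P\<^sub>i\<^sub>j\<^sub>k\<close>.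
\<close>

type_synonym trilinear = "complex ^ (4 \<times> 2 \<times> 2 \<times> 2)"

definition ctrl :: "trilinear \<Rightarrow> 2 \<Rightarrow> 2 \<Rightarrow> 2 \<Rightarrow> complex ^ 4" where
  "ctrl F i j k = (\<chi> l. F $ (l, i, j, k))"

definition trilin :: "trilinear \<Rightarrow> complex ^ 2 \<Rightarrow> complex ^ 2 \<Rightarrow> complex ^ 2 \<Rightarrow> complex ^ 4" where
  "trilin F s t u = (\<Sum>i\<in>UNIV. \<Sum>j\<in>UNIV. \<Sum>k\<in>UNIV. (s $ i * t $ j * u $ k) *s ctrl F i j k)"

definition real_control_points :: "trilinear \<Rightarrow> bool" where
  "real_control_points F \<longleftrightarrow> (\<exists>(w :: 2 \<Rightarrow> 2 \<Rightarrow> 2 \<Rightarrow> real) (P :: 2 \<Rightarrow> 2 \<Rightarrow> 2 \<Rightarrow> real ^ 4).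
     \<forall>i j k. P i j k $ 0 = 1 \<and> (\<forall>l. ctrl F i j k $ l = of_real (w i j k * P i j k $ l)))"

text \<open>
  A rational map from projective 3-space to the projective line, written \<open>(A\<^sub>0 : A\<^sub>1)\<close> with forms
  \<open>A\<^sub>0\<close>, \<open>A\<^sub>1\<close> of degree \<open>a\<close> without common factor.
\<close>

definition reduced_pair :: "nat \<Rightarrow> (complex ^ 4 \<Rightarrow> complex ^ 2) \<Rightarrow> bool" where
  "reduced_pair a A \<longleftrightarrow> form a (\<lambda>x. A x $ 0) \<and> form a (\<lambda>x. A x $ 1) \<and>
     no_common_factor (\<lambda>x. A x $ 0) (\<lambda>x. A x $ 1)"

text \<open>
  The two rational maps are mutually inverse: on a nonempty Zariski-open set of the source (which
  is dense) either composition is defined and is the identity.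
\<close>

definition inverse_maps :: "trilinear \<Rightarrow>
    (complex ^ 4 \<Rightarrow> complex ^ 2) \<Rightarrow> (complex ^ 4 \<Rightarrow> complex ^ 2) \<Rightarrow> (complex ^ 4 \<Rightarrow> complex ^ 2) \<Rightarrow> bool" where
  "inverse_maps F A B C \<longleftrightarrow>
     (\<exists>V. zariski_open3 V \<and> V \<noteq> {} \<and>
        (\<forall>s t u. s \<noteq> 0 \<and> t \<noteq> 0 \<and> u \<noteq> 0 \<and> (pt s, pt t, pt u) \<in> V \<longrightarrow>
           (let x = trilin F s t u in
              x \<noteq> 0 \<and> A x \<noteq> 0 \<and> B x \<noteq> 0 \<and> C x \<noteq> 0 \<and>
              pt (A x) = pt s \<and> pt (B x) = pt t \<and> pt (C x) = pt u))) \<and>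
     (\<exists>V. zariski_open V \<and> V \<noteq> {} \<and>
        (\<forall>x. x \<noteq> 0 \<and> pt x \<in> V \<longrightarrow>
           A x \<noteq> 0 \<and> B x \<noteq> 0 \<and> C x \<noteq> 0 \<and>
           trilin F (A x) (B x) (C x) \<noteq> 0 \<and> pt (trilin F (A x) (B x) (C x)) = pt x))"

definition birational_of_type :: "nat \<Rightarrow> nat \<Rightarrow> nat \<Rightarrow> trilinear \<Rightarrow> bool" where
  "birational_of_type a b c F \<longleftrightarrow> (\<exists>A B C.
     reduced_pair a A \<and> reduced_pair b B \<and> reduced_pair c C \<and> inverse_maps F A B C)"

text \<open>The vectors \<open>axis 0 1\<close> and \<open>axis 1 1\<close> are the homogeneous coordinates (1 : 0) and (0 : 1).\<close>

definition Sigma_surf :: "trilinear \<Rightarrow> 2 \<Rightarrow> 4 proj set" where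
  "Sigma_surf F i = zariski_closure {pt (trilin F (axis i 1) t u) | t u.
     t \<noteq> 0 \<and> u \<noteq> 0 \<and> trilin F (axis i 1) t u \<noteq> 0}"

definition T_surf :: "trilinear \<Rightarrow> 2 \<Rightarrow> 4 proj set" where
  "T_surf F j = zariski_closure {pt (trilin F s (axis j 1) u) | s u.
     s \<noteq> 0 \<and> u \<noteq> 0 \<and> trilin F s (axis j 1) u \<noteq> 0}"

definition Y_surf :: "trilinear \<Rightarrow> 2 \<Rightarrow> 4 proj set" where
  "Y_surf F k = zariski_closure {pt (trilin F s t (axis k 1)) | s t.
     s \<noteq> 0 \<and> t \<noteq> 0 \<and> trilin F s t (axis k 1) \<noteq> 0}"

definition join :: "complex ^ 4 \<Rightarrow> complex ^ 4 \<Rightarrow> 4 proj set" where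
  "join v w = projectivization (vec.span {v, w})"

definition s_line :: "trilinear \<Rightarrow> 2 \<Rightarrow> 2 \<Rightarrow> 4 proj set" where
  "s_line F j k = join (ctrl F 0 j k) (ctrl F 1 j k)"

definition t_line :: "trilinear \<Rightarrow> 2 \<Rightarrow> 2 \<Rightarrow> 4 proj set" where
  "t_line F i k = join (ctrl F i 0 k) (ctrl F i 1 k)"

definition u_line :: "trilinear \<Rightarrow> 2 \<Rightarrow> 2 \<Rightarrow> 4 proj set" where
  "u_line F i j = join (ctrl F i j 0) (ctrl F i j 1)"

definition nondegenerate :: "trilinear \<Rightarrow> bool" where
  "nondegenerate F \<longleftrightarrow>
     (let surfaces = [Sigma_surf F 0, Sigma_surf F 1, T_surf F 0, T_surf F 1, Y_surf F 0, Y_surf F 1];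
          lines = [s_line F 0 0, s_line F 0 1, s_line F 1 0, s_line F 1 1,
                   t_line F 0 0, t_line F 0 1, t_line F 1 0, t_line F 1 1,
                   u_line F 0 0, u_line F 0 1, u_line F 1 0, u_line F 1 1]
      in (\<forall>X\<in>set surfaces. smooth_surface X) \<and> distinct surfaces \<and>
         (\<forall>L\<in>set lines. is_line L) \<and> distinct lines)"

definition tripod_config :: "trilinear \<Rightarrow>
    4 proj set \<Rightarrow> 4 proj set \<Rightarrow> 4 proj set \<Rightarrow> 4 proj \<Rightarrow> 4 proj set \<Rightarrow> bool" where
  "tripod_config F s t u A C \<longleftrightarrow>
     (\<forall>i. quadric_surface (Sigma_surf F i) \<and> quadric_surface (T_surf F i) \<and>
          quadric_surface (Y_surf F i)) \<and>
     is_line s \<and> is_line t \<and> is_line u \<and> distinct [s, t, u] \<and>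
     (\<forall>j k. s_line F j k \<inter> s \<noteq> {}) \<and>
     (\<forall>i k. t_line F i k \<inter> t \<noteq> {}) \<and>
     (\<forall>i j. u_line F i j \<inter> u \<noteq> {}) \<and>
     A \<in> s \<and> A \<in> t \<and> A \<in> u \<and>
     plane_conic C \<and>
     (\<forall>j k. s_line F j k \<inter> C \<noteq> {}) \<and>
     (\<forall>i k. t_line F i k \<inter> C \<noteq> {}) \<and>
     (\<forall>i j. u_line F i j \<inter> C \<noteq> {}) \<and>
     s \<inter> C \<noteq> {} \<and> t \<inter> C \<noteq> {} \<and> u \<inter> C \<noteq> {}"

definition tripod :: "trilinear \<Rightarrow> bool" where
  "tripod F \<longleftrightarrow> (\<exists>s t u A C. tripod_config F s t u A C)"

end

theory Submission
  imports Defs "HOL-Computational_Algebra.Fundamental_Theorem_Algebra"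
begin

text \<open>
  Fix \<open>s\<close> and let \<open>M\<^sub>0 + z M\<^sub>1\<close> be the 4 by 4 matrix of the bilinear map \<open>(t, u) \<mapsto> \<phi>(s, t, u)\<close> for
  \<open>s = (1 : z)\<close>. That the inverse has quadratic components \<open>A\<^sub>0, A\<^sub>1\<close> means that \<open>s\<^sub>1 A\<^sub>0 - s\<^sub>0 A\<^sub>1\<close> vanishes on
  all \<open>\<phi>(s, t, u)\<close>; read on rank-one tensors this gives two identities, relative to the determinant form, for
  \<open>N = M\<^sub>0\<inverse> M\<^sub>1 + l\<close>. They imply that \<open>N\<close> is a root of a cubic \<open>z\<^sup>3 - \<nu> z + \<rho>\<close> and that eigenspaces of simple roots
  are isotropic. If all boundary surfaces come from nonsingular matrices, no eigenspace contains an isotropic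
  plane; this excludes three distinct roots, and a triple root is excluded by an open condition on the quartic
  \<open>det (x M\<^sub>0 + y M\<^sub>1)\<close>. A double root determines \<open>N\<close> up to changes of coordinates, and \<open>\<phi>\<close> becomes
  \<open>(a, b, c) \<mapsto> (a : b : c : a b + b c + c a)\<close>. The pencils of the inverse are then spanned by \<open>x\<^sub>3 x\<^sub>i\<close> and
  \<open>q = x\<^sub>0 x\<^sub>1 + x\<^sub>1 x\<^sub>2 + x\<^sub>0 x\<^sub>2\<close>, so that the conic is \<open>x\<^sub>3 = q = 0\<close>, the lines \<open>s, t, u\<close> join \<open>A = (0 : 0 : 0 : 1)\<close>
  to the other coordinate points, and \<open>x\<^sub>3 x\<^sub>i = q = 0\<close> is the union claimed.
\<close>

subsection \<open>Forms and bilinear forms\<close>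

text \<open>The inverse supplies identities on rank-one tensors only, that is, on the Segre quadric
  in the space of 2 by 2 matrices; passing to all vectors leaves an unknown multiple of the
  determinant form each time. These multiples become \<nu>, \<rho> and the shift l. The shift also
  removes the square term of the cubic, so the roots sum to 0: a double root has the shape r, r, -2
  r with r nonzero, and a triple root means that N is nilpotent. After this only r and l are left as
  numerical parameters, and both are absorbed into the coordinate change of the parameter s. The
  normal form is symmetric in its three parameters up to a permutation of coordinates, which carries
  every result about s over to t and u. Genericity is expressed by an open subset of the ambient
  projective 31-space, so one real birational map outside the excluded hypersurface has to be
  exhibited; it is the normal form with the boundary parameters moved away from the base
  points.\<close>

lemma finite_exponents: "finite {e :: 'n::finite \<Rightarrow> nat. (\<Sum>i\<in>UNIV. e i) = d}"
proof (rule finite_subset)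
  show "{e :: 'n \<Rightarrow> nat. (\<Sum>i\<in>UNIV. e i) = d} \<subseteq> UNIV \<rightarrow>\<^sub>E {..d}"
    using member_le_sum[of _ "UNIV :: 'n set"] by (fastforce simp: PiE_def)
  show "finite (UNIV \<rightarrow>\<^sub>E {..d} :: ('n \<Rightarrow> nat) set)" by (rule finite_PiE) auto
qed

text \<open>Terms with the same exponent are collected into one coefficient, so any finite family of
  monomials of degree \<open>d\<close> gives a form, repetitions included.\<close>

lemma formI_sum:
  fixes p :: "complex ^ 'n::finite \<Rightarrow> complex"
  assumes "finite I" "\<And>i. i \<in> I \<Longrightarrow> (\<Sum>k\<in>UNIV. e i k) = d"
    and "\<And>x. p x = (\<Sum>i\<in>I. c i * (\<Prod>k\<in>UNIV. (x $ k) ^ e i k))"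
  shows "form d p"
  unfolding form_def
proof (intro exI allI)
  fix x :: "complex ^ 'n"
  let ?T = "{e :: 'n \<Rightarrow> nat. (\<Sum>i\<in>UNIV. e i) = d}"
  have "p x = (\<Sum>f\<in>?T. \<Sum>i | i \<in> I \<and> e i = f. c i * (\<Prod>k\<in>UNIV. (x $ k) ^ e i k))"
    unfolding assms(3) by (rule sum.group[symmetric]) (use assms finite_exponents in auto)
  also have "\<dots> = (\<Sum>f\<in>?T. (\<Sum>i | i \<in> I \<and> e i = f. c i) * (\<Prod>k\<in>UNIV. (x $ k) ^ f k))"
    by (intro sum.cong) (auto simp: sum_distrib_right)
  finally show "p x = \<dots>" .
qed

lemma form_mult:
  assumes "form a p" "form b q"
  shows "form (a + b) (\<lambda>x. p x * q x)"
proof -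
  obtain c d where c: "\<And>x. p x = (\<Sum>e | sum e UNIV = a. c e * (\<Prod>i\<in>UNIV. (x $ i) ^ e i))"
    and d: "\<And>x. q x = (\<Sum>e | sum e UNIV = b. d e * (\<Prod>i\<in>UNIV. (x $ i) ^ e i))"
    using assms unfolding form_def by blast
  show ?thesis
  proof (rule formI_sum[where I = "{e. sum e UNIV = a} \<times> {e. sum e UNIV = b}"
        and e = "\<lambda>(e, f) i. e i + f i" and c = "\<lambda>(e, f). c e * d f"])
    show "p x * q x = (\<Sum>i\<in>{e. sum e UNIV = a} \<times> {e. sum e UNIV = b}.
      (case i of (e, f) \<Rightarrow> c e * d f) * (\<Prod>k\<in>UNIV. (x $ k) ^ (case i of (e, f) \<Rightarrow> \<lambda>i. e i + f i) k))" for x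
      unfolding c d sum_product sum.cartesian_product
      by (intro sum.cong) (auto simp: power_add prod.distrib)
  qed (auto simp: finite_exponents sum.distrib)
qed

lemma form_add:
  assumes "form d p" "form d q"
  shows "form d (\<lambda>x. p x + q x)"
proof -
  obtain a b where "\<And>x. p x = (\<Sum>e | sum e UNIV = d. a e * (\<Prod>i\<in>UNIV. (x $ i) ^ e i))"
    and "\<And>x. q x = (\<Sum>e | sum e UNIV = d. b e * (\<Prod>i\<in>UNIV. (x $ i) ^ e i))"
    using assms unfolding form_def by blast
  then show ?thesis
    unfolding form_def by (intro exI[of _ "\<lambda>e. a e + b e"]) (simp add: sum.distrib ring_distribs)
qed

lemma form_const: "form 0 (\<lambda>_ :: complex ^ 'n::finite. c)"
  by (rule formI_sum[where I = "{()}" and e = "\<lambda>_ _. 0" and c = "\<lambda>_. c"]) auto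

lemma form_zero: "form d (\<lambda>_ :: complex ^ 'n::finite. 0)"
  unfolding form_def by (intro exI[of _ "\<lambda>_. 0"]) simp

lemma form_coord: "form 1 (\<lambda>x :: complex ^ 'n::finite. x $ i)"
proof (rule formI_sum[where I = "{()}" and e = "\<lambda>_ k. if k = i then 1 else 0" and c = "\<lambda>_. 1"])
  fix x :: "complex ^ 'n"
  have "(\<Prod>k\<in>UNIV. (x $ k) ^ (if k = i then 1 else 0)) = (\<Prod>k\<in>UNIV. if k = i then x $ k else 1)"
    by (intro prod.cong) auto
  then show "x $ i = (\<Sum>_\<in>{()}. 1 * (\<Prod>k\<in>UNIV. (x $ k) ^ (if k = i then 1 else 0)))"
    by (simp add: prod.delta)
qed auto

lemma form_cmult: "form d p \<Longrightarrow> form d (\<lambda>x. c * p x)"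
  using form_mult[OF form_const, of d p c] by simp

lemma form_minus: "form d p \<Longrightarrow> form d (\<lambda>x. - p x)"
  using form_cmult[of d p "-1"] by simp

lemma form_diff: "form d p \<Longrightarrow> form d q \<Longrightarrow> form d (\<lambda>x. p x - q x)"
  using form_add[OF _ form_minus, of d p q] by simp

lemma form_sum: "(\<And>i. i \<in> I \<Longrightarrow> form d (p i)) \<Longrightarrow> form d (\<lambda>x. \<Sum>i\<in>I. p i x)"
  by (induction I rule: infinite_finite_induct) (auto simp: form_zero form_add)

lemma form_prod: "finite I \<Longrightarrow> (\<And>i. i \<in> I \<Longrightarrow> form 1 (p i)) \<Longrightarrow> form (card I) (\<lambda>x. \<Prod>i\<in>I. p i x)"
proof (induction I rule: finite_induct)
  case (insert i I)
  then show ?case using form_mult[of 1 "p i" "card I" "\<lambda>x. \<Prod>i\<in>I. p i x"] by simp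
qed (auto intro: form_const)

lemma form_det:
  fixes M :: "complex ^ 'm::finite \<Rightarrow> complex ^ 'n::finite ^ 'n"
  assumes "\<And>i j. form 1 (\<lambda>x. M x $ i $ j)"
  shows "form CARD('n) (\<lambda>x. det (M x))"
  unfolding det_def by (intro form_sum form_cmult form_prod assms) simp

lemma form_matvec: "form 1 (\<lambda>x :: complex ^ 'n::finite. (A *v x) $ i)"
  unfolding matrix_vector_mult_def by (simp del: One_nat_def) (intro form_sum form_cmult form_coord)

lemma form_scale: "form d p \<Longrightarrow> p (c *s x) = c ^ d * p x"
  by (auto simp: form_def power_mult_distrib prod.distrib power_sum[symmetric] sum_distrib_left
      intro!: sum.cong)

text \<open>Restriction to a line turns statements about forms into statements about polynomials in
  one variable, where roots are under control.\<close>

lemma form_line_poly: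
  assumes "form d p"
  shows "\<exists>P. \<forall>z. p (x + z *s y) = poly P z"
proof -
  obtain c where c: "\<And>x. p x = (\<Sum>e | sum e UNIV = d. c e * (\<Prod>i\<in>UNIV. (x $ i) ^ e i))"
    using assms unfolding form_def by blast
  show ?thesis
    by (intro exI[of _ "\<Sum>e | sum e UNIV = d. [:c e:] * (\<Prod>i\<in>UNIV. [:x $ i, y $ i:] ^ e i)"])
      (simp add: c poly_sum poly_prod)
qed

lemma form_0_D: "form 0 p \<Longrightarrow> \<exists>c. \<forall>x. p x = c"
proof -
  assume "form 0 p"
  then have "p x = p 0" for x using form_scale[of 0 p 0 x] by simp
  then show ?thesis by blast
qed

lemma form_1_linear:
  assumes "form 1 p"
  shows "p (x + y) = p x + p y"
proof -
  obtain c where c: "\<And>x. p x = (\<Sum>e | sum e UNIV = 1. c e * (\<Prod>i\<in>UNIV. (x $ i) ^ e i))"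
    using assms unfolding form_def by blast
  have "(\<Prod>i\<in>UNIV. ((x + y) $ i) ^ e i) = (\<Prod>i\<in>UNIV. (x $ i) ^ e i) + (\<Prod>i\<in>UNIV. (y $ i) ^ e i)"
    if e: "sum e UNIV = 1" for e :: "'a \<Rightarrow> nat"
  proof -
    obtain i where i: "e i = 1" "\<And>k. k \<noteq> i \<Longrightarrow> e k = 0"
      using e by (subst (asm) sum_eq_1_iff) auto
    have "(\<Prod>k\<in>UNIV. (z $ k) ^ e k) = (\<Prod>k\<in>UNIV. if k = i then z $ k else 1)" for z :: "complex ^ 'a"
      using i by (intro prod.cong) auto
    then have *: "(\<Prod>k\<in>UNIV. (z $ k) ^ e k) = z $ i" for z :: "complex ^ 'a"
      by (simp add: prod.delta)
    show ?thesis using *[of "x + y"] *[of x] *[of y] by simp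
  qed
  then show ?thesis
    by (simp add: c sum.distrib[symmetric] ring_distribs[symmetric])
qed

section \<open>Symmetric bilinear forms and the polarization of quadratic forms\<close>

definition sym_bilinear :: "(complex ^ 'n::finite \<Rightarrow> complex ^ 'n \<Rightarrow> complex) \<Rightarrow> bool" where
  "sym_bilinear B \<longleftrightarrow> (\<forall>x y. B x y = B y x) \<and> (\<forall>x y z. B x (y + z) = B x y + B x z) \<and>
     (\<forall>c x y. B x (c *s y) = c * B x y)"

lemma sym_bilinearD:
  assumes "sym_bilinear B"
  shows "B x (y + z) = B x y + B x z" "B (y + z) x = B y x + B z x"
    "B x (c *s y) = c * B x y" "B (c *s y) x = c * B y x" "B x 0 = 0" "B 0 x = 0"
    "B x (y - z) = B x y - B x z" "B (y - z) x = B y x - B z x"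
proof -
  have *: "\<And>x y. B x y = B y x" "\<And>x y z. B x (y + z) = B x y + B x z"
     "\<And>c x y. B x (c *s y) = c * B x y"
    using assms by (auto simp: sym_bilinear_def)
  show "B x (y + z) = B x y + B x z" "B x (c *s y) = c * B x y" by (simp_all add: *)
  show "B (y + z) x = B y x + B z x" "B (c *s y) x = c * B y x" using * by metis+
  show 0: "B x 0 = 0" using *(3)[of x 0 0] by simp
  show "B 0 x = 0" using 0 *(1) by metis
  have m: "B x (y - z) = B x y - B x z" for x y z using *(2)[of x "y - z" z] by simp
  show "B x (y - z) = B x y - B x z" by (rule m)
  show "B (y - z) x = B y x - B z x" using m[of x y z] *(1) by metis
qed

lemma sym_bilinear_commute: "sym_bilinear B \<Longrightarrow> B x y = B y x"
  by (simp add: sym_bilinear_def)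

lemma sum_eq_2_cases:
  assumes "sum e UNIV = (2::nat)"
  obtains i where "e = (\<lambda>k::'n::finite. if k = i then 2 else 0)"
  | i j where "i \<noteq> j" "e = (\<lambda>k. if k = i \<or> k = j then 1 else 0)"
proof -
  obtain i where i: "e i \<noteq> 0" using assms by (metis sum.neutral zero_neq_numeral)
  have s: "sum e UNIV = e i + sum e (UNIV - {i})" by (simp add: sum.remove[of UNIV i])
  show ?thesis
  proof (cases "e i = 1")
    case True
    then have "sum e (UNIV - {i}) = 1" using s assms by simp
    then obtain j where j: "j \<in> UNIV - {i}" "e j = 1" "\<forall>k\<in>UNIV - {i}. j \<noteq> k \<longrightarrow> e k = 0"
      using sum_eq_1_iff[of "UNIV - {i}" e] by auto
    then show ?thesis using True that(2)[of i j] by (force simp: fun_eq_iff)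
  next
    case False
    then have "e i = 2 \<and> sum e (UNIV - {i}) = 0" using s assms i by arith
    then show ?thesis using that(1)[of i] by (auto simp: fun_eq_iff)
  qed
qed

text \<open>Every monomial of degree 2 is a product of two coordinates, possibly equal, and such a
  product is polarized by symmetrizing; the factor 1/2 makes the diagonal come out right.\<close>

lemma form_2_bilinear:
  fixes p :: "complex ^ 'n::finite \<Rightarrow> complex"
  assumes "form 2 p"
  obtains B where "sym_bilinear B" "\<And>x. p x = B x x"
proof -
  obtain c where c: "\<And>x. p x = (\<Sum>e | sum e UNIV = 2. c e * (\<Prod>i\<in>UNIV. (x $ i) ^ e i))"
    using assms unfolding form_def by blast
  have "\<exists>i j. \<forall>x :: complex ^ 'n. (\<Prod>k\<in>UNIV. (x $ k) ^ e k) = x $ i * x $ j"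
    if e: "sum e UNIV = 2" for e :: "'n \<Rightarrow> nat"
    using e
  proof (cases rule: sum_eq_2_cases)
    case (1 i)
    have "(\<Prod>k\<in>UNIV. (x $ k) ^ e k) = (\<Prod>k\<in>UNIV. if k = i then (x $ k)\<^sup>2 else 1)" for x :: "complex ^ 'n"
      unfolding 1 by (intro prod.cong) auto
    then show ?thesis by (intro exI[of _ i]) (simp add: prod.delta power2_eq_square)
  next
    case (2 i j)
    have "(\<Prod>k\<in>UNIV. (x $ k) ^ e k) =
        (\<Prod>k\<in>UNIV. if k = i then x $ k else 1) * (\<Prod>k\<in>UNIV. if k = j then x $ k else 1)" for x :: "complex ^ 'n"
      unfolding 2 prod.distrib[symmetric] using \<open>i \<noteq> j\<close> by (intro prod.cong) auto
    then show ?thesis by (intro exI[of _ i] exI[of _ j]) (simp add: prod.delta)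
  qed
  then obtain i j where ij: "\<And>e x. sum e UNIV = 2 \<Longrightarrow>
      (\<Prod>k\<in>UNIV. (x $ k) ^ e k) = (x :: complex ^ 'n) $ i e * x $ j e"
    by metis
  show ?thesis
  proof (rule that)
    let ?B = "\<lambda>x y :: complex ^ 'n. \<Sum>e | sum e UNIV = 2. c e / 2 * (x $ i e * y $ j e + y $ i e * x $ j e)"
    show "sym_bilinear ?B"
      unfolding sym_bilinear_def
      by (auto simp: sum.distrib[symmetric] sum_distrib_left algebra_simps intro!: sum.cong)
    show "p x = ?B x x" for x by (auto simp: c ij intro!: sum.cong)
  qed
qed

subsection \<open>Rank-one tensors and the determinant form\<close>

lemma UNIV_2_01: "(UNIV :: 2 set) = {0, 1}"
  unfolding UNIV_2 by auto

lemma UNIV_4_0123: "(UNIV :: 4 set) = {0, 1, 2, 3}"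
  unfolding UNIV_4 by auto

lemma all_2: "(\<forall>i :: 2. P i) \<longleftrightarrow> P 0 \<and> P 1"
  by (metis (mono_tags) UNIV_2_01 UNIV_I insertE singletonD)

lemma all_4: "(\<forall>i :: 4. P i) \<longleftrightarrow> P 0 \<and> P 1 \<and> P 2 \<and> P 3"
  by (metis (mono_tags) UNIV_4_0123 UNIV_I insertE singletonD)

lemma sum_UNIV_2: "sum f (UNIV :: 2 set) = f 0 + f 1"
  unfolding UNIV_2_01 by simp

lemma sum_UNIV_4: "sum f (UNIV :: 4 set) = f 0 + f 1 + f 2 + f 3"
  unfolding UNIV_4_0123 by (simp add: add.assoc)

lemma vec_eq_2: "(x :: 'a ^ 2) = y \<longleftrightarrow> x $ 0 = y $ 0 \<and> x $ 1 = y $ 1"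
  by (simp add: vec_eq_iff all_2)

lemma vec_eq_4: "(x :: 'a ^ 4) = y \<longleftrightarrow> x $ 0 = y $ 0 \<and> x $ 1 = y $ 1 \<and> x $ 2 = y $ 2 \<and> x $ 3 = y $ 3"
  by (simp add: vec_eq_iff all_4)

definition v2 :: "complex \<Rightarrow> complex \<Rightarrow> complex ^ 2" where
  "v2 a b = (\<chi> i. if i = 0 then a else b)"

definition v4 :: "complex \<Rightarrow> complex \<Rightarrow> complex \<Rightarrow> complex \<Rightarrow> complex ^ 4" where
  "v4 a b c d = (\<chi> i. if i = 0 then a else if i = 1 then b else if i = 2 then c else d)"

lemma v2_nth [simp]: "v2 a b $ 0 = a" "v2 a b $ 1 = b"
  by (simp_all add: v2_def)

lemma v4_nth [simp]: "v4 a b c d $ 0 = a" "v4 a b c d $ 1 = b" "v4 a b c d $ 2 = c" "v4 a b c d $ 3 = d"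
  by (simp_all add: v4_def)

lemma v4_eta: "v4 (x $ 0) (x $ 1) (x $ 2) (x $ 3) = x"
  by (simp add: vec_eq_4)

lemma axis_2_eq_v2: "axis 0 1 = v2 1 0" "axis 1 1 = v2 0 1"
  by (simp_all add: vec_eq_2 axis_def)

definition ten :: "complex ^ 2 \<Rightarrow> complex ^ 2 \<Rightarrow> complex ^ 4" where
  "ten t u = v4 (t $ 0 * u $ 0) (t $ 0 * u $ 1) (t $ 1 * u $ 0) (t $ 1 * u $ 1)"

text \<open>Vectors of length 4 are read as 2 by 2 matrices; \<open>bJ x x\<close> is twice the determinant.\<close>

definition bJ :: "complex ^ 4 \<Rightarrow> complex ^ 4 \<Rightarrow> complex" where
  "bJ x y = x $ 0 * y $ 3 + x $ 3 * y $ 0 - x $ 1 * y $ 2 - x $ 2 * y $ 1"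

lemma sym_bilinear_bJ: "sym_bilinear bJ"
  by (auto simp: sym_bilinear_def bJ_def algebra_simps)

lemmas bJ_simps = sym_bilinearD[OF sym_bilinear_bJ]

lemma bJ_nondeg: "(\<And>x. bJ x y = 0) \<Longrightarrow> y = 0"
proof -
  assume "\<And>x. bJ x y = 0"
  from this[of "v4 1 0 0 0"] this[of "v4 0 1 0 0"] this[of "v4 0 0 1 0"] this[of "v4 0 0 0 1"]
  show ?thesis by (simp add: bJ_def vec_eq_4)
qed

lemma bJ_ten: "bJ (ten t u) (ten t' u') = (t $ 0 * t' $ 1 - t $ 1 * t' $ 0) * (u $ 0 * u' $ 1 - u $ 1 * u' $ 0)"
  by (simp add: bJ_def ten_def algebra_simps)

text \<open>A 2 by 2 matrix of determinant 0 has rank at most one: if its first row is not 0, the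
  second row is a multiple of it. The zero matrix is included, with a zero factor.\<close>

lemma bJ_zero_ten:
  assumes "bJ x x = 0"
  obtains t u where "x = ten t u"
proof (cases "x $ 0 = 0 \<and> x $ 1 = 0")
  case True
  then have "x = ten (v2 0 1) (v2 (x $ 2) (x $ 3))" by (simp add: vec_eq_4 ten_def)
  then show ?thesis by (rule that)
next
  case False
  have d: "x $ 0 * x $ 3 = x $ 1 * x $ 2" using assms by (simp add: bJ_def algebra_simps)
  show ?thesis
  proof (cases "x $ 0 = 0")
    case True
    then have "x = ten (v2 1 (x $ 3 / x $ 1)) (v2 (x $ 0) (x $ 1))" using False d by (simp add: vec_eq_4 ten_def)
    then show ?thesis by (rule that)
  next
    case False
    then have "x = ten (v2 1 (x $ 2 / x $ 0)) (v2 (x $ 0) (x $ 1))" using d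
      by (simp add: vec_eq_4 ten_def field_simps)
    then show ?thesis by (rule that)
  qed
qed

text \<open>The rank-one tensors are the zeros of the determinant, and a quadratic form vanishing on
  them is a multiple of it. Tensors with entries 0 and 1 already determine all coefficients: unit
  vectors give the diagonal, rows and columns the mixed terms within them, and the all-one tensor
  relates the two remaining coefficients.\<close>

lemma sym_bilinear_zero_on_ten:
  assumes B: "sym_bilinear B" and 0: "\<And>t u. B (ten t u) (ten t u) = 0"
  obtains c where "\<And>x y. B x y = c * bJ x y"
proof -
  let ?e0 = "v4 1 0 0 0" let ?e1 = "v4 0 1 0 0" let ?e2 = "v4 0 0 1 0" let ?e3 = "v4 0 0 0 1"
  note [simp] = sym_bilinearD[OF B]
  have dec: "x = x $ 0 *s ?e0 + x $ 1 *s ?e1 + x $ 2 *s ?e2 + x $ 3 *s ?e3" for x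
    by (simp add: vec_eq_4)
  have sy: "B ?e1 ?e0 = B ?e0 ?e1" "B ?e2 ?e0 = B ?e0 ?e2" "B ?e3 ?e0 = B ?e0 ?e3"
    "B ?e2 ?e1 = B ?e1 ?e2" "B ?e3 ?e1 = B ?e1 ?e3" "B ?e3 ?e2 = B ?e2 ?e3"
    using sym_bilinear_commute[OF B] by blast+
  have t: "ten (v2 a b) (v2 c d) = (a*c) *s ?e0 + (a*d) *s ?e1 + (b*c) *s ?e2 + (b*d) *s ?e3" for a b c d
    by (simp add: vec_eq_4 ten_def)
  have T': "B ((a*c) *s ?e0 + (a*d) *s ?e1 + (b*c) *s ?e2 + (b*d) *s ?e3)
      ((a*c) *s ?e0 + (a*d) *s ?e1 + (b*c) *s ?e2 + (b*d) *s ?e3) = 0" for a b c d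
    unfolding t[symmetric] by (rule 0)
  have d: "B ?e0 ?e0 = 0" "B ?e1 ?e1 = 0" "B ?e2 ?e2 = 0" "B ?e3 ?e3 = 0"
    using T'[where a = 1 and b = 0 and c = 1 and d = 0] T'[where a = 1 and b = 0 and c = 0 and d = 1] T'[where a = 0 and b = 1 and c = 1 and d = 0] T'[where a = 0 and b = 1 and c = 0 and d = 1] by simp_all
  have o: "B ?e0 ?e1 = 0" "B ?e0 ?e2 = 0" "B ?e1 ?e3 = 0" "B ?e2 ?e3 = 0"
    using T'[where a = 1 and b = 0 and c = 1 and d = 1] T'[where a = 1 and b = 1 and c = 1 and d = 0] T'[where a = 1 and b = 1 and c = 0 and d = 1] T'[where a = 0 and b = 1 and c = 1 and d = 1] by (simp_all add: d sy)
  have "B ?e1 ?e2 = - B ?e0 ?e3"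
    using T'[where a = 1 and b = 1 and c = 1 and d = 1] by (simp add: d o sy algebra_simps) algebra
  then have "B x y = B ?e0 ?e3 * bJ x y" for x y
    apply (subst dec[of x], subst dec[of y])
    apply (simp add: d o sy bJ_def)
    apply (simp add: algebra_simps)
    done
  then show ?thesis by (rule that)
qed

section \<open>Roots of quadratics and cubics, and a bound on spans\<close>

lemma quadratic_split: obtains b c :: complex where "b + c = p" "b * c = q"
proof
  let ?d = "csqrt (p\<^sup>2 - 4 * q)"
  have d: "?d * ?d = p\<^sup>2 - 4 * q" by (metis power2_csqrt power2_eq_square)
  show "(p + ?d) / 2 + (p - ?d) / 2 = p" by (simp add: field_simps)
  show "(p + ?d) / 2 * ((p - ?d) / 2) = q" using d by (simp add: field_simps power2_eq_square)
qed

text \<open>One root a of z^3 - p z + q comes from the fundamental theorem of algebra; the cofactor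
  z^2 + a z + a^2 - p is then split. Symmetric functions record the roots with multiplicity, so
  coincidences need no separate treatment.\<close>

lemma depressed_cubic_split:
  obtains a b c :: complex where "a + b + c = 0" "a * b + b * c + c * a = - p" "a * b * c = - q"
proof -
  have "\<not> constant (poly [:q, - p, 0, 1:])" by (simp add: constant_degree)
  then obtain a where "poly [:q, - p, 0, 1:] a = 0" using fundamental_theorem_of_algebra by blast
  then have a: "a ^ 3 - p * a + q = 0" by (simp add: algebra_simps power3_eq_cube)
  obtain b c where bc: "b + c = - a" "b * c = a\<^sup>2 - p" by (rule quadratic_split)
  show ?thesis
  proof
    show "a + b + c = 0" using bc(1) by (simp add: add.assoc)
    show "a * b + b * c + c * a = - p" using bc by algebra
    show "a * b * c = - q" using bc a by algebra
  qed
qed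

lemma not_in_span_three:
  obtains x :: "complex ^ 4" where "\<And>k l m. x \<noteq> k *s u1 + l *s u2 + m *s u3"
proof (rule ccontr)
  assume "\<not> thesis"
  then have *: "\<exists>k l m. x = k *s u1 + l *s u2 + m *s u3" for x :: "complex ^ 4"
    using that by blast
  have "UNIV \<subseteq> vec.span {u1, u2, u3}"
  proof
    fix x :: "complex ^ 4"
    obtain k l m where "x = k *s u1 + l *s u2 + m *s u3" using * by blast
    then show "x \<in> vec.span {u1, u2, u3}"
      by (simp add: vec.span_add vec.span_scale vec.span_base)
  qed
  then have "vec.dim (UNIV :: (complex ^ 4) set) \<le> card {u1, u2, u3}"
    by (rule vec.dim_le_card) simp
  also have "\<dots> \<le> 3" by (simp add: card_insert_if)
  finally show False by (simp add: vec_dim_card del: vec.dim_UNIV)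
qed

subsection \<open>The structure of the pencil operator\<close>

text \<open>
  The operator is \<open>M\<^sub>0\<inverse> M\<^sub>1 + l\<close>, where \<open>s\<^sub>0 M\<^sub>0 + s\<^sub>1 M\<^sub>1\<close> is the matrix of the bilinear map obtained by
  fixing \<open>s\<close>; the scalar \<open>l\<close> is chosen to kill the linear terms of the two quadratic identities.
  An isotropic eigenvector is a base point, and those with \<open>z $ 1 = 0\<close> lie on a boundary face.
\<close>

locale pencil_operator =
  fixes N :: "complex ^ 4 \<Rightarrow> complex ^ 4" and \<nu> \<rho> :: complex
  assumes add: "N (x + y) = N x + N y" and scale: "N (k *s x) = k *s N x"
    and quad1: "2 * bJ x (N (N x)) + bJ (N x) (N x) = \<nu> * bJ x x"
    and quad2: "2 * bJ (N x) (N (N x)) = \<rho> * bJ x x"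
    and no_base_line: "N z = r *s z \<Longrightarrow> bJ z z = 0 \<Longrightarrow> z $ 1 = 0 \<Longrightarrow> z = 0"
    and not_nilpotent: "\<exists>x. N (N (N x)) \<noteq> 0"
begin

lemma diff: "N (x - y) = N x - N y"
  using add[of "x - y" y] by simp

lemma polar1: "bJ x (N (N y)) + bJ (N (N x)) y + bJ (N x) (N y) = \<nu> * bJ x y"
proof -
  have c: "bJ y x = bJ x y" "bJ (N y) (N x) = bJ (N x) (N y)" "bJ y (N (N x)) = bJ (N (N x)) y"
    by (rule sym_bilinear_commute[OF sym_bilinear_bJ])+
  show ?thesis
    using quad1[of "x + y"] quad1[of x] quad1[of y] unfolding add bJ_simps c by algebra
qed

lemma polar2: "bJ (N x) (N (N y)) + bJ (N (N x)) (N y) = \<rho> * bJ x y"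
proof -
  have c: "bJ y x = bJ x y" "bJ (N y) (N (N x)) = bJ (N (N x)) (N y)"
    by (rule sym_bilinear_commute[OF sym_bilinear_bJ])+
  show ?thesis
    using quad2[of "x + y"] quad2[of x] quad2[of y] unfolding add bJ_simps c by algebra
qed

text \<open>Put \<open>N y\<close> for \<open>y\<close> in \<open>polar1\<close> and subtract
  \<open>polar2\<close>: the terms with N on both sides cancel, and what remains is this equation
  paired with an arbitrary \<open>x\<close>.\<close>

lemma cubic: "N (N (N y)) = \<nu> *s N y - \<rho> *s y"
proof -
  have "bJ x (N (N (N y)) - (\<nu> *s N y - \<rho> *s y)) = 0" for x
    using polar1[of x "N y"] polar2[of x y] by (simp add: bJ_simps algebra_simps)
  then have "N (N (N y)) - (\<nu> *s N y - \<rho> *s y) = 0" by (rule bJ_nondeg)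
  then show ?thesis by simp
qed

text \<open>3 r^2 - \<nu> is the derivative at r of the cubic z^3 - \<nu> z + \<rho>, so the last
  hypothesis holds exactly for r that is not a multiple root. On an eigenspace \<open>polar1\<close>
  reads 3 r^2 = \<nu> up to the factor \<open>bJ x y\<close>.\<close>

lemma eigen_isotropic:
  assumes "N x = r *s x" "N y = r *s y" "3 * r\<^sup>2 \<noteq> \<nu>"
  shows "bJ x y = 0"
proof -
  have "3 * r\<^sup>2 * bJ x y = \<nu> * bJ x y"
    using polar1[of x y] by (simp add: assms(1,2) scale bJ_simps power2_eq_square algebra_simps)
  then show ?thesis using assms(3) by simp
qed

text \<open>A two-dimensional isotropic eigenspace would meet the hyperplane excluded by \<open>no_base_line\<close>.\<close>

lemma isotropic_eigen_multiple:
  assumes "N x = r *s x" "N y = r *s y" "bJ x x = 0" "bJ x y = 0" "bJ y y = 0" "y \<noteq> 0"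
  shows "x = (x $ 1 / y $ 1) *s y" "y $ 1 \<noteq> 0"
proof -
  show y1: "y $ 1 \<noteq> 0" using no_base_line[of y r] assms by auto
  have "bJ y x = 0" using assms(4) sym_bilinear_commute[OF sym_bilinear_bJ] by metis
  then have "x - (x $ 1 / y $ 1) *s y = 0"
    by (intro no_base_line[of _ r])
      (use y1 assms in \<open>auto simp: diff scale bJ_simps vector_smult_assoc vec.scale_right_diff_distrib mult.commute\<close>)
  then show "x = (x $ 1 / y $ 1) *s y" by simp
qed

text \<open>The eigenspace is totally isotropic, hence of dimension at most 1. If r is not an
  eigenvalue, \<open>v\<close> is 0.\<close>

lemma simple_eigenspace:
  assumes "3 * r\<^sup>2 \<noteq> \<nu>"
  obtains v where "\<And>x. N x = r *s x \<Longrightarrow> \<exists>k. x = k *s v"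
proof (cases "\<exists>v. v \<noteq> 0 \<and> N v = r *s v")
  case True
  then obtain v where "v \<noteq> 0" "N v = r *s v" by blast
  then show ?thesis
    using that[of v] isotropic_eigen_multiple(1)[of _ r v] eigen_isotropic[OF _ _ assms] by metis
next
  case False
  then show ?thesis using that[of 0] by fastforce
qed

text \<open>With distinct roots the 4-dimensional space would be the sum of three eigenspaces, each
  of dimension at most 1.\<close>

lemma not_three_eigenvalues:
  assumes abc: "a + b + c = 0" "a * b + b * c + c * a = - \<nu>" "a * b * c = - \<rho>"
    and ne: "a \<noteq> b" "b \<noteq> c" "a \<noteq> c"
  shows False
proof -
  have P: "3 * a\<^sup>2 - \<nu> = (a - b) * (a - c)" "3 * b\<^sup>2 - \<nu> = (b - a) * (b - c)" "3 * c\<^sup>2 - \<nu> = (c - a) * (c - b)"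
    using abc(1,2) by algebra+
  then have "3 * a\<^sup>2 \<noteq> \<nu>" "3 * b\<^sup>2 \<noteq> \<nu>" "3 * c\<^sup>2 \<noteq> \<nu>"
    using ne by auto
  then obtain va vb vc where v: "\<And>x. N x = a *s x \<Longrightarrow> \<exists>k. x = k *s va"
    "\<And>x. N x = b *s x \<Longrightarrow> \<exists>k. x = k *s vb" "\<And>x. N x = c *s x \<Longrightarrow> \<exists>k. x = k *s vc"
    by (metis simple_eigenspace)
  obtain x where x: "\<And>k l m. x \<noteq> k *s va + l *s vb + m *s vc"
    using not_in_span_three[of va vb vc] by metis
  \<comment> \<open>This is (N - b)(N - c) x, which the cubic places in the eigenspace of the third
    root a.\<close>
  define w where "w = (\<lambda>b c. N (N x) - (b + c) *s N x + (b * c) *s x)"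
  have eig: "N (w b c) = a *s w b c"
    if "a + b + c = 0" "a * b + b * c + c * a = - \<nu>" "a * b * c = - \<rho>" for a b c
  proof -
    have a: "a = - b - c" using that(1) by (simp add: eq_neg_iff_add_eq_0 add_ac diff_eq_eq) algebra
    have "\<nu> = b * b + b * c + c * c" "\<rho> = b * c * (b + c)"
      using that(2,3) unfolding a by algebra+
    then show ?thesis
      unfolding w_def a
      by (simp add: add diff scale cubic vec_eq_iff algebra_simps)
  qed
  obtain k l m where klm: "w b c = k *s va" "w c a = l *s vb" "w a b = m *s vc"
    using v(1)[OF eig[of a b c]] v(2)[OF eig[of b c a]] v(3)[OF eig[of c a b]] abc
    by (auto simp: algebra_simps)
  define D where "D = (a - b) * (b - c) * (c - a)"
  have "D \<noteq> 0" using ne by (simp add: D_def)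
  \<comment> \<open>Lagrange interpolation of the constant 1 at the three roots, multiplied by the
    Vandermonde product \<open>D\<close> to clear denominators.\<close>
  have "D *s x = (c - b) *s w b c + (a - c) *s w c a + (b - a) *s w a b"
    by (simp add: D_def w_def vec_eq_iff algebra_simps)
  then have "(1 / D) *s (D *s x) = (1 / D) *s ((c - b) *s w b c + (a - c) *s w c a + (b - a) *s w a b)"
    by simp
  then have "x = (1 / D * ((c - b) * k)) *s va + (1 / D * ((a - c) * l)) *s vb + (1 / D * ((b - a) * m)) *s vc"
    using \<open>D \<noteq> 0\<close> by (simp add: klm vector_smult_assoc vector_add_ldistrib)
  then show False using x by blast
qed

text \<open>The equations say that the cubic is (z - r)^2 (z + 2 r). For r = 0 it would be z^3,
  making N nilpotent.\<close>

lemma double_eigenvalue: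
  obtains r where "r \<noteq> 0" "\<nu> = 3 * r\<^sup>2" "\<rho> = 2 * r ^ 3"
proof -
  obtain a b c where abc: "a + b + c = 0" "a * b + b * c + c * a = - \<nu>" "a * b * c = - \<rho>"
    by (rule depressed_cubic_split)
  have "\<exists>r. \<nu> = 3 * r\<^sup>2 \<and> \<rho> = 2 * r ^ 3"
  proof -
    have *: "\<nu> = 3 * x\<^sup>2 \<and> \<rho> = 2 * x ^ 3"
      if "x + x + y = 0" "x * x + x * y + y * x = - \<nu>" "x * x * y = - \<rho>" for x y
    proof -
      have "\<nu> = 3 * x\<^sup>2" "\<rho> = 2 * x ^ 3" using that by algebra+
      then show ?thesis by blast
    qed
    consider "a = b" | "b = c" | "a = c" using not_three_eigenvalues[OF abc] by blast
    then show ?thesis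
    proof cases
      case 1
      then show ?thesis using *[of a c] abc by (auto simp: algebra_simps)
    next
      case 2
      then show ?thesis using *[of b a] abc by (auto simp: algebra_simps)
    next
      case 3
      then show ?thesis using *[of a b] abc by (auto simp: algebra_simps)
    qed
  qed
  then obtain r where r: "\<nu> = 3 * r\<^sup>2" "\<rho> = 2 * r ^ 3" by blast
  moreover have "r \<noteq> 0" using not_nilpotent cubic r by auto
  ultimately show ?thesis using that by blast
qed

text \<open>Normalize to n = N / r - 1, whose cubic is n^3 + 3 n^2 = 0, and write 3 n = (n^2 + 3 n)
  - n^2. The first summand maps into the kernel of n and the second into its eigenspace of -3; both
  images are isotropic, hence at most lines, spanned by q and p. The quadratic identity then
  determines the coefficient of p from q.\<close>

lemma normal_form:
  obtains r p q \<mu> where "r \<noteq> 0" "bJ p p = 0" "bJ q q = 0" "bJ p q \<noteq> 0"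
    "\<mu> p = 0" "\<mu> q = 0" "\<And>x y. \<mu> (x + y) = \<mu> x + \<mu> y" "\<And>k x. \<mu> (k *s x) = k * \<mu> x"
    "\<And>x. N x = r *s (x + \<mu> x *s q - (3 * bJ x q / bJ p q) *s p)"
proof -
  obtain r where r: "r \<noteq> 0" "\<nu> = 3 * r\<^sup>2" "\<rho> = 2 * r ^ 3" by (rule double_eigenvalue)
  define n where "n x = (1 / r) *s N x - x" for x
  have Nn: "N x = r *s (x + n x)" for x
    using r(1) by (simp add: n_def vector_smult_assoc)
  have n_add: "n (x + y) = n x + n y" and n_scale: "n (k *s x) = k *s n x" for x y k
    by (simp_all add: n_def add scale vec_eq_iff algebra_simps)
  have n_diff: "n (x - y) = n x - n y" for x y
    using n_add[of "x - y" y] by simp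
  have eigen_1: "n z = 0 \<Longrightarrow> bJ z z = 0 \<Longrightarrow> z $ 1 = 0 \<Longrightarrow> z = 0" for z
    using no_base_line[of z r] by (simp add: Nn)
  have mult: "x = (x $ 1 / y $ 1) *s y" "y $ 1 \<noteq> 0"
    if "n x = c *s x" "n y = c *s y" "bJ x x = 0" "bJ x y = 0" "bJ y y = 0" "y \<noteq> 0" for x y c
    using isotropic_eigen_multiple[of x "r * (1 + c)" y] that
    by (simp_all add: Nn vec.scale_left_distrib vector_smult_assoc vector_add_ldistrib distrib_left)
  have n_cubic: "n (n (n x)) = - 3 *s n (n x)" for x
  proof -
    have "r ^ 3 *s (n (n (n x)) + 3 *s n (n x)) = 0"
      using cubic[of x] unfolding Nn r n_add n_scale
      by (simp add: vec_eq_iff algebra_simps power2_eq_square power3_eq_cube)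
    then have "n (n (n x)) + 3 *s n (n x) = 0"
      using r(1) by (simp only: vec.scale_eq_0_iff) simp
    then show ?thesis by (simp add: eq_neg_iff_add_eq_0)
  qed
  have n_polar: "3 * bJ x (n y) + 3 * bJ (n x) y + bJ x (n (n y)) + bJ (n (n x)) y + bJ (n x) (n y) = 0" for x y
  proof -
    have "r\<^sup>2 * (3 * bJ x (n y) + 3 * bJ (n x) y + bJ x (n (n y)) + bJ (n (n x)) y + bJ (n x) (n y)) = 0"
      using polar1[of x y] unfolding Nn r n_add n_scale bJ_simps
      by (simp add: algebra_simps power2_eq_square)
    then show ?thesis using r(1) by simp
  qed
  \<comment> \<open>m = n (n + 3) vanishes exactly when n is diagonalizable, and its image lies in
    the kernel of n by the cubic.\<close>
  define m where "m x = n (n x) + 3 *s n x" for x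
  have m_add: "m (x + y) = m x + m y" and m_scale: "m (k *s x) = k *s m x" for x y k
    by (simp_all add: m_def n_add n_scale vec_eq_iff algebra_simps)
  have nm: "n (m x) = 0" for x
    by (simp add: m_def n_add n_scale n_cubic)
  have mm: "m (m x) = 0" for x
    using n_scale[of 0 0] by (simp add: m_def[of "m x"] nm)
  have m_polar: "bJ x (m y) + bJ (m x) y + bJ (n x) (n y) = 0" for x y
    using n_polar[of x y] by (simp add: m_def bJ_simps algebra_simps)
  have m_iso: "bJ (m x) (m y) = 0" for x y
    using m_polar[of x "m y"] by (simp add: mm nm bJ_simps)
  have e3_iso: "bJ x y = 0" if "n x = - 3 *s x" "n y = - 3 *s y" for x y
    using n_polar[of x y] unfolding that n_scale bJ_simps by simp
  \<comment> \<open>If m = 0, the image of n consists of eigenvectors for -3 and is at most a line.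
    So n has a nontrivial kernel on the isotropic plane of the vectors \<open>v4 a 0 b 0\<close>,
    which lies in the hyperplane \<open>z $ 1 = 0\<close> and therefore contains no
    eigenvector.\<close>
  have "\<exists>x. m x \<noteq> 0"
  proof (rule ccontr)
    assume "\<nexists>x. m x \<noteq> 0"
    then have nn: "n (n x) = - 3 *s n x" for x
      by (simp add: m_def eq_neg_iff_add_eq_0)
    have dep: "\<exists>x. x \<noteq> 0 \<and> n x = 0 \<and> bJ x x = 0 \<and> x $ 1 = 0"
    proof (cases "n (v4 0 0 1 0) = 0")
      case True
      then show ?thesis by (intro exI[of _ "v4 0 0 1 0"]) (simp add: bJ_def vec_eq_4)
    next
      case False
      define e where "e = n (v4 1 0 0 0) $ 1"
      define f where "f = n (v4 0 0 1 0) $ 1"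
      have f: "f \<noteq> 0" "n (v4 1 0 0 0) = (e / f) *s n (v4 0 0 1 0)"
        using mult[OF nn nn e3_iso[OF nn nn] e3_iso[OF nn nn] e3_iso[OF nn nn] False] by (simp_all add: e_def f_def)
      have "v4 f 0 (- e) 0 = f *s v4 1 0 0 0 - e *s v4 0 0 1 0"
        by (simp add: vec_eq_4)
      then have "n (v4 f 0 (- e) 0) = 0"
        using f by (simp add: n_diff n_scale vector_smult_assoc)
      then show ?thesis
        using f by (intro exI[of _ "v4 f 0 (- e) 0"]) (simp add: bJ_def vec_eq_4)
    qed
    then show False using eigen_1 by blast
  qed
  then obtain x0 where x0: "m x0 \<noteq> 0" by blast
  define q where "q = m x0"
  define \<mu> where "\<mu> x = m x $ 1 / q $ 1" for x
  have m_\<mu>: "m x = \<mu> x *s q" for x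
    using mult(1)[of "m x" 0 q] x0 by (simp add: \<mu>_def q_def nm m_iso)
  have \<mu>_add: "\<mu> (x + y) = \<mu> x + \<mu> y" and \<mu>_scale: "\<mu> (k *s x) = k * \<mu> x" for x y k
    by (simp_all add: \<mu>_def m_add m_scale add_divide_distrib)
  have \<mu>q: "\<mu> q = 0" by (simp add: \<mu>_def q_def mm)
  have "\<mu> x0 \<noteq> 0" using m_\<mu>[of x0] x0 by auto
  have qq: "bJ q q = 0" "q \<noteq> 0" using m_iso x0 by (simp_all add: q_def)
  obtain p \<psi> where p: "n p = - 3 *s p" "\<And>x. n (n x) = \<psi> x *s p"
    and \<psi>: "\<And>x y. \<psi> (x + y) = \<psi> x + \<psi> y"
  proof (cases "\<exists>y. n (n y) \<noteq> 0")
    case True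
    then obtain y where y: "n (n y) \<noteq> 0" by blast
    note e = e3_iso[OF n_cubic n_cubic]
    show ?thesis
    proof (rule that)
      show "n (n (n y)) = - 3 *s n (n y)" by (rule n_cubic)
      show "n (n x) = (n (n x) $ 1 / n (n y) $ 1) *s n (n y)" for x
        by (rule mult(1)[OF n_cubic n_cubic e e e y])
    qed (simp add: n_add add_divide_distrib)
  next
    case False
    \<comment> \<open>If n^2 = 0, then p = 0; this degenerate case is ruled out once
      \<open>bJ p q\<close> is shown to be nonzero.\<close>
    then show ?thesis using that[of 0 "\<lambda>_. 0"] n_scale[of 0 0] by simp
  qed
  have \<mu>p: "\<mu> p = 0" by (simp add: \<mu>_def m_def p(1) n_scale[of "- 3", simplified] vector_smult_assoc)
  have pp: "bJ p p = 0" using e3_iso p(1) by blast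
  have n_eq: "n x = (1/3) *s (\<mu> x *s q - \<psi> x *s p)" for x
    using m_\<mu>[of x] p(2)[of x] by (simp add: m_def vec_eq_iff) (simp add: algebra_simps)
  define \<delta> where "\<delta> x = bJ x q - \<psi> x * bJ p q / 9" for x
  have qp: "bJ q p = bJ p q" using sym_bilinear_commute[OF sym_bilinear_bJ] .
  have \<mu>\<delta>: "\<mu> x * \<delta> x = 0" for x
  proof -
    have "bJ q x = bJ x q" using sym_bilinear_commute[OF sym_bilinear_bJ] .
    then show ?thesis
      using m_polar[of x x] unfolding m_\<mu> unfolding n_eq
      by (simp add: bJ_simps qq pp qp \<delta>_def field_simps)
  qed
  \<comment> \<open>\<mu> and \<delta> are additive with product 0 and \<mu> is not 0; where \<mu>
    vanishes, translate by \<open>x0\<close>, at which it does not.\<close>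
  have \<delta>: "\<delta> x = 0" for x
  proof (cases "\<mu> x = 0")
    case True
    then have "\<mu> (x0 + x) \<noteq> 0" using \<open>\<mu> x0 \<noteq> 0\<close> by (simp add: \<mu>_add)
    then have "\<delta> (x0 + x) = 0" "\<delta> x0 = 0"
      using \<mu>\<delta>[of "x0 + x"] \<mu>\<delta>[of x0] \<open>\<mu> x0 \<noteq> 0\<close> by auto
    then show ?thesis by (simp add: \<delta>_def bJ_simps \<psi> field_simps)
  qed (use \<mu>\<delta>[of x] in simp)
  have pq: "bJ p q \<noteq> 0"
  proof
    assume "bJ p q = 0"
    then have "bJ x q = 0" for x using \<delta>[of x] by (simp add: \<delta>_def)
    then show False using bJ_nondeg qq(2) by blast
  qed
  then have \<psi>_eq: "\<psi> x = 9 * bJ x q / bJ p q" for x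
    using \<delta>[of x] by (simp add: \<delta>_def field_simps)
  show ?thesis
  proof (rule that)
    show "N x = r *s (x + (\<mu> x / 3) *s q - (3 * bJ x q / bJ p q) *s p)" for x
      by (simp add: Nn n_eq \<psi>_eq vec_eq_iff algebra_simps)
  qed (use r pp qq pq \<mu>p \<mu>q in \<open>simp_all add: \<mu>_add \<mu>_scale add_divide_distrib\<close>)
qed

end

subsection \<open>Reduction to the normal form\<close>

lemma det_nonzero_inverse:
  fixes G :: "complex ^ 'n::finite ^ 'n"
  assumes "det G \<noteq> 0"
  obtains K where "G ** K = mat 1" "K ** G = mat 1"
  using assms by (auto simp: invertible_det_nz[symmetric] invertible_def)

lemma mat_matvec: "mat k *v x = k *s (x :: complex ^ 'n::finite)"
  by (simp add: matrix_vector_mult_def mat_def vec_eq_iff sum.delta if_distrib if_distribR cong: if_cong)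

lemma matrix_eqI: "(\<And>x. A *v x = B *v x) \<Longrightarrow> A = (B :: complex ^ 'n::finite ^ 'm::finite)"
  by (simp add: matrix_eq)

lemma matvec_scale: "A *v (k *s x) = k *s (A *v (x :: complex ^ 'n::finite))"
  by (simp add: vector_scalar_commute)

lemmas matvec_linear = matrix_vector_right_distrib matvec_scale matrix_vector_mult_diff_distrib

lemma det_mat: "det (mat k :: complex ^ 'n::finite ^ 'n) = k ^ CARD('n)"
  by (subst det_diagonal) (auto simp: mat_def)

text \<open>1 + z N has the inverse 1 - z N + z^2 N^2, so its determinant is a polynomial in z
  without zeros, hence constant and equal to 1. The scalar \<open>w\<close> is factored out, except
  for w = 0, where det N = 0 suffices.\<close>

lemma det_add_nilpotent:
  fixes N :: "complex ^ 4 ^ 4"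
  assumes "\<And>x. N *v (N *v (N *v x)) = 0"
  shows "det (mat w + mat y ** N) = w ^ 4"
proof -
  have f: "det (mat 1 + mat z ** N) \<noteq> 0" for z
  proof -
    have "(mat 1 + mat z ** N) ** (mat 1 - mat z ** N + mat (z * z) ** (N ** N)) = mat 1"
    proof (rule matrix_eqI)
      fix x
      show "((mat 1 + mat z ** N) ** (mat 1 - mat z ** N + mat (z * z) ** (N ** N))) *v x = mat 1 *v x"
        by (simp only: matrix_vector_mul_assoc[symmetric] matrix_vector_mult_add_rdistrib
          matrix_vector_mult_diff_rdistrib mat_matvec matvec_linear assms) (simp add: vec_eq_iff algebra_simps)
    qed
    from arg_cong[OF this, of det]
    have "det (mat 1 + mat z ** N) * det (mat 1 - mat z ** N + mat (z * z) ** (N ** N)) = 1"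
      by (simp only: det_mul det_I)
    then show ?thesis by auto
  qed
  have "form 4 (\<lambda>v :: complex ^ 2. det (mat (v $ 0) + mat (v $ 1) ** N :: complex ^ 4 ^ 4))"
  proof -
    have "form 1 (\<lambda>v :: complex ^ 2. (mat (v $ 0) + mat (v $ 1) ** N) $ i $ j)" for i j
    proof -
      have "(mat (v $ 0) + mat (v $ 1) ** N) $ i $ j = mat 1 $ i $ j * v $ 0 + N $ i $ j * v $ 1"
        for v :: "complex ^ 2"
      proof -
        have "(mat (v $ 1) ** N) $ i $ j = (\<Sum>k\<in>UNIV. if i = k then v $ 1 * N $ k $ j else 0)"
          unfolding matrix_matrix_mult_def vec_lambda_beta by (intro sum.cong) (auto simp: mat_def)
        then show ?thesis by (simp add: sum.delta) (simp add: mat_def)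
      qed
      moreover have "form 1 (\<lambda>v :: complex ^ 2. mat 1 $ i $ j * v $ 0 + N $ i $ j * v $ 1)"
        by (intro form_add form_cmult form_coord)
      ultimately show ?thesis by presburger
    qed
    then show ?thesis using form_det[where M = "\<lambda>v :: complex ^ 2. mat (v $ 0) + mat (v $ 1) ** N"] by simp
  qed
  from form_line_poly[OF this, of "v2 1 0" "v2 0 1"]
  obtain P where "\<forall>z. det (mat ((v2 1 0 + z *s v2 0 1) $ 0) + mat ((v2 1 0 + z *s v2 0 1) $ 1) ** N) = poly P z"
    by blast
  then have P: "det (mat 1 + mat z ** N) = poly P z" for z by simp
  then have "poly P z \<noteq> 0" for z using f[of z] by simp
  then have "constant (poly P)" using fundamental_theorem_of_algebra by blast
  then have "poly P z = poly P 0" for z by (auto simp: constant_def)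
  moreover have "poly P 0 = 1"
  proof -
    have "mat 1 + mat 0 ** N = mat 1" by (rule matrix_eqI)
        (simp add: matrix_vector_mult_add_rdistrib matrix_vector_mul_assoc[symmetric] mat_matvec)
    then show ?thesis using P[of 0] by simp
  qed
  ultimately have one: "det (mat 1 + mat z ** N) = 1" for z by (simp add: P)
  show ?thesis
  proof (cases "w = 0")
    case True
    have "N ** (N ** N) = mat 0"
      using assms by (intro matrix_eqI) (simp add: matrix_vector_mul_assoc[symmetric] mat_matvec)
    from arg_cong[OF this, of det] have "det N * (det N * det N) = 0"
      by (simp only: det_mul det_mat) simp
    moreover have "mat w + mat y ** N = mat y ** N"
      using True by (intro matrix_eqI) (simp add: matrix_vector_mult_add_rdistrib mat_matvec)
    ultimately show ?thesis using True by (simp add: det_mul)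
  next
    case False
    have "mat w + mat y ** N = mat w ** (mat 1 + mat (y / w) ** N)"
      using False by (intro matrix_eqI)
        (simp add: matrix_vector_mult_add_rdistrib matrix_vector_mul_assoc[symmetric] mat_matvec matvec_linear vector_smult_assoc vector_add_ldistrib)
    then show ?thesis by (simp add: det_mul det_mat one)
  qed
qed

section \<open>Trilinear maps as pencils of 4 by 4 matrices\<close>

definition idx1 :: "4 \<Rightarrow> 2" where "idx1 m = (if m = 0 \<or> m = 1 then 0 else 1)"
definition idx2 :: "4 \<Rightarrow> 2" where "idx2 m = (if m = 0 \<or> m = 2 then 0 else 1)"

lemma idx_simps [simp]:
  "idx1 0 = 0" "idx1 1 = 0" "idx1 2 = 1" "idx1 3 = 1"
  "idx2 0 = 0" "idx2 1 = 1" "idx2 2 = 0" "idx2 3 = 1"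
  by (simp_all add: idx1_def idx2_def)

text \<open>Columns follow the order of \<open>ten\<close>: position \<open>m\<close> holds the
  entry in row \<open>idx1 m\<close> and column \<open>idx2 m\<close>, so that the matrix acts on
  \<open>ten t u\<close> as the bilinear map does on the pair.\<close>

definition slice :: "trilinear \<Rightarrow> complex ^ 2 \<Rightarrow> complex ^ 4 ^ 4" where
  "slice F s = (\<chi> l m. s $ 0 * F $ (l, 0, idx1 m, idx2 m) + s $ 1 * F $ (l, 1, idx1 m, idx2 m))"

lemma trilin_nth: "trilin F s t u $ l = (\<Sum>i\<in>UNIV. \<Sum>j\<in>UNIV. \<Sum>k\<in>UNIV. s $ i * t $ j * u $ k * F $ (l, i, j, k))"
  by (simp add: trilin_def ctrl_def)

lemma trilin_slice: "trilin F s t u = slice F s *v ten t u"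
  by (simp add: vec_eq_iff trilin_nth slice_def matrix_vector_mult_def sum_UNIV_4 sum_UNIV_2 ten_def algebra_simps)

lemma trilin_linear_1: "trilin F (a *s s + b *s s') t u = a *s trilin F s t u + b *s trilin F s' t u"
  by (simp add: vec_eq_iff trilin_nth sum_UNIV_2 algebra_simps)

lemma trilin_linear_2: "trilin F s (a *s t + b *s t') u = a *s trilin F s t u + b *s trilin F s t' u"
  by (simp add: vec_eq_iff trilin_nth sum_UNIV_2 algebra_simps)

lemma trilin_linear_3: "trilin F s t (a *s u + b *s u') = a *s trilin F s t u + b *s trilin F s t u'"
  by (simp add: vec_eq_iff trilin_nth sum_UNIV_2 algebra_simps)

lemma trilin_0: "trilin F 0 t u = 0" "trilin F s 0 u = 0" "trilin F s t 0 = 0"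
  by (simp_all add: vec_eq_iff trilin_nth)

lemma ten_nonzero: "t \<noteq> 0 \<Longrightarrow> u \<noteq> 0 \<Longrightarrow> ten t u \<noteq> 0"
  by (auto simp: ten_def vec_eq_4 vec_eq_2)

lemma slice_nonsingular:
  assumes "det (slice F s) \<noteq> 0" "t \<noteq> 0" "u \<noteq> 0"
  shows "trilin F s t u \<noteq> 0"
proof
  assume "trilin F s t u = 0"
  obtain K where "K ** slice F s = mat 1" by (rule det_nonzero_inverse[OF assms(1)])
  then have "ten t u = K *v (slice F s *v ten t u)" by (simp add: matrix_vector_mul_assoc)
  then show False using \<open>trilin F s t u = 0\<close> ten_nonzero[OF assms(2,3)] by (simp add: trilin_slice)
qed

definition gl2 :: "(complex ^ 2 \<Rightarrow> complex ^ 2) \<Rightarrow> bool" where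
  "gl2 h \<longleftrightarrow> (\<exists>a b c d. a * d - b * c \<noteq> 0 \<and> (\<forall>s. h s = v2 (a * s $ 0 + b * s $ 1) (c * s $ 0 + d * s $ 1)))"

text \<open>
  In affine parameters \<open>(a, b, c)\<close> this is \<open>(a : b : c : a b + b c + c a)\<close>, the inverse of
  \<open>(x\<^sub>0 x\<^sub>3 / q, x\<^sub>1 x\<^sub>3 / q, x\<^sub>2 x\<^sub>3 / q)\<close> with \<open>q = x\<^sub>0 x\<^sub>1 + x\<^sub>1 x\<^sub>2 + x\<^sub>0 x\<^sub>2\<close>.
\<close>

definition nf :: "complex ^ 2 \<Rightarrow> complex ^ 2 \<Rightarrow> complex ^ 2 \<Rightarrow> complex ^ 4" where
  "nf s t u = v4 (s $ 1 * t $ 0 * u $ 0) (s $ 0 * t $ 1 * u $ 0) (s $ 0 * t $ 0 * u $ 1)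
     (s $ 0 * t $ 1 * u $ 1 + s $ 1 * (t $ 1 * u $ 0 + t $ 0 * u $ 1))"

definition has_normal_form :: "trilinear \<Rightarrow> complex ^ 4 ^ 4 \<Rightarrow> (complex ^ 2 \<Rightarrow> complex ^ 2) \<Rightarrow>
    (complex ^ 2 \<Rightarrow> complex ^ 2) \<Rightarrow> (complex ^ 2 \<Rightarrow> complex ^ 2) \<Rightarrow> bool" where
  "has_normal_form F H f g h \<longleftrightarrow> invertible H \<and> gl2 f \<and> gl2 g \<and> gl2 h \<and>
     (\<forall>s t u. trilin F s t u = H *v nf (f s) (g t) (h u))"

lemma sym_bilinear_matvec: "sym_bilinear B \<Longrightarrow> sym_bilinear (\<lambda>x y. B (G *v x) (G *v y))"
  by (auto simp: sym_bilinear_def matvec_linear)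

text \<open>With s = (1 : z) and x of rank one, the inverse identity becomes z A0 = A1 at M (x + z L
  x). Its coefficients in z are quadratic relations on rank-one tensors, each of which extends to
  all vectors up to a multiple of \<open>bJ\<close>. The constant coefficient identifies A1 with a
  nonzero multiple of \<open>bJ\<close>, the linear one expresses A0, and the other two become the
  identities for N.\<close>

lemma pencil_operator_exists:
  assumes G: "det (slice F (axis 0 1)) \<noteq> 0"
    and bt: "\<And>s u. s \<noteq> 0 \<Longrightarrow> u \<noteq> 0 \<Longrightarrow> trilin F s (axis 1 1) u \<noteq> 0"
    and bu: "\<And>s t. s \<noteq> 0 \<Longrightarrow> t \<noteq> 0 \<Longrightarrow> trilin F s t (axis 0 1) \<noteq> 0"
    and A: "form 2 A0" "form 2 A1" "A1 \<noteq> (\<lambda>_. 0)"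
    and inv: "\<And>s t u. s $ 1 * A0 (trilin F s t u) = s $ 0 * A1 (trilin F s t u)"
  obtains L l \<nu> \<rho> where "slice F (axis 1 1) = slice F (axis 0 1) ** L"
    "(\<exists>x. (L + mat l) *v ((L + mat l) *v ((L + mat l) *v x)) \<noteq> 0) \<longrightarrow> pencil_operator (\<lambda>x. (L + mat l) *v x) \<nu> \<rho>"
proof -
  define M where "M = slice F (axis 0 1)"
  obtain K where K: "M ** K = mat 1" "K ** M = mat 1" using det_nonzero_inverse[OF G] unfolding M_def by blast
  define L where "L = K ** slice F (axis 1 1)"
  have M_L: "slice F (axis 1 1) = M ** L" using K by (simp add: L_def matrix_mul_assoc)
  have s01: "s = s $ 0 *s axis 0 1 + s $ 1 *s axis 1 1" for s :: "complex ^ 2"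
    by (simp add: vec_eq_2 axis_def)
  have F: "trilin F s t u = M *v (s $ 0 *s ten t u + s $ 1 *s (L *v ten t u))" for s t u
    by (subst s01[of s], subst trilin_linear_1)
      (simp add: trilin_slice M_L M_def[symmetric] matvec_linear matrix_vector_mul_assoc[symmetric])
  obtain B0 B1 where B0: "sym_bilinear B0" "\<And>x. A0 x = B0 x x" and B1: "sym_bilinear B1" "\<And>x. A1 x = B1 x x"
    using A(1,2) by (metis form_2_bilinear)
  define C0 where "C0 = (\<lambda>x y. B0 (M *v x) (M *v y))"
  define C1 where "C1 = (\<lambda>x y. B1 (M *v x) (M *v y))"
  have sb: "sym_bilinear C0" "sym_bilinear C1"
    unfolding C0_def C1_def using sym_bilinear_matvec[OF B0(1)] sym_bilinear_matvec[OF B1(1)] by blast+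
  note C0_simps = sym_bilinearD[OF sb(1)]
  have C1_ten: "C1 (ten t u) (ten t u) = 0" for t u
    using inv[of "v2 1 0" t u] by (simp add: F C1_def B1(2))
  obtain c where c: "\<And>x y. C1 x y = c * bJ x y"
    using sym_bilinear_zero_on_ten[OF sb(2) C1_ten] by blast
  have "c \<noteq> 0"
  proof
    assume "c = 0"
    then have "A1 x = 0" for x using c[of "K *v x" "K *v x"] K by (simp add: B1(2) C1_def matrix_vector_mul_assoc)
    then show False using A(3) by auto
  qed
  have ids: "C0 x x = 2 * c * bJ x (L *v x)" "2 * C0 x (L *v x) = c * bJ (L *v x) (L *v x)" "C0 (L *v x) (L *v x) = 0"
    if x: "x = ten t u" for x t u
  proof -
    \<comment> \<open>A polynomial identity in z without constant term; its three coefficients are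
      read off from the values at 1, -1 and 2.\<close>
    have *: "z * C0 x x + 2 * z\<^sup>2 * C0 x (L *v x) + z ^ 3 * C0 (L *v x) (L *v x) =
        2 * c * z * bJ x (L *v x) + c * z\<^sup>2 * bJ (L *v x) (L *v x)" for z
    proof -
      have xx: "bJ x x = 0" using C1_ten[of t u] \<open>c \<noteq> 0\<close> by (simp add: c x)
      have "z * C0 (x + z *s (L *v x)) (x + z *s (L *v x)) = C1 (x + z *s (L *v x)) (x + z *s (L *v x))"
        using inv[of "v2 1 z" t u] by (simp add: F C0_def C1_def B0(2) B1(2) x)
      then show ?thesis
        unfolding c C0_simps bJ_simps xx sym_bilinear_commute[OF sb(1), of "L *v x" x]
          sym_bilinear_commute[OF sym_bilinear_bJ, of "L *v x" x]
        by algebra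
    qed
    have e: "C0 x x + 2 * C0 x (L *v x) + C0 (L *v x) (L *v x) = 2 * c * bJ x (L *v x) + c * bJ (L *v x) (L *v x)"
      "- C0 x x + 2 * C0 x (L *v x) - C0 (L *v x) (L *v x) = - 2 * c * bJ x (L *v x) + c * bJ (L *v x) (L *v x)"
      "2 * C0 x x + 8 * C0 x (L *v x) + 8 * C0 (L *v x) (L *v x) = 4 * c * bJ x (L *v x) + 4 * c * bJ (L *v x) (L *v x)"
      using *[of 1] *[of "- 1"] *[of 2] by simp_all
    show "C0 x x = 2 * c * bJ x (L *v x)" "2 * C0 x (L *v x) = c * bJ (L *v x) (L *v x)" "C0 (L *v x) (L *v x) = 0"
      using e by algebra+
  qed
  have bJc: "bJ x y = bJ y x" for x y by (rule sym_bilinear_commute[OF sym_bilinear_bJ])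
  have C0c: "C0 x y = C0 y x" for x y by (rule sym_bilinear_commute[OF sb(1)])
  have "sym_bilinear (\<lambda>x y. C0 x y - c * (bJ x (L *v y) + bJ y (L *v x)))"
    using C0c by (auto simp: sym_bilinear_def C0_simps bJ_simps matvec_linear algebra_simps)
  then obtain k1 where k1: "\<And>x y. C0 x y - c * (bJ x (L *v y) + bJ y (L *v x)) = k1 * bJ x y"
    by (rule sym_bilinear_zero_on_ten) (use ids(1) in auto)
  have "sym_bilinear (\<lambda>x y. C0 x (L *v y) + C0 y (L *v x) - c * bJ (L *v x) (L *v y))"
    using bJc by (auto simp: sym_bilinear_def C0_simps bJ_simps matvec_linear algebra_simps)
  then obtain k2 where k2: "\<And>x y. C0 x (L *v y) + C0 y (L *v x) - c * bJ (L *v x) (L *v y) = k2 * bJ x y"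
    by (rule sym_bilinear_zero_on_ten) (use ids(2) in auto)
  have "sym_bilinear (\<lambda>x y. C0 (L *v x) (L *v y))"
    using sb(1) by (rule sym_bilinear_matvec)
  then obtain k3 where k3: "\<And>x y. C0 (L *v x) (L *v y) = k3 * bJ x y"
    by (rule sym_bilinear_zero_on_ten) (use ids(3) in auto)
  \<comment> \<open>The 3 makes the linear term in \<open>k2'\<close> equal 6 l
    \<open>bJ x (L x)\<close>, which is what the shift produces: 4 l from 2
    \<open>bJ x (N (N x))\<close> and 2 l from \<open>bJ (N x) (N x)\<close>.\<close>
  define l where "l = k1 / (3 * c)"
  have k1': "C0 x y = c * (bJ x (L *v y) + bJ y (L *v x) + 3 * l * bJ x y)" for x y
    using k1[of x y] \<open>c \<noteq> 0\<close> by (simp add: l_def field_simps)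
  have k2': "c * (2 * bJ x (L *v (L *v x)) + bJ (L *v x) (L *v x) + 6 * l * bJ x (L *v x)) = k2 * bJ x x" for x
    using k2[of x x] unfolding k1' by (simp add: algebra_simps)
  have k3': "c * (2 * bJ (L *v x) (L *v (L *v x)) + 3 * l * bJ (L *v x) (L *v x)) = k3 * bJ x x" for x
    using k3[of x x] unfolding k1' by (simp add: algebra_simps)
  have N: "(L + mat l) *v x = L *v x + l *s x" for x
    by (simp add: matrix_vector_mult_add_rdistrib mat_matvec)
  have op: "pencil_operator (\<lambda>x. (L + mat l) *v x) (k2 / c + 3 * l\<^sup>2) (k3 / c + l * k2 / c + 2 * l ^ 3)"
    if "\<exists>x. (L + mat l) *v ((L + mat l) *v ((L + mat l) *v x)) \<noteq> 0"
  proof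
    fix x
    show "2 * bJ x ((L + mat l) *v ((L + mat l) *v x)) + bJ ((L + mat l) *v x) ((L + mat l) *v x) = (k2 / c + 3 * l\<^sup>2) * bJ x x"
      and "2 * bJ ((L + mat l) *v x) ((L + mat l) *v ((L + mat l) *v x)) = (k3 / c + l * k2 / c + 2 * l ^ 3) * bJ x x"
    proof -
      have "c * (2 * bJ x ((L + mat l) *v ((L + mat l) *v x)) + bJ ((L + mat l) *v x) ((L + mat l) *v x))
          = (k2 + 3 * c * l\<^sup>2) * bJ x x"
        using k2'[of x] unfolding N matvec_linear bJ_simps bJc[of "L *v x" x] by algebra
      then show "2 * bJ x ((L + mat l) *v ((L + mat l) *v x)) + bJ ((L + mat l) *v x) ((L + mat l) *v x) = (k2 / c + 3 * l\<^sup>2) * bJ x x"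
        using \<open>c \<noteq> 0\<close> by (simp add: field_simps)
      have "c * (2 * bJ ((L + mat l) *v x) ((L + mat l) *v ((L + mat l) *v x))) = (k3 + l * k2 + 2 * c * l ^ 3) * bJ x x"
        using k2'[of x] k3'[of x] unfolding N matvec_linear bJ_simps bJc[of "L *v x" x] by algebra
      then show "2 * bJ ((L + mat l) *v x) ((L + mat l) *v ((L + mat l) *v x)) = (k3 / c + l * k2 / c + 2 * l ^ 3) * bJ x x"
        using \<open>c \<noteq> 0\<close> by (simp add: field_simps)
    qed
  next
    fix z r
    assume z: "(L + mat l) *v z = r *s z" "bJ z z = 0" "z $ 1 = 0"
    \<comment> \<open>Since L z = (r - l) z, this is the parameter at which the slice annihilates
      z.\<close>
    define s where "s = v2 (l - r) 1"
    have "s \<noteq> 0" by (simp add: s_def vec_eq_2)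
    have s0: "trilin F s t u = 0" if "z = ten t u" for t u
    proof -
      have "L *v z + l *s z = r *s z" using z(1) unfolding N .
      then have "L *v z = (r - l) *s z" by (simp add: vec_eq_iff algebra_simps)
      then have "s $ 0 *s z + s $ 1 *s (L *v z) = 0" by (simp add: s_def vec_eq_iff algebra_simps)
      then show ?thesis unfolding F that[symmetric] by simp
    qed
    show "z = 0"
    proof (rule ccontr)
      assume "z \<noteq> 0"
      \<comment> \<open>Given \<open>z $ 1 = 0\<close>, isotropy forces the first row or the second
        column of z to vanish, that is, t = (0 : 1) or u = (1 : 0); these are the two faces covered
        by \<open>bt\<close> and \<open>bu\<close>.\<close>
      have "z $ 0 = 0 \<or> z $ 3 = 0" using z(2,3) by (simp add: bJ_def)
      then consider "z = ten (axis 1 1) (v2 (z $ 2) (z $ 3))" | "z = ten (v2 (z $ 0) (z $ 2)) (axis 0 1)"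
        using z(3) by (auto simp: vec_eq_4 ten_def axis_2_eq_v2)
      then show False
      proof cases
        case 1
        then show False using s0[OF 1] bt[OF \<open>s \<noteq> 0\<close>, of "v2 (z $ 2) (z $ 3)"] \<open>z \<noteq> 0\<close>
          by (auto simp: vec_eq_2 vec_eq_4 ten_def)
      next
        case 2
        then show False using s0[OF 2] bu[OF \<open>s \<noteq> 0\<close>, of "v2 (z $ 0) (z $ 2)"] \<open>z \<noteq> 0\<close>
          by (auto simp: vec_eq_2 vec_eq_4 ten_def)
      qed
    qed
  qed (use that in \<open>simp_all add: matvec_linear\<close>)
  show ?thesis
    using that[OF M_L[unfolded M_def]] op by blast
qed

text \<open>
  The quartic \<open>D x y = d * (x - l * y) ^ 4\<close> has \<open>x\<^sup>2 y\<^sup>2\<close>-coefficient \<open>6 * d * l\<^sup>2\<close>, which is half of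
  \<open>D 1 1 + D 1 (- 1) - 2 * D 1 0 - 2 * D 0 1\<close>; so the defect vanishes on fourth powers.
\<close>

definition invariant_defect :: "trilinear \<Rightarrow> complex" where
  "invariant_defect F = (let D = (\<lambda>x y. det (slice F (v2 x y))) in
     (D 1 1 + D 1 (- 1) - 2 * D 1 0 - 2 * D 0 1)\<^sup>2 - 144 * D 1 0 * D 0 1)"

lemma invariant_defect_nilpotent:
  assumes "slice F (axis 1 1) = slice F (axis 0 1) ** L"
    and "\<And>x. (L + mat l) *v ((L + mat l) *v ((L + mat l) *v x)) = 0"
  shows "invariant_defect F = 0"
proof -
  have "det (slice F (v2 x y)) = det (slice F (axis 0 1)) * (x - l * y) ^ 4" for x y
  proof -
    have "slice F (v2 x y) = mat x ** slice F (axis 0 1) + mat y ** slice F (axis 1 1)"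
      by (intro matrix_eqI)
        (simp add: matrix_vector_mult_add_rdistrib matrix_vector_mul_assoc[symmetric] mat_matvec,
         simp add: vec_eq_iff slice_def matrix_vector_mult_def sum_UNIV_4 axis_def algebra_simps)
    also have "\<dots> = slice F (axis 0 1) ** (mat (x - l * y) + mat y ** (L + mat l))"
      unfolding assms(1)
      by (intro matrix_eqI)
        (simp only: matrix_vector_mult_add_rdistrib matrix_vector_mul_assoc[symmetric] mat_matvec matvec_linear,
         simp add: vec_eq_iff algebra_simps)
    finally show ?thesis by (simp add: det_mul det_add_nilpotent[OF assms(2)])
  qed
  moreover have "d * (1 - l) ^ 4 + d * (1 + l) ^ 4 - 2 * d - 2 * (d * l ^ 4) = 12 * d * l\<^sup>2" for d
    by (simp add: eval_nat_numeral algebra_simps)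
  ultimately show ?thesis
    by (simp add: invariant_defect_def power_mult_distrib) (simp add: eval_nat_numeral)
qed

text \<open>The isotropic vectors p and q are rank-one tensors, and their factors form bases of the
  two parameter planes. In the resulting tensor basis the operator is explicit, and matching with
  \<open>nf\<close> needs only rescaling and one change of basis in the target.\<close>

lemma has_normal_form_exists:
  assumes G: "det (slice F (axis 0 1)) \<noteq> 0"
    and bt: "\<And>s u. s \<noteq> 0 \<Longrightarrow> u \<noteq> 0 \<Longrightarrow> trilin F s (axis 1 1) u \<noteq> 0"
    and bu: "\<And>s t. s \<noteq> 0 \<Longrightarrow> t \<noteq> 0 \<Longrightarrow> trilin F s t (axis 0 1) \<noteq> 0"
    and A: "form 2 A0" "form 2 A1" "A1 \<noteq> (\<lambda>_. 0)"
    and inv: "\<And>s t u. s $ 1 * A0 (trilin F s t u) = s $ 0 * A1 (trilin F s t u)"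
    and nondeg: "invariant_defect F \<noteq> 0"
  obtains H f g h where "has_normal_form F H f g h"
proof -
  obtain L l \<nu> \<rho> where L: "slice F (axis 1 1) = slice F (axis 0 1) ** L"
    and op: "(\<exists>x. (L + mat l) *v ((L + mat l) *v ((L + mat l) *v x)) \<noteq> 0) \<longrightarrow>
      pencil_operator (\<lambda>x. (L + mat l) *v x) \<nu> \<rho>"
    using pencil_operator_exists[OF G bt bu A inv] by blast
  define N where "N x = (L + mat l) *v x" for x
  interpret pencil_operator N \<nu> \<rho>
    unfolding N_def using op invariant_defect_nilpotent[OF L] nondeg by blast
  obtain r p q \<mu> where r: "r \<noteq> 0" and pq: "bJ p p = 0" "bJ q q = 0" "bJ p q \<noteq> 0"
    and \<mu>: "\<mu> p = 0" "\<mu> q = 0" "\<And>x y. \<mu> (x + y) = \<mu> x + \<mu> y" "\<And>k x. \<mu> (k *s x) = k * \<mu> x"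
    and N: "\<And>x. N x = r *s (x + \<mu> x *s q - (3 * bJ x q / bJ p q) *s p)"
  proof (rule normal_form)
    fix r p q \<mu>
    assume "r \<noteq> 0" "bJ p p = 0" "bJ q q = 0" "bJ p q \<noteq> 0" "\<mu> p = 0" "\<mu> q = 0"
      "\<And>x y. \<mu> (x + y) = \<mu> x + \<mu> y" "\<And>k x. \<mu> (k *s x) = k * \<mu> x"
      "\<And>x. N x = r *s (x + \<mu> x *s q - (3 * bJ x q / bJ p q) *s p)"
    then show thesis by (rule that)
  qed
  obtain pt0 pu0 where p: "p = ten pt0 pu0" using bJ_zero_ten[OF pq(1)] .
  obtain qt qu where q: "q = ten qt qu" using bJ_zero_ten[OF pq(2)] .
  \<comment> \<open>\<open>bJ p q\<close> is the product of the two 2 by 2 determinants formed by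
    the factors, so both pairs of factors are independent.\<close>
  have ind0: "pt0 $ 0 * qt $ 1 - pt0 $ 1 * qt $ 0 \<noteq> 0" "pu0 $ 0 * qu $ 1 - pu0 $ 1 * qu $ 0 \<noteq> 0"
    using pq(3) by (auto simp: p q bJ_ten)
  have N_fix: "N x = r *s x" if "bJ x q = 0" "\<mu> x = 0" for x
    using that by (simp add: N)
  define \<alpha> where "\<alpha> = \<mu> (ten pt0 qu)"
  define \<beta> where "\<beta> = \<mu> (ten qt pu0)"
  have "\<alpha> \<noteq> 0"
  proof
    assume a: "\<alpha> = 0"
    \<comment> \<open>If \<alpha> = 0, all tensors with second factor \<open>qu\<close> are
      eigenvectors for r. This one has a first factor with vanishing coordinate 0, so
      \<open>z $ 1 = 0\<close>.\<close>
    define z where "z = qt $ 0 *s ten pt0 qu + (- (pt0 $ 0)) *s q"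
    have "bJ z q = 0" "bJ z z = 0" "z $ 1 = 0"
      by (auto simp: z_def q bJ_simps bJ_ten) (simp_all add: ten_def)
    moreover have "\<mu> z = 0" unfolding z_def \<mu> using a by (simp add: \<alpha>_def)
    ultimately have "z = 0" using no_base_line N_fix by blast
    moreover have "z = (qt $ 0 * pt0 $ 1 - pt0 $ 0 * qt $ 1) *s v4 0 0 (qu $ 0) (qu $ 1)"
      by (simp add: z_def q ten_def vec_eq_4 algebra_simps)
    ultimately show False using ind0 by (auto simp: vec_eq_4 algebra_simps)
  qed
  have "\<beta> \<noteq> 0"
  proof
    assume b: "\<beta> = 0"
    \<comment> \<open>Likewise for the tensors with first factor \<open>qt\<close>; here the second
      factor has vanishing coordinate 1.\<close>
    define z where "z = qu $ 1 *s ten qt pu0 + (- (pu0 $ 1)) *s q"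
    have "bJ z q = 0" "bJ z z = 0" "z $ 1 = 0"
      by (auto simp: z_def q bJ_simps bJ_ten) (simp_all add: ten_def)
    moreover have "\<mu> z = 0" unfolding z_def \<mu> using b by (simp add: \<beta>_def)
    ultimately have "z = 0" using no_base_line N_fix by blast
    moreover have "z = (qu $ 1 * pu0 $ 0 - pu0 $ 1 * qu $ 0) *s v4 (qt $ 0) 0 (qt $ 1) 0"
      by (simp add: z_def q ten_def vec_eq_4 algebra_simps)
    ultimately show False using ind0 by (auto simp: vec_eq_4 algebra_simps)
  qed
  \<comment> \<open>The scaling makes \<mu> equal to -3 on both mixed tensors, the same number by
    which N / r - 1 multiplies p.\<close>
  define pt where "pt = (- 3 / \<alpha>) *s pt0"
  define pu where "pu = (- 3 / \<beta>) *s pu0"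
  define dt where "dt = pt $ 0 * qt $ 1 - pt $ 1 * qt $ 0"
  define du where "du = pu $ 0 * qu $ 1 - pu $ 1 * qu $ 0"
  have dt: "dt \<noteq> 0" and du: "du \<noteq> 0"
    using ind0 \<open>\<alpha> \<noteq> 0\<close> \<open>\<beta> \<noteq> 0\<close> by (auto simp: dt_def du_def pt_def pu_def field_simps)
  define e where "e = ten pt qu"
  define e' where "e' = ten qt pu"
  define p' where "p' = ten pt pu"
  have p': "p' = (9 / (\<alpha> * \<beta>)) *s p"
    by (simp add: p'_def p pt_def pu_def ten_def vec_eq_4)
  have ee: "e = (- 3 / \<alpha>) *s ten pt0 qu" "e' = (- 3 / \<beta>) *s ten qt pu0"
    by (simp_all add: e_def e'_def pt_def pu_def ten_def vec_eq_4)
  have \<mu>_e: "\<mu> e = - 3" "\<mu> e' = - 3" "\<mu> p' = 0"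
    unfolding ee p' \<mu> \<alpha>_def[symmetric] \<beta>_def[symmetric] using \<open>\<alpha> \<noteq> 0\<close> \<open>\<beta> \<noteq> 0\<close> by simp_all
  have bq: "bJ e q = 0" "bJ e' q = 0" "bJ q q = 0"
    by (simp_all add: q e_def e'_def bJ_ten)
  have N_e: "N e = r *s (e - 3 *s q)" "N e' = r *s (e' - 3 *s q)" "N q = r *s q" "N p' = (- 2 * r) *s p'"
    using pq(3) \<open>\<alpha> \<noteq> 0\<close> \<open>\<beta> \<noteq> 0\<close>
    by (simp_all add: N \<mu>_e \<mu> bq vec_eq_iff) (simp_all add: p' bJ_simps field_simps)
  \<comment> \<open>The coordinates of \<open>f s\<close> are the eigenvalues of s_0 + s_1 L
    belonging to the roots r and -2 r; \<open>g\<close> and \<open>h\<close> below are coordinates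
    in the new bases, by Cramer's rule.\<close>
  define f where "f s = v2 (s $ 0 + (r - l) * s $ 1) (s $ 0 + (- l - 2 * r) * s $ 1)" for s :: "complex ^ 2"
  define g where "g t = v2 ((t $ 0 * qt $ 1 - t $ 1 * qt $ 0) / dt) ((pt $ 0 * t $ 1 - pt $ 1 * t $ 0) / dt)" for t :: "complex ^ 2"
  define h where "h u = v2 ((u $ 0 * qu $ 1 - u $ 1 * qu $ 0) / du) ((pu $ 0 * u $ 1 - pu $ 1 * u $ 0) / du)" for u :: "complex ^ 2"
  have gl: "gl2 f" "gl2 g" "gl2 h"
  proof -
    have "1 * (- l - 2 * r) - (r - l) * 1 \<noteq> 0" using r by simp
    then show "gl2 f" unfolding gl2_def f_def by (metis mult_1)
    have "qt $ 1 / dt * (pt $ 0 / dt) - (- qt $ 0 / dt) * (- pt $ 1 / dt) = 1 / dt"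
      using dt by (simp add: field_simps) (simp add: dt_def algebra_simps)
    then have "qt $ 1 / dt * (pt $ 0 / dt) - (- qt $ 0 / dt) * (- pt $ 1 / dt) \<noteq> 0" using dt by simp
    then show "gl2 g" unfolding gl2_def g_def
      by (intro exI[of _ "qt $ 1 / dt"] exI[of _ "- qt $ 0 / dt"] exI[of _ "- pt $ 1 / dt"] exI[of _ "pt $ 0 / dt"])
        (simp add: vec_eq_2 diff_divide_distrib mult.commute)
    have "qu $ 1 / du * (pu $ 0 / du) - (- qu $ 0 / du) * (- pu $ 1 / du) = 1 / du"
      using du by (simp add: field_simps) (simp add: du_def algebra_simps)
    then have "qu $ 1 / du * (pu $ 0 / du) - (- qu $ 0 / du) * (- pu $ 1 / du) \<noteq> 0" using du by simp
    then show "gl2 h" unfolding gl2_def h_def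
      by (intro exI[of _ "qu $ 1 / du"] exI[of _ "- qu $ 0 / du"] exI[of _ "- pu $ 1 / du"] exI[of _ "pu $ 0 / du"])
        (simp add: vec_eq_2 diff_divide_distrib mult.commute)
  qed
  have t_dec: "t = g t $ 0 *s pt + g t $ 1 *s qt" for t
    using dt by (simp add: g_def vec_eq_2 field_simps) (simp add: dt_def algebra_simps)
  have u_dec: "u = h u $ 0 *s pu + h u $ 1 *s qu" for u
    using du by (simp add: h_def vec_eq_2 field_simps) (simp add: du_def algebra_simps)
  have ten_dec: "ten t u = (g t $ 0 * h u $ 0) *s p' + (g t $ 0 * h u $ 1) *s e + (g t $ 1 * h u $ 0) *s e' + (g t $ 1 * h u $ 1) *s q" for t u
    by (subst t_dec[of t], subst u_dec[of u]) (simp add: p'_def e_def e'_def q ten_def vec_eq_4 algebra_simps)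
  \<comment> \<open>Since f_1 - f_0 = -3 r s_1, the coefficient of q is f_0 g_1 h_1 + (f_1 -
    f_0)(g_0 h_1 + g_1 h_0). Subtracting q from e and e' absorbs its part - f_0 (g_0 h_1 + g_1 h_0),
    leaving the last coordinate of \<open>nf\<close>.\<close>
  define K :: "complex ^ 4 ^ 4" where "K = (\<chi> i j. v4 (p' $ i) ((e' - q) $ i) ((e - q) $ i) (q $ i) $ j)"
  have K: "K *v y = y $ 0 *s p' + y $ 1 *s (e' - q) + y $ 2 *s (e - q) + y $ 3 *s q" for y
    by (simp add: K_def matrix_vector_mult_def vec_eq_iff sum_UNIV_4 algebra_simps)
  have "inj ((*v) K)"
  proof (rule injI)
    fix x y assume "K *v x = K *v y"
    define d where "d = x - y"
    have "K *v d = 0" using \<open>K *v x = K *v y\<close> by (simp add: d_def matvec_linear)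
    then have 0: "bJ (K *v d) w = 0" for w by (simp add: bJ_simps)
    have b: "bJ p' p' = 0" "bJ e e = 0" "bJ e' e' = 0" "bJ p' e = 0" "bJ p' e' = 0" "bJ e' e = - (dt * du)"
      "bJ p' q = dt * du" "bJ e e' = - (dt * du)" "bJ e p' = 0" "bJ e' p' = 0" "bJ q p' = dt * du" "bJ q e = 0" "bJ q e' = 0"
      by (simp_all add: p'_def e_def e'_def q bJ_ten dt_def du_def algebra_simps)
    have "d $ 0 = 0 \<and> d $ 1 = 0 \<and> d $ 2 = 0 \<and> d $ 3 = 0"
      using 0[of q] 0[of e] 0[of e'] 0[of p'] dt du unfolding K by (simp add: bJ_simps bq b)
    then show "x = y" by (simp add: d_def vec_eq_4)
  qed
  then have "invertible K"
    by (simp add: invertible_left_inverse matrix_left_invertible_injective)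
  moreover have "invertible (slice F (axis 0 1))" using G by (simp add: invertible_det_nz)
  ultimately have inv_H: "invertible (slice F (axis 0 1) ** K)" by (rule invertible_mult[rotated])
  have "trilin F s t u = (slice F (axis 0 1) ** K) *v nf (f s) (g t) (h u)" for s t u
  proof -
    have s01: "s = s $ 0 *s axis 0 1 + s $ 1 *s axis 1 1"
      by (simp add: vec_eq_2 axis_def)
    define X where "X = ten t u"
    have "trilin F s t u = slice F (axis 0 1) *v ((s $ 0 - l * s $ 1) *s X + s $ 1 *s N X)"
      by (subst s01, subst trilin_linear_1)
        (simp only: trilin_slice L X_def[symmetric] N_def matvec_linear matrix_vector_mul_assoc[symmetric]
          matrix_vector_mult_add_rdistrib mat_matvec, simp add: vec_eq_iff algebra_simps)
    also have "(s $ 0 - l * s $ 1) *s X + s $ 1 *s N X = K *v nf (f s) (g t) (h u)"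
      unfolding X_def ten_dec add scale N_e K nf_def v4_nth
      by (simp add: vec_eq_iff f_def algebra_simps)
    finally show ?thesis by (simp add: matrix_vector_mul_assoc)
  qed
  then have "has_normal_form F (slice F (axis 0 1) ** K) f g h"
    unfolding has_normal_form_def using inv_H gl by blast
  then show ?thesis by (rule that)
qed

subsection \<open>Quadrics, lines and pencils\<close>

lemma pt_in_zero_locus:
  assumes "x \<noteq> 0" "form d p"
  shows "pt x \<in> zero_locus {p} \<longleftrightarrow> p x = 0"
proof
  assume "pt x \<in> zero_locus {p}"
  then obtain v where v: "v \<noteq> 0" "p v = 0" "pt x = pt v" by (auto simp: zero_locus_def)
  then obtain c where "x = c *s v" using pt_eq_iff[OF v(1) assms(1)] by auto
  then show "p x = 0" using form_scale[OF assms(2)] v by simp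
qed (use assms in \<open>auto simp: zero_locus_def\<close>)

lemma pt_in_projectivization:
  assumes "x \<noteq> 0" "vec.subspace W"
  shows "pt x \<in> projectivization W \<longleftrightarrow> x \<in> W"
proof
  assume "pt x \<in> projectivization W"
  then obtain v where v: "v \<noteq> 0" "v \<in> W" "pt x = pt v" by (auto simp: projectivization_def)
  then obtain c where "x = c *s v" using pt_eq_iff[OF v(1) assms(1)] by auto
  then show "x \<in> W" using v assms(2) by (simp add: vec.subspace_scale)
qed (use assms in \<open>auto simp: projectivization_def\<close>)

lemma span_pair: "x \<in> vec.span {v, w} \<longleftrightarrow> (\<exists>a b. x = a *s v + b *s w)"
  by (auto simp: vec.span_insert vec.span_singleton algebra_simps diff_eq_eq)

lemma pt_in_join: "x \<noteq> 0 \<Longrightarrow> pt x \<in> join v w \<longleftrightarrow> (\<exists>a b. x = a *s v + b *s w)"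
  by (simp add: join_def pt_in_projectivization vec.subspace_span span_pair)

lemma is_line_join:
  assumes "\<And>a b. a *s v + b *s w = 0 \<Longrightarrow> a = 0 \<and> b = 0"
  shows "is_line (join v w)"
proof -
  have w: "w \<noteq> 0" using assms[of 0 1] by auto
  have "v \<notin> vec.span {w}"
  proof
    assume "v \<in> vec.span {w}"
    then obtain k where "v = k *s w" by (auto simp: vec.span_singleton)
    then show False using assms[of 1 "- k"] by simp
  qed
  moreover from this have "v \<noteq> w" by (auto simp: vec.span_base)
  ultimately have "vec.independent {v, w}" "card {v, w} = 2"
    using w by (auto simp: vec.independent_insert)
  then have "vec.dim (vec.span {v, w}) = 2" by (metis vec.dim_span_eq_card_independent)
  then show ?thesis unfolding is_line_def join_def using vec.subspace_span by blast
qed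

lemma zariski_closure_zero_locus:
  assumes "form d p"
  shows "zariski_closure (zero_locus {p}) = zero_locus {p}"
proof -
  have "zariski_closed (zero_locus {p})"
    using assms unfolding zariski_closed_def by (intro exI[of _ "{p}"]) auto
  then show ?thesis unfolding zariski_closure_def by auto
qed

text \<open>Each of two complementary coordinate planes contains a nonzero vector killed by g; some
  combination of these two vectors is killed by h as well.\<close>

lemma common_zero_of_linear_pair:
  assumes "form 1 g" "form 1 h"
  obtains v :: "complex ^ 4" where "v \<noteq> 0" "g v = 0" "h v = 0"
proof -
  have comb: "\<exists>a b. (a, b) \<noteq> (0, 0) \<and> p (a *s v + b *s w) = 0" if "form 1 p" for p and v w :: "complex ^ 4"
  proof (cases "p v = 0")
    case True
    then show ?thesis using form_scale[OF that] by (intro exI[of _ 1] exI[of _ 0]) simp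
  next
    case False
    have "p (p w *s v + (- p v) *s w) = 0"
      unfolding form_1_linear[OF that] form_scale[OF that] by simp
    with False show ?thesis by (intro exI[of _ "p w"] exI[of _ "- p v"]) simp
  qed
  obtain a b where ab: "(a, b) \<noteq> (0, 0)" "g (a *s v4 1 0 0 0 + b *s v4 0 1 0 0) = 0"
    using comb[OF assms(1)] by blast
  obtain c d where cd: "(c, d) \<noteq> (0, 0)" "g (c *s v4 0 0 1 0 + d *s v4 0 0 0 1) = 0"
    using comb[OF assms(1)] by blast
  obtain k l where kl: "(k, l) \<noteq> (0, 0)"
    "h (k *s (a *s v4 1 0 0 0 + b *s v4 0 1 0 0) + l *s (c *s v4 0 0 1 0 + d *s v4 0 0 0 1)) = 0"
    using comb[OF assms(2)] by blast
  show ?thesis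
  proof (rule that)
    show "k *s (a *s v4 1 0 0 0 + b *s v4 0 1 0 0) + l *s (c *s v4 0 0 1 0 + d *s v4 0 0 0 1) \<noteq> 0"
      using ab(1) cd(1) kl(1) by (auto simp: vec_eq_4)
    show "g (k *s (a *s v4 1 0 0 0 + b *s v4 0 1 0 0) + l *s (c *s v4 0 0 1 0 + d *s v4 0 0 0 1)) = 0"
      using ab(2) cd(2) unfolding form_1_linear[OF assms(1)] form_scale[OF assms(1)] by simp
  qed (rule kl(2))
qed

text \<open>The partial derivatives at v are 2 \<open>B v\<close> on the coordinate vectors, so a
  singular point lies in the radical. So does a common zero of two linear factors, which excludes a
  factorization.\<close>

lemma nondegenerate_quadric:
  fixes B :: "complex ^ 4 \<Rightarrow> complex ^ 4 \<Rightarrow> complex"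
  assumes B: "sym_bilinear B" "form 2 (\<lambda>x. B x x)" and nd: "\<And>v. (\<And>w. B v w = 0) \<Longrightarrow> v = 0"
  shows "smooth_surface (zero_locus {\<lambda>x. B x x})" "quadric_surface (zero_locus {\<lambda>x. B x x})"
proof -
  note [simp] = sym_bilinearD[OF B(1)]
  have c: "B x y = B y x" for x y by (rule sym_bilinear_commute[OF B(1)])
  have dv: "\<exists>i. deriv (\<lambda>z. B (v + z *s axis i 1) (v + z *s axis i 1)) 0 \<noteq> 0" if "v \<noteq> 0" for v
  proof (rule ccontr)
    assume "\<not> ?thesis"
    then have d0: "deriv (\<lambda>z. B (v + z *s axis i 1) (v + z *s axis i 1)) 0 = 0" for i by blast
    have "B v (axis i 1) = 0" for i
    proof -
      have "B (v + z *s axis i 1) (v + z *s axis i 1) = B v v + 2 * z * B v (axis i 1) + z * z * B (axis i 1) (axis i 1)" for z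
        using c[of "axis i 1" v] by (simp add: algebra_simps)
      then have "((\<lambda>z. B (v + z *s axis i 1) (v + z *s axis i 1)) has_field_derivative 2 * B v (axis i 1)) (at 0)"
        by (simp only:) (auto intro!: derivative_eq_intros)
      then show ?thesis using d0[of i] by (simp add: DERIV_imp_deriv)
    qed
    then have 0: "B v (axis i 1) = 0" for i .
    have "B v w = 0" for w
    proof -
      have "w = w $ 0 *s axis 0 1 + w $ 1 *s axis 1 1 + w $ 2 *s axis 2 1 + w $ 3 *s axis 3 1"
        by (simp add: vec_eq_4 axis_def)
      then have "B v w = B v (w $ 0 *s axis 0 1 + w $ 1 *s axis 1 1 + w $ 2 *s axis 2 1 + w $ 3 *s axis 3 1)"
        by simp
      then show ?thesis by (simp add: 0)
    qed
    then show False using nd that by blast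
  qed
  show "smooth_surface (zero_locus {\<lambda>x. B x x})"
    unfolding smooth_surface_def
  proof (rule exI[of _ 2], rule exI[of _ "\<lambda>x. B x x"], intro conjI allI impI)
    show "1 \<le> (2::nat)" by simp
    show "form 2 (\<lambda>x. B x x)" by (rule B(2))
    show "zero_locus {\<lambda>x. B x x} = zero_locus {\<lambda>x. B x x}" ..
    fix v assume "v \<noteq> 0 \<and> B v v = 0"
    then show "\<exists>i. deriv (\<lambda>z. B (v + z *s axis i 1) (v + z *s axis i 1)) 0 \<noteq> 0"
      using dv by blast
  qed
  have "\<not> (\<exists>g h. form 1 g \<and> form 1 h \<and> (\<lambda>x. B x x) = (\<lambda>v. g v * h v))"
  proof (rule notI, elim exE conjE)
    fix g h assume gh: "form 1 g" "form 1 h" "(\<lambda>x. B x x) = (\<lambda>v. g v * h v)"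
    obtain v where v: "v \<noteq> 0" "g v = 0" "h v = 0" by (rule common_zero_of_linear_pair[OF gh(1,2)])
    have e: "B x x = g x * h x" for x using gh(3) by (rule fun_cong)
    have "B v w = 0" for w
      using e[of "v + w"] e[of w] e[of v] v(2,3) c[of w v] form_1_linear[OF gh(1), of v w] form_1_linear[OF gh(2), of v w]
      by simp
    then show False using nd v(1) by blast
  qed
  then show "quadric_surface (zero_locus {\<lambda>x. B x x})"
    unfolding quadric_surface_def using B(2) by blast
qed

section \<open>Changes of parameter and the pencils of quadrics of the normal form\<close>

lemma gl2_inverse:
  assumes "gl2 h"
  obtains k where "\<And>s. h (k s) = s"
proof -
  obtain a b c d where n: "a * d - b * c \<noteq> 0" and h: "\<And>s. h s = v2 (a * s $ 0 + b * s $ 1) (c * s $ 0 + d * s $ 1)"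
    using assms by (auto simp: gl2_def)
  define m where "m = a * d - b * c"
  have "h (v2 ((d * s $ 0 - b * s $ 1) / m) ((a * s $ 1 - c * s $ 0) / m)) = s" for s
    using n by (simp add: h vec_eq_2 m_def[symmetric] field_simps) (simp add: m_def algebra_simps)
  then show ?thesis by (rule that)
qed

lemma gl2_zero: "gl2 h \<Longrightarrow> h 0 = 0"
  by (auto simp: gl2_def vec_eq_2)

lemma gl2_axes: "gl2 h \<Longrightarrow> h (axis 0 1) $ 0 * h (axis 1 1) $ 1 \<noteq> h (axis 0 1) $ 1 * h (axis 1 1) $ 0"
  by (auto simp: gl2_def axis_def algebra_simps)

definition qf :: "complex ^ 4 \<Rightarrow> complex" where
  "qf y = y $ 0 * y $ 1 + y $ 1 * y $ 2 + y $ 0 * y $ 2"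

text \<open>For i = 0, 1, 2 this is the equation of the surface on which the i-th parameter of
  \<open>nf\<close> is held at s: its affine value s_1 / s_0 is x_3 x_i / q.\<close>

definition pencil :: "4 \<Rightarrow> complex ^ 2 \<Rightarrow> complex ^ 4 \<Rightarrow> complex" where
  "pencil i s y = s $ 1 * qf y - s $ 0 * (y $ 3 * y $ i)"

definition pencil_polar :: "4 \<Rightarrow> complex ^ 2 \<Rightarrow> complex ^ 4 \<Rightarrow> complex ^ 4 \<Rightarrow> complex" where
  "pencil_polar i s x y = (s $ 1 * (x $ 0 * y $ 1 + x $ 1 * y $ 0 + x $ 1 * y $ 2 + x $ 2 * y $ 1 + x $ 0 * y $ 2 + x $ 2 * y $ 0)
     - s $ 0 * (x $ 3 * y $ i + x $ i * y $ 3)) / 2"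

lemma pencil_eq_polar: "pencil i s y = pencil_polar i s y y"
  by (simp add: pencil_def pencil_polar_def qf_def algebra_simps)

lemma pencil_nf: "pencil 0 s (nf s t u) = 0" "pencil 1 t (nf s t u) = 0" "pencil 2 u (nf s t u) = 0"
  by (simp_all add: pencil_def qf_def nf_def algebra_simps)

text \<open>For fixed s with both coordinates nonzero, \<open>nf\<close> is an invertible linear
  function of the tensor of t and u. The tensor \<open>X\<close> solves it for y, and the pencil
  equation says that \<open>X\<close> has determinant 0.\<close>

lemma nf_onto:
  assumes "s $ 0 \<noteq> 0" "s $ 1 \<noteq> 0" "pencil 0 s y = 0"
  obtains t u where "nf s t u = y"
proof -
  define X where "X = v4 (y $ 0 / s $ 1) (y $ 2 / s $ 0) (y $ 1 / s $ 0) ((y $ 3 - s $ 1 * (y $ 1 / s $ 0 + y $ 2 / s $ 0)) / s $ 0)"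
  have "y $ 0 / s $ 1 * ((y $ 3 - s $ 1 * (y $ 1 / s $ 0 + y $ 2 / s $ 0)) / s $ 0) = y $ 2 / s $ 0 * (y $ 1 / s $ 0)"
    using assms(1,2) assms(3)[unfolded pencil_def qf_def] by (simp add: divide_simps) algebra
  then have "bJ X X = 0"
    by (simp add: X_def bJ_def mult.commute)
  then obtain t u where "X = ten t u" by (rule bJ_zero_ten)
  then have X: "t $ 0 * u $ 0 = y $ 0 / s $ 1" "t $ 0 * u $ 1 = y $ 2 / s $ 0" "t $ 1 * u $ 0 = y $ 1 / s $ 0"
     "t $ 1 * u $ 1 = (y $ 3 - s $ 1 * (y $ 1 / s $ 0 + y $ 2 / s $ 0)) / s $ 0"
    by (auto simp: X_def ten_def vec_eq_4)
  have "nf s t u = y"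
    unfolding nf_def vec_eq_4 v4_nth mult.assoc X using assms by simp
  then show ?thesis by (rule that)
qed

lemma pencil_pair:
  assumes "a * d \<noteq> b * (c :: complex)"
  shows "b * p - a * q = 0 \<and> d * p - c * q = 0 \<longleftrightarrow> p = 0 \<and> q = 0"
proof
  assume *: "b * p - a * q = 0 \<and> d * p - c * q = 0"
  then have "(a * d - b * c) * p = 0" "(a * d - b * c) * q = 0" by algebra+
  then show "p = 0 \<and> q = 0" using assms by simp
qed simp

section \<open>Exchange of the parameters\<close>

definition swap_st :: "trilinear \<Rightarrow> trilinear" where
  "swap_st F = (\<chi> p. case p of (l, i, j, k) \<Rightarrow> F $ (l, j, i, k))"

definition swap_su :: "trilinear \<Rightarrow> trilinear" where
  "swap_su F = (\<chi> p. case p of (l, i, j, k) \<Rightarrow> F $ (l, k, j, i))"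

lemma swap_trilin: "trilin (swap_st F) s t u = trilin F t s u" "trilin (swap_su F) s t u = trilin F u t s"
  by (simp_all add: vec_eq_iff trilin_nth swap_st_def swap_su_def sum_UNIV_2 algebra_simps)

lemma ctrl_trilin: "ctrl F i j k = trilin F (axis i 1) (axis j 1) (axis k 1)"
proof -
  have "\<forall>i j k. ctrl F i j k = trilin F (axis i 1) (axis j 1) (axis k 1)"
    by (simp add: all_2 vec_eq_iff trilin_nth sum_UNIV_2 axis_def ctrl_def)
  then show ?thesis by blast
qed

text \<open>These translations allow the geometry to be done for the s-direction and then applied to
  the swapped maps.\<close>

lemma swap_boundary:
  "T_surf F j = Sigma_surf (swap_st F) j"
  "t_line F i k = s_line (swap_st F) i k" "u_line F i j = s_line (swap_su F) j i"
  "s_line F j k = t_line (swap_st F) j k" "u_line F i j = u_line (swap_st F) j i"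
  by (simp_all add: T_surf_def Sigma_surf_def s_line_def t_line_def u_line_def ctrl_trilin swap_trilin)

lemma swap_Y_surf: "Y_surf F k = Sigma_surf (swap_su F) k"
  unfolding Y_surf_def Sigma_surf_def swap_trilin by (rule arg_cong[where f = zariski_closure]) blast

subsection \<open>The geometry of the normal form\<close>

lemma gl2_onto:
  assumes "gl2 h" "v \<noteq> 0"
  obtains s where "s \<noteq> 0" "h s = v"
  using gl2_inverse[OF assms(1)] gl2_zero[OF assms(1)] assms(2) by metis

lemma gl2_axes_inj:
  assumes "gl2 h" "h (axis i 1) $ 0 * h (axis j 1) $ 1 = h (axis i 1) $ 1 * h (axis j 1) $ 0"
  shows "i = j"
proof -
  have "\<forall>i j. h (axis i 1) $ 0 * h (axis j 1) $ 1 = h (axis i 1) $ 1 * h (axis j 1) $ 0 \<longrightarrow> i = j"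
    using gl2_axes[OF assms(1)] by (auto simp: all_2 mult.commute)
  then show ?thesis using assms(2) by blast
qed

lemma form_mult_linear: "form 1 p \<Longrightarrow> form 1 q \<Longrightarrow> form 2 (\<lambda>x. p x * q x)"
  using form_mult[of 1 p 1 q] by (simp add: numeral_2_eq_2)

lemma sym_bilinear_pencil_polar: "sym_bilinear (pencil_polar i s)"
  unfolding sym_bilinear_def pencil_polar_def by (auto simp: algebra_simps add_divide_distrib diff_divide_distrib)

lemma v4_zero_iff: "v4 a b c d = 0 \<longleftrightarrow> a = 0 \<and> b = 0 \<and> c = 0 \<and> d = 0"
  by (simp add: vec_eq_4)

lemma v4_linear: "k *s v4 a b c d = v4 (k * a) (k * b) (k * c) (k * d)"
  "v4 a b c d + v4 a' b' c' d' = v4 (a + a') (b + b') (c + c') (d + d')"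
  by (simp_all add: vec_eq_4)

lemma qf_nf: "qf (nf s t u) = s $ 0 * t $ 0 * u $ 0 * nf s t u $ 3"
  by (simp add: qf_def nf_def algebra_simps)

text \<open>The three \<open>no_base\<close> conditions keep the boundary faces clear of base
  points; they are what forces the boundary parameters of the normal form away from 0 and
  infinity.\<close>

locale normal_form_map =
  fixes F :: trilinear and H Hi :: "complex ^ 4 ^ 4" and f g h :: "complex ^ 2 \<Rightarrow> complex ^ 2"
  assumes inverse: "H ** Hi = mat 1" "Hi ** H = mat 1" and gl: "gl2 f" "gl2 g" "gl2 h"
    and nf: "trilin F s t u = H *v nf (f s) (g t) (h u)"
    and no_base_s: "t \<noteq> 0 \<Longrightarrow> u \<noteq> 0 \<Longrightarrow> trilin F (axis i 1) t u \<noteq> 0"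
    and no_base_t: "s \<noteq> 0 \<Longrightarrow> u \<noteq> 0 \<Longrightarrow> trilin F s (axis j 1) u \<noteq> 0"
    and no_base_u: "s \<noteq> 0 \<Longrightarrow> t \<noteq> 0 \<Longrightarrow> trilin F s t (axis k 1) \<noteq> 0"
begin

lemma inverse_vec [simp]: "Hi *v (H *v y) = y" "H *v (Hi *v x) = x"
  by (simp_all add: matrix_vector_mul_assoc inverse)

lemma inverse_zero_iff [simp]: "Hi *v x = 0 \<longleftrightarrow> x = 0" "H *v x = 0 \<longleftrightarrow> x = 0"
  by (metis inverse_vec matrix_vector_mult_0_right)+

lemma Hi_trilin [simp]: "Hi *v trilin F s t u = nf (f s) (g t) (h u)"
  by (simp add: nf)

lemma axis_neq_0 [simp]: "axis i 1 \<noteq> (0 :: complex ^ 2)"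
  by (simp add: axis_eq_0_iff)

text \<open>In affine terms the normal form is undefined where all three parameters are infinite or
  all are 0.\<close>

lemma base_point_0:
  assumes "f s $ 0 = 0 \<and> g t $ 0 = 0 \<and> h u $ 0 = 0 \<or> f s $ 1 = 0 \<and> g t $ 1 = 0 \<and> h u $ 1 = 0"
  shows "trilin F s t u = 0"
proof -
  have "nf (f s) (g t) (h u) = 0" using assms by (auto simp: nf_def vec_eq_4)
  then show ?thesis by (simp add: nf)
qed

text \<open>Otherwise suitable t and u would complete the face parameter to one of these two base
  points.\<close>

lemma f_axis: "f (axis i 1) $ 0 \<noteq> 0" "f (axis i 1) $ 1 \<noteq> 0"
proof -
  obtain t u where "t \<noteq> 0" "u \<noteq> 0" "g t = v2 0 1" "h u = v2 0 1"
    using gl2_onto[OF gl(2)] gl2_onto[OF gl(3)] by (metis v2_nth(2) zero_index zero_neq_one)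
  then show "f (axis i 1) $ 0 \<noteq> 0" using no_base_s[of t u i] base_point_0[of "axis i 1" t u] by auto
  obtain t u where "t \<noteq> 0" "u \<noteq> 0" "g t = v2 1 0" "h u = v2 1 0"
    using gl2_onto[OF gl(2)] gl2_onto[OF gl(3)] by (metis v2_nth(1) zero_index zero_neq_one)
  then show "f (axis i 1) $ 1 \<noteq> 0" using no_base_s[of t u i] base_point_0[of "axis i 1" t u] by auto
qed

lemma g_axis: "g (axis i 1) $ 0 \<noteq> 0" "g (axis i 1) $ 1 \<noteq> 0"
proof -
  obtain s u where "s \<noteq> 0" "u \<noteq> 0" "f s = v2 0 1" "h u = v2 0 1"
    using gl2_onto[OF gl(1)] gl2_onto[OF gl(3)] by (metis v2_nth(2) zero_index zero_neq_one)
  then show "g (axis i 1) $ 0 \<noteq> 0" using no_base_t[of s u i] base_point_0[of s "axis i 1" u] by auto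
  obtain s u where "s \<noteq> 0" "u \<noteq> 0" "f s = v2 1 0" "h u = v2 1 0"
    using gl2_onto[OF gl(1)] gl2_onto[OF gl(3)] by (metis v2_nth(1) zero_index zero_neq_one)
  then show "g (axis i 1) $ 1 \<noteq> 0" using no_base_t[of s u i] base_point_0[of s "axis i 1" u] by auto
qed

lemma h_axis: "h (axis i 1) $ 0 \<noteq> 0" "h (axis i 1) $ 1 \<noteq> 0"
proof -
  obtain s t where "s \<noteq> 0" "t \<noteq> 0" "f s = v2 0 1" "g t = v2 0 1"
    using gl2_onto[OF gl(1)] gl2_onto[OF gl(2)] by (metis v2_nth(2) zero_index zero_neq_one)
  then show "h (axis i 1) $ 0 \<noteq> 0" using no_base_u[of s t i] base_point_0[of s t "axis i 1"] by auto
  obtain s t where "s \<noteq> 0" "t \<noteq> 0" "f s = v2 1 0" "g t = v2 1 0"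
    using gl2_onto[OF gl(1)] gl2_onto[OF gl(2)] by (metis v2_nth(1) zero_index zero_neq_one)
  then show "h (axis i 1) $ 1 \<noteq> 0" using no_base_u[of s t i] base_point_0[of s t "axis i 1"] by auto
qed

lemma form_qf: "form 2 (\<lambda>x. qf (Hi *v x))"
  unfolding qf_def by (intro form_add form_mult_linear form_matvec)

lemma form_pencil: "form 2 (\<lambda>x. pencil i s (Hi *v x))"
  unfolding pencil_def by (intro form_diff form_cmult form_qf form_mult_linear form_matvec)

definition pencil_surface :: "4 \<Rightarrow> complex ^ 2 \<Rightarrow> 4 proj set" where
  "pencil_surface i s = zero_locus {\<lambda>x. pencil i s (Hi *v x)}"

lemma pt_in_pencil_surface: "x \<noteq> 0 \<Longrightarrow> pt x \<in> pencil_surface i s \<longleftrightarrow> pencil i s (Hi *v x) = 0"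
  unfolding pencil_surface_def by (rule pt_in_zero_locus[OF _ form_pencil])

text \<open>By \<open>nf_onto\<close> the face already covers the whole quadric, so its image is
  closed.\<close>

lemma Sigma_surf_eq: "Sigma_surf F i = pencil_surface 0 (f (axis i 1))"
proof -
  let ?s = "f (axis i 1)"
  have "{pt (trilin F (axis i 1) t u) | t u. t \<noteq> 0 \<and> u \<noteq> 0 \<and> trilin F (axis i 1) t u \<noteq> 0} = pencil_surface 0 ?s"
  proof (intro equalityI subsetI)
    fix P assume "P \<in> {pt (trilin F (axis i 1) t u) | t u. t \<noteq> 0 \<and> u \<noteq> 0 \<and> trilin F (axis i 1) t u \<noteq> 0}"
    then show "P \<in> pencil_surface 0 ?s"
      by (auto simp: pt_in_pencil_surface pencil_nf)
  next
    fix P assume P: "P \<in> pencil_surface 0 ?s"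
    obtain x where x: "x \<noteq> 0" "P = pt x" by (rule proj_cases)
    then have "pencil 0 ?s (Hi *v x) = 0" using P pt_in_pencil_surface by blast
    then obtain t' u' where tu: "nf ?s t' u' = Hi *v x" by (rule nf_onto[OF f_axis])
    obtain t u where "g t = t'" "h u = u'" using gl2_inverse[OF gl(2)] gl2_inverse[OF gl(3)] by metis
    then have "x = trilin F (axis i 1) t u" using tu by (simp add: nf)
    moreover from this have "t \<noteq> 0" "u \<noteq> 0" using x(1) by (auto simp: trilin_0)
    ultimately show "P \<in> {pt (trilin F (axis i 1) t u) | t u. t \<noteq> 0 \<and> u \<noteq> 0 \<and> trilin F (axis i 1) t u \<noteq> 0}"
      using x by blast
  qed
  then show ?thesis
    unfolding Sigma_surf_def by (simp add: pencil_surface_def zariski_closure_zero_locus[OF form_pencil])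
qed

lemma Sigma_quadric: "smooth_surface (Sigma_surf F i)" "quadric_surface (Sigma_surf F i)"
proof -
  let ?B = "\<lambda>x y. pencil_polar 0 (f (axis i 1)) (Hi *v x) (Hi *v y)"
  have "sym_bilinear ?B" by (rule sym_bilinear_matvec[OF sym_bilinear_pencil_polar])
  moreover have "form 2 (\<lambda>x. ?B x x)" unfolding pencil_eq_polar[symmetric] by (rule form_pencil)
  moreover have "v = 0" if "\<And>w. ?B v w = 0" for v
  proof -
    define y where "y = Hi *v v"
    have "pencil_polar 0 (f (axis i 1)) y w = 0" for w using that[of "H *v w"] by (simp add: y_def)
    from this[of "v4 1 0 0 0"] this[of "v4 0 1 0 0"] this[of "v4 0 0 1 0"] this[of "v4 0 0 0 1"]
    have "y = 0" using f_axis[of i] by (auto simp: pencil_polar_def vec_eq_4)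
    then show "v = 0" by (simp add: y_def)
  qed
  ultimately have "smooth_surface (zero_locus {\<lambda>x. ?B x x})" "quadric_surface (zero_locus {\<lambda>x. ?B x x})"
    using nondegenerate_quadric by blast+
  then show "smooth_surface (Sigma_surf F i)" "quadric_surface (Sigma_surf F i)"
    by (simp_all add: Sigma_surf_eq pencil_surface_def pencil_eq_polar)
qed

lemma pencil_surface_neq:
  assumes "s $ 0 \<noteq> 0" "t $ 1 \<noteq> 0"
  shows "pencil_surface 0 s \<noteq> pencil_surface 1 t" "pencil_surface 0 s \<noteq> pencil_surface 2 t"
    "pencil_surface 1 s \<noteq> pencil_surface 2 t"
proof -
  have *: "pencil_surface i s \<noteq> pencil_surface j t" if "pencil i s y = 0" "pencil j t y \<noteq> 0" "y \<noteq> 0" for i j y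
    using that pt_in_pencil_surface[of "H *v y" i s] pt_in_pencil_surface[of "H *v y" j t] by auto
  \<comment> \<open>The test points have \<open>qf\<close> equal to 1 and coordinate j equal to 0,
    so the equation with index j takes the value t_1; the last coordinate is chosen to satisfy the
    other equation.\<close>
  show "pencil_surface 0 s \<noteq> pencil_surface 1 t"
    by (rule *[of _ "v4 1 0 1 (s $ 1 / s $ 0)"]) (use assms in \<open>auto simp: pencil_def qf_def v4_zero_iff\<close>)
  show "pencil_surface 0 s \<noteq> pencil_surface 2 t" "pencil_surface 1 s \<noteq> pencil_surface 2 t"
    by (rule *[of _ "v4 1 1 0 (s $ 1 / s $ 0)"]; use assms in \<open>auto simp: pencil_def qf_def vec_eq_4\<close>)+
qed

text \<open>Two independent members span the pencil, so they meet exactly in its base locus.\<close>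

lemma pencil_pair_axes:
  assumes "gl2 k"
  shows "pencil i (k (axis 0 1)) y = 0 \<and> pencil i (k (axis 1 1)) y = 0 \<longleftrightarrow> qf y = 0 \<and> y $ 3 * y $ i = 0"
  unfolding pencil_def by (rule pencil_pair) (use gl2_axes[OF assms] in simp)

lemma Sigma_distinct: "Sigma_surf F 0 \<noteq> Sigma_surf F 1"
proof
  let ?s = "f (axis 0 1)"
  let ?y = "v4 1 0 1 (?s $ 1 / ?s $ 0)"
  assume "Sigma_surf F 0 = Sigma_surf F 1"
  then have "pencil 0 ?s ?y = 0 \<longleftrightarrow> pencil 0 (f (axis 1 1)) ?y = 0"
    using pt_in_pencil_surface[of "H *v ?y" 0 ?s] pt_in_pencil_surface[of "H *v ?y" 0 "f (axis 1 1)"]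
    by (simp add: Sigma_surf_eq v4_zero_iff)
  moreover have "pencil 0 ?s ?y = 0" using f_axis[of 0] by (simp add: pencil_def qf_def)
  ultimately have "qf ?y = 0" using pencil_pair_axes[OF gl(1), of 0 ?y] by simp
  then show False by (simp add: qf_def)
qed

lemma pt_in_s_line: "x \<noteq> 0 \<Longrightarrow> pt x \<in> s_line F j k \<longleftrightarrow> (\<exists>s. x = trilin F s (axis j 1) (axis k 1))"
proof -
  have e: "(\<exists>a b. P (a *s axis 0 1 + b *s axis 1 1)) \<longleftrightarrow> (\<exists>s. P s)" for P :: "complex ^ 2 \<Rightarrow> bool"
  proof
    assume "\<exists>s. P s"
    then obtain s where "P s" ..
    moreover have "s = s $ 0 *s axis 0 1 + s $ 1 *s axis 1 1" by (simp add: vec_eq_2 axis_def)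
    ultimately show "\<exists>a b. P (a *s axis 0 1 + b *s axis 1 1)" by metis
  qed auto
  show "x \<noteq> 0 \<Longrightarrow> ?thesis"
    unfolding s_line_def ctrl_trilin
    using e[of "\<lambda>s. x = trilin F s (axis j 1) (axis k 1)"] by (simp add: pt_in_join trilin_linear_1)
qed

lemma is_line_s: "is_line (s_line F j k)"
  unfolding s_line_def ctrl_trilin
proof (rule is_line_join)
  fix a b assume "a *s trilin F (axis 0 1) (axis j 1) (axis k 1) + b *s trilin F (axis 1 1) (axis j 1) (axis k 1) = 0"
  then have "trilin F (a *s axis 0 1 + b *s axis 1 1) (axis j 1) (axis k 1) = 0"
    by (simp add: trilin_linear_1)
  then have "a *s axis 0 1 + b *s axis 1 1 = (0 :: complex ^ 2)"
    using no_base_t by (metis axis_neq_0)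
  then show "a = 0 \<and> b = 0" by (simp add: vec_eq_2 axis_def)
qed

text \<open>The point of affine parameter 0 separates boundary lines: as x_0 = 0 and
  \<open>qf\<close> is nonzero, it lies on neither surface \<open>Sigma_surf F i\<close>, hence on
  no t-line or u-line.\<close>

lemma s_line_point:
  obtains x where "x \<noteq> 0" "pt x \<in> s_line F j k" "(Hi *v x) $ 0 = 0" "qf (Hi *v x) \<noteq> 0"
    "Hi *v x = nf (v2 1 0) (g (axis j 1)) (h (axis k 1))"
proof -
  have "v2 1 0 \<noteq> 0" by (simp add: vec_eq_2)
  then obtain s where s: "s \<noteq> 0" "f s = v2 1 0" by (rule gl2_onto[OF gl(1)])
  define x where "x = trilin F s (axis j 1) (axis k 1)"
  have x: "x \<noteq> 0" using no_base_t[OF s(1)] by (simp add: x_def)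
  show ?thesis
  proof (rule that[OF x])
    show "pt x \<in> s_line F j k" using x by (auto simp: pt_in_s_line x_def)
    show "qf (Hi *v x) \<noteq> 0" using g_axis[of j] h_axis[of k] by (simp add: x_def s qf_nf) (simp add: nf_def)
  qed (simp_all add: x_def s nf_def)
qed

text \<open>The pencils with index 1 and 2 recover the t- and u-parameters of the chosen point, and
  the two boundary values of each are projectively distinct.\<close>

lemma s_line_inj:
  assumes "s_line F j k = s_line F j' k'"
  shows "j = j' \<and> k = k'"
proof -
  obtain x where x: "x \<noteq> 0" "pt x \<in> s_line F j k"
    and y: "Hi *v x = nf (v2 1 0) (g (axis j 1)) (h (axis k 1))"
    by (rule s_line_point)
  obtain s where "x = trilin F s (axis j' 1) (axis k' 1)"
    using x assms by (auto simp: pt_in_s_line)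
  then have "pencil 1 (g (axis j' 1)) (Hi *v x) = 0" "pencil 2 (h (axis k' 1)) (Hi *v x) = 0"
    by (simp_all add: pencil_nf)
  then have "g (axis j 1) $ 1 * h (axis k 1) $ 0 * h (axis k 1) $ 1 *
        (g (axis j' 1) $ 0 * g (axis j 1) $ 1 - g (axis j' 1) $ 1 * g (axis j 1) $ 0) = 0"
    "h (axis k 1) $ 1 * g (axis j 1) $ 0 * g (axis j 1) $ 1 *
        (h (axis k' 1) $ 0 * h (axis k 1) $ 1 - h (axis k' 1) $ 1 * h (axis k 1) $ 0) = 0"
    unfolding y pencil_def qf_def nf_def v4_nth v2_nth by algebra+
  then show ?thesis
    using g_axis[of j] h_axis[of k] gl2_axes_inj[OF gl(2), of j' j] gl2_axes_inj[OF gl(3), of k' k] by (auto simp: mult.commute)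
qed

lemma s_line_neq: "s_line F j k \<noteq> t_line F i k'" "s_line F j k \<noteq> u_line F i j'"
proof -
  obtain x where x: "x \<noteq> 0" "pt x \<in> s_line F j k" "(Hi *v x) $ 0 = 0" "qf (Hi *v x) \<noteq> 0"
    by (rule s_line_point)
  have *: False if "x = trilin F (axis i 1) t u" for t u
  proof -
    have "pencil 0 (f (axis i 1)) (Hi *v x) = 0" by (simp add: that pencil_nf)
    then show False using x(3,4) f_axis[of i] by (simp add: pencil_def)
  qed
  show "s_line F j k \<noteq> t_line F i k'"
  proof
    assume "s_line F j k = t_line F i k'"
    then obtain a b where "x = a *s ctrl F i 0 k' + b *s ctrl F i 1 k'"
      using x(1,2) by (auto simp: t_line_def pt_in_join)
    then have "x = trilin F (axis i 1) (a *s axis 0 1 + b *s axis 1 1) (axis k' 1)"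
      by (simp only: ctrl_trilin trilin_linear_2)
    then show False by (rule *)
  qed
  show "s_line F j k \<noteq> u_line F i j'"
  proof
    assume "s_line F j k = u_line F i j'"
    then obtain a b where "x = a *s ctrl F i j' 0 + b *s ctrl F i j' 1"
      using x(1,2) by (auto simp: u_line_def pt_in_join)
    then have "x = trilin F (axis i 1) (axis j' 1) (a *s axis 0 1 + b *s axis 1 1)"
      by (simp only: ctrl_trilin trilin_linear_3)
    then show False by (rule *)
  qed
qed

section \<open>The three axes, their common point and the conic\<close>

definition s_axis :: "4 proj set" where "s_axis = join (H *v v4 1 0 0 0) (H *v v4 0 0 0 1)"
definition t_axis :: "4 proj set" where "t_axis = join (H *v v4 0 1 0 0) (H *v v4 0 0 0 1)"
definition u_axis :: "4 proj set" where "u_axis = join (H *v v4 0 0 1 0) (H *v v4 0 0 0 1)"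
definition apex :: "4 proj" where "apex = pt (H *v v4 0 0 0 1)"
definition conic :: "4 proj set" where
  "conic = projectivization {x. (Hi *v x) $ 3 = 0} \<inter> zero_locus {\<lambda>x. qf (Hi *v x)}"

lemma H_eq_iff: "x = H *v y \<longleftrightarrow> Hi *v x = y"
  by auto

lemma pt_in_axis:
  assumes "x \<noteq> 0"
  shows "pt x \<in> s_axis \<longleftrightarrow> (Hi *v x) $ 1 = 0 \<and> (Hi *v x) $ 2 = 0"
    "pt x \<in> t_axis \<longleftrightarrow> (Hi *v x) $ 0 = 0 \<and> (Hi *v x) $ 2 = 0"
    "pt x \<in> u_axis \<longleftrightarrow> (Hi *v x) $ 0 = 0 \<and> (Hi *v x) $ 1 = 0"
  unfolding s_axis_def t_axis_def u_axis_def pt_in_join[OF assms] matvec_scale[symmetric]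
    matrix_vector_right_distrib[symmetric] H_eq_iff v4_linear
  by (auto simp: vec_eq_4)

lemma is_line_axes: "is_line s_axis" "is_line t_axis" "is_line u_axis"
  unfolding s_axis_def t_axis_def u_axis_def
  by (rule is_line_join; simp add: matvec_linear[symmetric] v4_linear v4_zero_iff)+

lemma axes_distinct: "distinct [s_axis, t_axis, u_axis]"
proof -
  have "pt (H *v v4 1 0 0 0) \<in> s_axis" "pt (H *v v4 1 0 0 0) \<notin> t_axis" "pt (H *v v4 1 0 0 0) \<notin> u_axis"
    "pt (H *v v4 0 1 0 0) \<in> t_axis" "pt (H *v v4 0 1 0 0) \<notin> u_axis"
    by (subst pt_in_axis; simp add: v4_zero_iff)+
  then show ?thesis by auto
qed

lemma apex_in_axes: "apex \<in> s_axis" "apex \<in> t_axis" "apex \<in> u_axis"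
  unfolding apex_def by (subst pt_in_axis; simp add: v4_zero_iff)+

lemma subspace_plane: "vec.subspace {x. (Hi *v x) $ 3 = 0}"
  by (auto simp: vec.subspace_def matvec_linear)

lemma pt_in_conic:
  assumes "x \<noteq> 0"
  shows "pt x \<in> conic \<longleftrightarrow> (Hi *v x) $ 3 = 0 \<and> qf (Hi *v x) = 0"
  using assms by (simp add: conic_def pt_in_projectivization subspace_plane pt_in_zero_locus[OF _ form_qf])

lemma plane_conic_conic: "plane_conic conic"
  unfolding plane_conic_def
proof (intro exI conjI)
  show "vec.subspace {x. (Hi *v x) $ 3 = 0}" by (rule subspace_plane)
  show "vec.dim {x. (Hi *v x) $ 3 = 0} = 3"
  proof -
    have W: "{x. (Hi *v x) $ 3 = 0} = (*v) H ` {y. \<forall>i. i \<notin> {0, 1, 2} \<longrightarrow> y $ i = 0}"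
      by (auto simp: all_4 H_eq_iff image_iff intro!: exI[of _ "Hi *v _"])
    have inj_H: "inj ((*v) H)" by (metis injI inverse_vec(1))
    have "vec.dim ((*v) H ` {y. \<forall>i. i \<notin> {0, 1, 2} \<longrightarrow> y $ i = 0}) = vec.dim {y :: complex ^ 4. \<forall>i. i \<notin> {0, 1, 2 :: 4} \<longrightarrow> y $ i = 0}"
      by (rule vec.dim_image_eq[OF matrix_vector_mul_linear_gen inj_on_subset[OF inj_H subset_UNIV]])
    also have "\<dots> = card {0, 1, 2 :: 4}" by (rule dim_substandard_cart)
    finally show ?thesis unfolding W by simp
  qed
  show "form 2 (\<lambda>x. qf (Hi *v x))" by (rule form_qf)
  show "\<not> (\<exists>p q. form 1 p \<and> form 1 q \<and> (\<forall>v\<in>{x. (Hi *v x) $ 3 = 0}. qf (Hi *v v) = p v * q v))"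
  proof (rule notI, elim exE conjE)
    fix p q assume p: "form 1 p" and q: "form 1 q"
      and *: "\<forall>v\<in>{x. (Hi *v x) $ 3 = 0}. qf (Hi *v v) = p v * q v"
    define P where "P y = p (H *v y)" for y
    define Q where "Q y = q (H *v y)" for y
    have e: "qf y = P y * Q y" if "y $ 3 = 0" for y
      using *[rule_format, of "H *v y"] that by (simp add: P_def Q_def)
    have lin: "P (x + y) = P x + P y" "Q (x + y) = Q x + Q y" for x y
      by (simp_all add: P_def Q_def matvec_linear form_1_linear[OF p] form_1_linear[OF q])
    \<comment> \<open>On the plane \<open>qf\<close> vanishes at the three coordinate points and is
      1 at their pairwise sums. If it were P Q, one of the two linear factors would vanish at two of
      these points and hence at their sum.\<close>
    note e' = e[of "v4 1 0 0 0 + v4 0 1 0 0"] e[of "v4 0 1 0 0 + v4 0 0 1 0"] e[of "v4 1 0 0 0 + v4 0 0 1 0"]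
    note e'' = e[of "v4 1 0 0 0"] e[of "v4 0 1 0 0"] e[of "v4 0 0 1 0"]
    show False
      using e' e'' unfolding lin by (auto simp: qf_def)
  qed
qed (simp add: conic_def)

text \<open>At infinite affine parameter, (0 : 1), coordinates 1 and 2 of the normal form
  vanish.\<close>

lemma s_line_meets_axis: "s_line F j k \<inter> s_axis \<noteq> {}"
proof -
  have "v2 0 1 \<noteq> 0" by (simp add: vec_eq_2)
  then obtain s where s: "s \<noteq> 0" "f s = v2 0 1" by (rule gl2_onto[OF gl(1)])
  define x where "x = trilin F s (axis j 1) (axis k 1)"
  have x: "x \<noteq> 0" using no_base_t[OF s(1)] by (simp add: x_def)
  have "pt x \<in> s_axis" using x by (simp add: pt_in_axis) (simp add: x_def s nf_def)
  moreover have "pt x \<in> s_line F j k" using x by (auto simp: pt_in_s_line x_def)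
  ultimately show ?thesis by blast
qed

lemma s_line_meets_conic: "s_line F j k \<inter> conic \<noteq> {}"
proof -
  let ?t = "g (axis j 1)" and ?u = "h (axis k 1)"
  \<comment> \<open>The last coordinate of \<open>nf\<close> is linear in its first argument, and
    this is the root; by \<open>qf_nf\<close> the quadric \<open>qf\<close> vanishes there
    too.\<close>
  have "v2 (?t $ 1 * ?u $ 0 + ?t $ 0 * ?u $ 1) (- (?t $ 1 * ?u $ 1)) \<noteq> 0"
    using g_axis[of j] h_axis[of k] by (simp add: vec_eq_2)
  then obtain s where s: "s \<noteq> 0" "f s = v2 (?t $ 1 * ?u $ 0 + ?t $ 0 * ?u $ 1) (- (?t $ 1 * ?u $ 1))"
    by (rule gl2_onto[OF gl(1)])
  define x where "x = trilin F s (axis j 1) (axis k 1)"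
  have x: "x \<noteq> 0" using no_base_t[OF s(1)] by (simp add: x_def)
  have "(Hi *v x) $ 3 = 0" by (simp add: x_def s nf_def algebra_simps)
  then have "pt x \<in> conic" using x by (simp add: pt_in_conic) (simp add: x_def qf_nf)
  moreover have "pt x \<in> s_line F j k" using x by (auto simp: pt_in_s_line x_def)
  ultimately show ?thesis by blast
qed

lemma axes_meet_conic: "s_axis \<inter> conic \<noteq> {}" "t_axis \<inter> conic \<noteq> {}" "u_axis \<inter> conic \<noteq> {}"
proof -
  have "pt (H *v v4 1 0 0 0) \<in> s_axis" "pt (H *v v4 0 1 0 0) \<in> t_axis" "pt (H *v v4 0 0 1 0) \<in> u_axis"
    by (subst pt_in_axis; simp add: v4_zero_iff)+
  moreover have "pt (H *v v4 1 0 0 0) \<in> conic" "pt (H *v v4 0 1 0 0) \<in> conic" "pt (H *v v4 0 0 1 0) \<in> conic"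
    by (subst pt_in_conic; simp add: v4_zero_iff qf_def)+
  ultimately show "s_axis \<inter> conic \<noteq> {}" "t_axis \<inter> conic \<noteq> {}" "u_axis \<inter> conic \<noteq> {}" by blast+
qed

text \<open>The base locus is x_3 x_i = q = 0. Its part with x_3 = 0 is the conic; on x_i = 0 the
  quadric reduces to the product of the other two coordinates and splits into two axes.\<close>

lemma pencil_surface_intersection:
  assumes "gl2 k"
  shows "pencil_surface 0 (k (axis 0 1)) \<inter> pencil_surface 0 (k (axis 1 1)) = t_axis \<union> u_axis \<union> conic"
    "pencil_surface 1 (k (axis 0 1)) \<inter> pencil_surface 1 (k (axis 1 1)) = s_axis \<union> u_axis \<union> conic"
    "pencil_surface 2 (k (axis 0 1)) \<inter> pencil_surface 2 (k (axis 1 1)) = s_axis \<union> t_axis \<union> conic"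
proof -
  have *: "X \<inter> Y = Z" if "\<And>x. x \<noteq> 0 \<Longrightarrow> pt x \<in> X \<and> pt x \<in> Y \<longleftrightarrow> pt x \<in> Z" for X Y Z :: "4 proj set"
    using that by (intro set_eqI) (metis IntD1 IntD2 IntI proj_cases)
  show "pencil_surface 0 (k (axis 0 1)) \<inter> pencil_surface 0 (k (axis 1 1)) = t_axis \<union> u_axis \<union> conic"
    "pencil_surface 1 (k (axis 0 1)) \<inter> pencil_surface 1 (k (axis 1 1)) = s_axis \<union> u_axis \<union> conic"
    "pencil_surface 2 (k (axis 0 1)) \<inter> pencil_surface 2 (k (axis 1 1)) = s_axis \<union> t_axis \<union> conic"
    by (rule *; simp add: pt_in_pencil_surface pencil_pair_axes[OF assms] pt_in_axis pt_in_conic;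
        auto simp: qf_def)+
qed

end

subsection \<open>Generic maps of type (2,2,2)\<close>

definition perm_st :: "complex ^ 4 ^ 4" where
  "perm_st = (\<chi> i. if i = 0 then axis 1 1 else if i = 1 then axis 0 1 else axis i 1)"

definition perm_su :: "complex ^ 4 ^ 4" where
  "perm_su = (\<chi> i. if i = 0 then axis 2 1 else if i = 2 then axis 0 1 else axis i 1)"

lemma perm_vec: "perm_st *v y = v4 (y $ 1) (y $ 0) (y $ 2) (y $ 3)" "perm_su *v y = v4 (y $ 2) (y $ 1) (y $ 0) (y $ 3)"
  by (simp_all add: vec_eq_4 matrix_vector_mult_def sum_UNIV_4 perm_st_def perm_su_def axis_def)

context normal_form_map
begin

text \<open>Exchanging parameters of \<open>nf\<close> only permutes its first three coordinates, so
  a swapped map is again in normal form with H permuted accordingly.\<close>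

lemma swap_st_map: "normal_form_map (swap_st F) (H ** perm_st) (perm_st ** Hi) g f h"
proof
  show "(H ** perm_st) ** (perm_st ** Hi) = mat 1" "(perm_st ** Hi) ** (H ** perm_st) = mat 1"
    by (rule matrix_eqI, simp add: matrix_vector_mul_assoc[symmetric] perm_vec v4_eta mat_matvec)+
  show "trilin (swap_st F) s t u = (H ** perm_st) *v nf (g s) (f t) (h u)" for s t u
    by (simp add: swap_trilin nf matrix_vector_mul_assoc[symmetric] perm_vec) (simp add: nf_def algebra_simps)
qed (simp_all add: gl swap_trilin no_base_s no_base_t no_base_u)

lemma swap_su_map: "normal_form_map (swap_su F) (H ** perm_su) (perm_su ** Hi) h g f"
proof
  show "(H ** perm_su) ** (perm_su ** Hi) = mat 1" "(perm_su ** Hi) ** (H ** perm_su) = mat 1"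
    by (rule matrix_eqI, simp add: matrix_vector_mul_assoc[symmetric] perm_vec v4_eta mat_matvec)+
  show "trilin (swap_su F) s t u = (H ** perm_su) *v nf (h s) (g t) (f u)" for s t u
    by (simp add: swap_trilin nf matrix_vector_mul_assoc[symmetric] perm_vec) (simp add: nf_def algebra_simps)
qed (simp_all add: gl swap_trilin no_base_s no_base_t no_base_u)

lemma tripod_main:
  "nondegenerate F" "tripod_config F s_axis t_axis u_axis apex conic"
  "Sigma_surf F 0 \<inter> Sigma_surf F 1 = t_axis \<union> u_axis \<union> conic"
  "T_surf F 0 \<inter> T_surf F 1 = s_axis \<union> u_axis \<union> conic"
  "Y_surf F 0 \<inter> Y_surf F 1 = s_axis \<union> t_axis \<union> conic"
proof -
  interpret st: normal_form_map "swap_st F" "H ** perm_st" "perm_st ** Hi" g f h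
    by (rule swap_st_map)
  interpret su: normal_form_map "swap_su F" "H ** perm_su" "perm_su ** Hi" h g f
    by (rule swap_su_map)
  have T: "T_surf F j = pencil_surface 1 (g (axis j 1))" for j
    by (simp add: swap_boundary(1) st.Sigma_surf_eq st.pencil_surface_def pencil_surface_def pencil_def qf_def
        matrix_vector_mul_assoc[symmetric] perm_vec algebra_simps)
  have Y: "Y_surf F k = pencil_surface 2 (h (axis k 1))" for k
    by (simp add: swap_Y_surf su.Sigma_surf_eq su.pencil_surface_def pencil_surface_def pencil_def qf_def
        matrix_vector_mul_assoc[symmetric] perm_vec algebra_simps)
  have axes: "st.s_axis = t_axis" "su.s_axis = u_axis"
    by (simp_all add: st.s_axis_def su.s_axis_def t_axis_def u_axis_def matrix_vector_mul_assoc[symmetric] perm_vec)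
  have conics: "st.conic = conic" "su.conic = conic"
    by (simp_all add: st.conic_def su.conic_def conic_def matrix_vector_mul_assoc[symmetric] perm_vec qf_def algebra_simps)
  note lines = swap_boundary(2,3)
  show "Sigma_surf F 0 \<inter> Sigma_surf F 1 = t_axis \<union> u_axis \<union> conic"
    "T_surf F 0 \<inter> T_surf F 1 = s_axis \<union> u_axis \<union> conic"
    "Y_surf F 0 \<inter> Y_surf F 1 = s_axis \<union> t_axis \<union> conic"
    unfolding Sigma_surf_eq T Y by (rule pencil_surface_intersection; rule gl)+
  have quadric: "quadric_surface (Sigma_surf F i)" "quadric_surface (T_surf F i)" "quadric_surface (Y_surf F i)"
    and smooth: "smooth_surface (Sigma_surf F i)" "smooth_surface (T_surf F i)" "smooth_surface (Y_surf F i)" for i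
    unfolding swap_boundary(1) swap_Y_surf
    by (rule Sigma_quadric st.Sigma_quadric su.Sigma_quadric)+
  have meets: "s_line F j k \<inter> s_axis \<noteq> {}" "t_line F j k \<inter> t_axis \<noteq> {}" "u_line F j k \<inter> u_axis \<noteq> {}"
    "s_line F j k \<inter> conic \<noteq> {}" "t_line F j k \<inter> conic \<noteq> {}" "u_line F j k \<inter> conic \<noteq> {}" for j k
    using s_line_meets_axis[of j k] st.s_line_meets_axis[of j k] su.s_line_meets_axis[of k j]
      s_line_meets_conic[of j k] st.s_line_meets_conic[of j k] su.s_line_meets_conic[of k j]
    by (simp_all add: lines axes conics)
  show "tripod_config F s_axis t_axis u_axis apex conic"
    unfolding tripod_config_def
    using axes_distinct
    by (simp add: quadric is_line_axes meets apex_in_axes plane_conic_conic axes_meet_conic)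
  have surfaces: "Sigma_surf F 0 \<noteq> Sigma_surf F 1" "T_surf F 0 \<noteq> T_surf F 1" "Y_surf F 0 \<noteq> Y_surf F 1"
    unfolding swap_boundary(1) swap_Y_surf
    by (rule Sigma_distinct st.Sigma_distinct su.Sigma_distinct)+
  have surfaces': "Sigma_surf F i \<noteq> T_surf F j" "Sigma_surf F i \<noteq> Y_surf F j" "T_surf F i \<noteq> Y_surf F j" for i j
    unfolding Sigma_surf_eq T Y
    by (rule pencil_surface_neq f_axis g_axis h_axis)+
  have is_line: "is_line (s_line F j k)" "is_line (t_line F j k)" "is_line (u_line F j k)" for j k
    unfolding lines by (rule is_line_s st.is_line_s su.is_line_s)+
  have inj: "s_line F j k = s_line F j' k' \<longleftrightarrow> j = j' \<and> k = k'" "t_line F j k = t_line F j' k' \<longleftrightarrow> j = j' \<and> k = k'"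
    "u_line F j k = u_line F j' k' \<longleftrightarrow> j = j' \<and> k = k'" for j k j' k'
    using s_line_inj[of j k j' k'] st.s_line_inj[of j k j' k'] su.s_line_inj[of k j k' j']
    by (auto simp: lines)
  have neq: "s_line F j k \<noteq> t_line F j' k'" "s_line F j k \<noteq> u_line F j' k'" "t_line F j k \<noteq> u_line F j' k'"
    for j k j' k'
  proof -
    show "s_line F j k \<noteq> t_line F j' k'" "s_line F j k \<noteq> u_line F j' k'" by (rule s_line_neq)+
    show "t_line F j k \<noteq> u_line F j' k'"
      unfolding swap_boundary(2)[of F j k] swap_boundary(5)[of F j' k'] by (rule st.s_line_neq)
  qed
  show "nondegenerate F"
    unfolding nondegenerate_def Let_def
    by (simp add: smooth surfaces surfaces' is_line inj neq)
qed

end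

section \<open>The hypersurface of excluded maps\<close>

lemma form_slice: "form 1 (\<lambda>F. slice F s $ i $ j)"
  unfolding slice_def by (simp del: One_nat_def) (intro form_add form_cmult form_coord)

lemma form_slice_swap: "form 1 (\<lambda>F. slice (swap_st F) s $ i $ j)" "form 1 (\<lambda>F. slice (swap_su F) s $ i $ j)"
  unfolding slice_def swap_st_def swap_su_def by (simp_all del: One_nat_def) (intro form_add form_cmult form_coord)+

definition face_dets :: "trilinear \<Rightarrow> complex" where
  "face_dets F = det (slice F (axis 0 1)) * det (slice F (axis 1 1)) *
     det (slice (swap_st F) (axis 0 1)) * det (slice (swap_st F) (axis 1 1)) *
     det (slice (swap_su F) (axis 0 1)) * det (slice (swap_su F) (axis 1 1))"

text \<open>All open conditions are gathered in one form in the 32 coefficients: six determinants of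
  degree 4 and the defect of degree 8.\<close>

lemma form_face_dets_invariant_defect: "\<exists>d. form d (\<lambda>F. face_dets F * invariant_defect F)"
proof -
  have d: "form 4 (\<lambda>F. det (slice F s))" "form 4 (\<lambda>F. det (slice (swap_st F) s))" "form 4 (\<lambda>F. det (slice (swap_su F) s))" for s
    using form_det[OF form_slice, of s] form_det[OF form_slice_swap(1), of s] form_det[OF form_slice_swap(2), of s]
    by simp_all
  have E: "form (4 + 4) invariant_defect"
    unfolding invariant_defect_def Let_def power2_eq_square mult.assoc
    by (intro form_diff form_mult form_add form_cmult d)
  have "form (4 + 4 + 4 + 4 + 4 + 4 + (4 + 4)) (\<lambda>F. face_dets F * invariant_defect F)"
    unfolding face_dets_def by (intro form_mult d E)
  then show ?thesis by blast
qed

lemma face_detsD: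
  assumes "face_dets F \<noteq> 0"
  shows "t \<noteq> 0 \<Longrightarrow> u \<noteq> 0 \<Longrightarrow> trilin F (axis i 1) t u \<noteq> 0"
    and "s \<noteq> 0 \<Longrightarrow> u \<noteq> 0 \<Longrightarrow> trilin F s (axis i 1) u \<noteq> 0"
    and "s \<noteq> 0 \<Longrightarrow> t \<noteq> 0 \<Longrightarrow> trilin F s t (axis i 1) \<noteq> 0"
proof -
  have "\<forall>i. det (slice F (axis i 1)) \<noteq> 0 \<and> det (slice (swap_st F) (axis i 1)) \<noteq> 0 \<and> det (slice (swap_su F) (axis i 1)) \<noteq> 0"
    using assms by (simp add: face_dets_def all_2)
  then show "t \<noteq> 0 \<Longrightarrow> u \<noteq> 0 \<Longrightarrow> trilin F (axis i 1) t u \<noteq> 0"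
    and "s \<noteq> 0 \<Longrightarrow> u \<noteq> 0 \<Longrightarrow> trilin F s (axis i 1) u \<noteq> 0"
    and "s \<noteq> 0 \<Longrightarrow> t \<noteq> 0 \<Longrightarrow> trilin F s t (axis i 1) \<noteq> 0"
    using slice_nonsingular[of F "axis i 1" t u] slice_nonsingular[of "swap_st F" "axis i 1" s u]
      slice_nonsingular[of "swap_su F" "axis i 1" t s]
    by (simp_all add: swap_trilin)
qed

section \<open>Extending identities from a nonempty open set\<close>

lemma triform_zero_well_defined:
  assumes "triform a b c p" "s \<noteq> 0" "t \<noteq> 0" "u \<noteq> 0" "s' \<noteq> 0" "t' \<noteq> 0" "u' \<noteq> 0"
    and "pt s = pt s'" "pt t = pt t'" "pt u = pt u'" and 0: "p s' t' u' = 0"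
  shows "p s t u = 0"
proof -
  obtain k l m where k: "s = k *s s'" "t = l *s t'" "u = m *s u'"
    using pt_eq_iff[of s' s] pt_eq_iff[of t' t] pt_eq_iff[of u' u] assms by auto
  have f: "form a (\<lambda>s. p s t u)" "form b (\<lambda>t. p s t u)" "form c (\<lambda>u. p s t u)" for s t u
    using assms(1) by (auto simp: triform_def)
  have "p s t u = k ^ a * (l ^ b * (m ^ c * p s' t' u'))"
    unfolding k using form_scale[OF f(1)] form_scale[OF f(2)] form_scale[OF f(3)] by simp
  then show ?thesis using 0 by simp
qed

text \<open>Polynomiality along lines is preserved by products, differences and linear substitutions
  without tracking degrees, and it is enough for density arguments.\<close>

definition line_poly :: "(complex ^ 'n::finite \<Rightarrow> complex) \<Rightarrow> bool" where
  "line_poly p \<longleftrightarrow> (\<forall>x y. \<exists>P. \<forall>z. p (x + z *s y) = poly P z)"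

lemma line_poly_mult: "line_poly p \<Longrightarrow> line_poly q \<Longrightarrow> line_poly (\<lambda>x. p x * q x)"
  unfolding line_poly_def by (metis poly_mult)

lemma line_poly_diff: "line_poly p \<Longrightarrow> line_poly q \<Longrightarrow> line_poly (\<lambda>x. p x - q x)"
  unfolding line_poly_def by (metis poly_diff)

lemma line_poly_const: "line_poly (\<lambda>_. c)"
  unfolding line_poly_def by (metis poly_const_conv)

lemma line_poly_form: "form d p \<Longrightarrow> line_poly p"
  unfolding line_poly_def using form_line_poly by blast

lemma line_poly_comp:
  assumes "line_poly p" "\<And>x y z. L (x + z *s y) = L x + z *s L y"
  shows "line_poly (\<lambda>x. p (L x))"
  using assms unfolding line_poly_def by simp

text \<open>On the line through \<open>x0\<close> and \<open>x\<close> the product of the two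
  polynomials vanishes identically while the first factor does not.\<close>

lemma line_poly_vanish:
  assumes "line_poly p" "line_poly q" "p x0 \<noteq> 0" "\<And>x. p x \<noteq> 0 \<Longrightarrow> q x = 0"
  shows "q x = 0"
proof -
  obtain P Q where P: "\<And>z. p (x0 + z *s (x - x0)) = poly P z" and Q: "\<And>z. q (x0 + z *s (x - x0)) = poly Q z"
    using assms(1,2) unfolding line_poly_def by metis
  have "poly (P * Q) z = 0" for z
    using assms(4)[of "x0 + z *s (x - x0)"] by (auto simp: P[symmetric] Q[symmetric])
  then have "P = 0 \<or> Q = 0" by (metis poly_all_0_iff_0 mult_eq_0_iff)
  moreover have "P \<noteq> 0" using assms(3) P[of 0] by auto
  ultimately show ?thesis using Q[of 1] by simp
qed

lemma inverse_identity:
  assumes inv: "inverse_maps F A B C" and A: "form 2 (\<lambda>x. A x $ 0)" "form 2 (\<lambda>x. A x $ 1)"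
  shows "s $ 1 * A (trilin F s t u) $ 0 = s $ 0 * A (trilin F s t u) $ 1"
proof -
  obtain V where V: "zariski_open3 V" "V \<noteq> {}" and
    VA: "\<And>s t u. s \<noteq> 0 \<Longrightarrow> t \<noteq> 0 \<Longrightarrow> u \<noteq> 0 \<Longrightarrow> (pt s, pt t, pt u) \<in> V \<Longrightarrow>
      A (trilin F s t u) \<noteq> 0 \<and> pt (A (trilin F s t u)) = pt s"
    using inv unfolding inverse_maps_def Let_def by blast
  obtain S where S: "\<forall>p\<in>S. \<exists>a b c. triform a b c p"
    and VS: "- V = {(pt s, pt t, pt u) | s t u. s \<noteq> 0 \<and> t \<noteq> 0 \<and> u \<noteq> 0 \<and> (\<forall>p\<in>S. p s t u = 0)}"
    using V(1) unfolding zariski_open3_def zariski_closed3_def by blast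
  obtain s0 t0 u0 where stu0: "s0 \<noteq> 0" "t0 \<noteq> 0" "u0 \<noteq> 0" "(pt s0, pt t0, pt u0) \<in> V"
    using V(2) by (metis all_not_in_conv prod_cases3 proj_cases)
  then have "(pt s0, pt t0, pt u0) \<notin> - V" by simp
  then obtain p where p: "p \<in> S" "p s0 t0 u0 \<noteq> 0" unfolding VS using stu0 by blast
  obtain a b c where abc: "triform a b c p" using S p(1) by blast
  define R where "R s t u = s $ 1 * A (trilin F s t u) $ 0 - s $ 0 * A (trilin F s t u) $ 1" for s t u
  have A0: "A 0 $ 0 = 0" "A 0 $ 1 = 0"
    using form_scale[OF A(1), of 0 0] form_scale[OF A(2), of 0 0] by simp_all
  have R: "R s t u = 0" if "p s t u \<noteq> 0" for s t u
  proof (cases "s = 0 \<or> t = 0 \<or> u = 0")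
    case True
    then have "trilin F s t u = 0" by (auto simp: trilin_0)
    then show ?thesis by (simp add: R_def A0)
  next
    case False
    have "(pt s, pt t, pt u) \<notin> - V"
    proof
      assume "(pt s, pt t, pt u) \<in> - V"
      then obtain s' t' u' where "pt s = pt s'" "pt t = pt t'" "pt u = pt u'" "s' \<noteq> 0" "t' \<noteq> 0" "u' \<noteq> 0" "p s' t' u' = 0"
        unfolding VS using p(1) by auto
      then show False using triform_zero_well_defined[OF abc, of s t u s' t' u'] False that by blast
    qed
    then have "A (trilin F s t u) \<noteq> 0" "pt (A (trilin F s t u)) = pt s" using VA False by auto
    then obtain k where "s = k *s A (trilin F s t u)" using pt_eq_iff[of "A (trilin F s t u)" s] False by auto
    then have "s $ i = k * A (trilin F s t u) $ i" for i by (metis vector_smult_component)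
    then show ?thesis by (simp add: R_def)
  qed
  have lp: "line_poly (\<lambda>s. p s t u)" "line_poly (\<lambda>t. p s t u)" "line_poly (\<lambda>u. p s t u)" for s t u
    using abc line_poly_form unfolding triform_def by blast+
  have L: "trilin F (x + z *s y) t u = trilin F x t u + z *s trilin F y t u"
    "trilin F s (x + z *s y) u = trilin F s x u + z *s trilin F s y u"
    "trilin F s t (x + z *s y) = trilin F s t x + z *s trilin F s t y" for s t u x y z
    using trilin_linear_1[of F 1 x z y t u] trilin_linear_2[of F s 1 x z y u] trilin_linear_3[of F s t 1 x z y] by simp_all
  note lA = line_poly_comp[OF line_poly_form[OF A(1)]] line_poly_comp[OF line_poly_form[OF A(2)]]
  have lR: "line_poly (\<lambda>s. R s t u)" "line_poly (\<lambda>t. R s t u)" "line_poly (\<lambda>u. R s t u)" for s t u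
    unfolding R_def
    by (intro line_poly_diff line_poly_mult line_poly_const line_poly_form[OF form_coord] lA L)+
  \<comment> \<open>The identity spreads one parameter at a time: first over all u, then over all t,
    finally over all s, starting from the single point where p is nonzero.\<close>
  have 1: "R s t u = 0" if "p s t u' \<noteq> 0" for s t u u'
    using line_poly_vanish[of "\<lambda>u. p s t u" "\<lambda>u. R s t u" u' u] lp(3) lR(3) that R by blast
  have 2: "R s t u = 0" if "p s t' u' \<noteq> 0" for s t u t' u'
    using line_poly_vanish[of "\<lambda>t. p s t u'" "\<lambda>t. R s t u" t' t] lp(2) lR(2) that 1 by blast
  have "R s t u = 0"
    using line_poly_vanish[of "\<lambda>s. p s t0 u0" "\<lambda>s. R s t u" s0 s] lp(1) lR(1) p(2) 2 by blast
  then show ?thesis by (simp add: R_def)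
qed

lemma normal_form_of_birational:
  assumes "birational_of_type 2 2 2 F" "face_dets F \<noteq> 0" "invariant_defect F \<noteq> 0"
  obtains H Hi f g h where "normal_form_map F H Hi f g h"
proof -
  obtain A B C where A: "reduced_pair 2 A" and inv: "inverse_maps F A B C"
    using assms(1) unfolding birational_of_type_def by blast
  then have forms: "form 2 (\<lambda>x. A x $ 0)" "form 2 (\<lambda>x. A x $ 1)"
    and ncf: "no_common_factor (\<lambda>x. A x $ 0) (\<lambda>x. A x $ 1)"
    by (simp_all add: reduced_pair_def)
  have "(\<lambda>x. A x $ 1) \<noteq> (\<lambda>_. 0)"
  proof
    assume "(\<lambda>x. A x $ 1) = (\<lambda>_. 0)"
    \<comment> \<open>If the second component vanished, the first, of degree 2, would itself be a
      common factor, with cofactors 1 and 0.\<close>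
    then have "\<exists>k m g p' q'. k \<ge> 1 \<and> form k g \<and> form m p' \<and> form m q' \<and>
      (\<lambda>x. A x $ 0) = (\<lambda>x. g x * p' x) \<and> (\<lambda>x. A x $ 1) = (\<lambda>x. g x * q' x)"
      by (intro exI[of _ 2] exI[of _ 0] exI[of _ "\<lambda>x. A x $ 0"] exI[of _ "\<lambda>_. 1"] exI[of _ "\<lambda>_. 0"])
        (simp add: forms form_const)
    then show False using ncf unfolding no_common_factor_def by blast
  qed
  moreover have "det (slice F (axis 0 1)) \<noteq> 0" using assms(2) by (simp add: face_dets_def)
  ultimately obtain H f g h where nf: "has_normal_form F H f g h"
    using has_normal_form_exists[of F "\<lambda>x. A x $ 0" "\<lambda>x. A x $ 1"] face_detsD[OF assms(2)] forms
      inverse_identity[OF inv forms] assms(3) by metis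
  then obtain Hi where "H ** Hi = mat 1" "Hi ** H = mat 1" by (auto simp: has_normal_form_def invertible_def)
  then have "normal_form_map F H Hi f g h"
    using nf face_detsD[OF assms(2)] by unfold_locales (auto simp: has_normal_form_def)
  then show ?thesis by (rule that)
qed

subsection \<open>A real example\<close>

lemma det_4:
  fixes A :: "complex ^ 4 ^ 4"
  shows "det A =
    A$0$0 * (A$1$1 * (A$2$2 * A$3$3 - A$2$3 * A$3$2) - A$1$2 * (A$2$1 * A$3$3 - A$2$3 * A$3$1) + A$1$3 * (A$2$1 * A$3$2 - A$2$2 * A$3$1))
  - A$0$1 * (A$1$0 * (A$2$2 * A$3$3 - A$2$3 * A$3$2) - A$1$2 * (A$2$0 * A$3$3 - A$2$3 * A$3$0) + A$1$3 * (A$2$0 * A$3$2 - A$2$2 * A$3$0))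
  + A$0$2 * (A$1$0 * (A$2$1 * A$3$3 - A$2$3 * A$3$1) - A$1$1 * (A$2$0 * A$3$3 - A$2$3 * A$3$0) + A$1$3 * (A$2$0 * A$3$1 - A$2$1 * A$3$0))
  - A$0$3 * (A$1$0 * (A$2$1 * A$3$2 - A$2$2 * A$3$1) - A$1$1 * (A$2$0 * A$3$2 - A$2$2 * A$3$0) + A$1$2 * (A$2$0 * A$3$1 - A$2$1 * A$3$0))"
proof -
  have f: "finite {1::4, 2, 3}" "0 \<notin> {1::4, 2, 3}" "finite {2::4, 3}" "1 \<notin> {2::4, 3}" "finite {3::4}" "2 \<notin> {3::4}"
    by auto
  show ?thesis
    unfolding det_def UNIV_4_0123
    unfolding sum_over_permutations_insert[OF f(1,2)]
    unfolding sum_over_permutations_insert[OF f(3,4)]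
    unfolding sum_over_permutations_insert[OF f(5,6)]
    unfolding permutes_sing
    by (simp add: sign_swap_id permutation_swap_id sign_compose sign_id swap_id_eq permutation_compose) (simp add: algebra_simps)
qed

definition ex_param :: "complex ^ 2 \<Rightarrow> complex ^ 2" where
  "ex_param s = v2 (s $ 0 + s $ 1) (s $ 0 + 2 * s $ 1)"

text \<open>\<open>ex_param\<close> moves the affine parameters of the vertices from 0 and infinity, where the normal form degenerates, to 1 and 2.\<close>

definition ex_map :: trilinear where
  "ex_map = (\<chi> p. case p of (l, i, j, k) \<Rightarrow> nf (ex_param (axis i 1)) (ex_param (axis j 1)) (ex_param (axis k 1)) $ l)"

lemma trilin_ex_map: "trilin ex_map s t u = nf (ex_param s) (ex_param t) (ex_param u)"
  by (simp add: vec_eq_4 trilin_nth ex_map_def sum_UNIV_2 nf_def ex_param_def axis_def algebra_simps)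

lemma ex_map_face_dets: "face_dets ex_map \<noteq> 0"
  by (simp add: face_dets_def det_4 slice_def swap_st_def swap_su_def ex_map_def nf_def ex_param_def axis_def)

lemma ex_map_invariant_defect: "invariant_defect ex_map \<noteq> 0"
  by (simp add: invariant_defect_def Let_def det_4 slice_def ex_map_def nf_def ex_param_def axis_def)

lemma ex_map_real: "real_control_points ex_map"
proof -
  \<comment> \<open>\<open>r i\<close> is the affine parameter of the vertex i. The first coordinate
    of \<open>nf\<close> at a vertex is \<open>r i\<close>, so it is the weight by which the others
    are divided.\<close>
  define r :: "2 \<Rightarrow> real" where "r = (\<lambda>i. if i = 0 then 1 else 2)"
  define P :: "2 \<Rightarrow> 2 \<Rightarrow> 2 \<Rightarrow> real ^ 4" where
    "P = (\<lambda>i j k. \<chi> l. if l = 0 then 1 else if l = 1 then r j / r i else if l = 2 then r k / r i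
       else (r j * r k + r i * (r j + r k)) / r i)"
  have "\<forall>i j k. P i j k $ 0 = 1 \<and> (\<forall>l. ctrl ex_map i j k $ l = of_real (r i * P i j k $ l))"
    by (simp add: all_2 all_4 P_def r_def ctrl_def ex_map_def nf_def ex_param_def axis_def)
  then show ?thesis unfolding real_control_points_def by (intro exI[of _ "\<lambda>i j k. r i"] exI[of _ P])
qed

text \<open>The inverse (qf : x_3 x_i) of the normal form followed by the inverse matrix of
  \<open>ex_param\<close>, which has determinant 1.\<close>

definition ex_inv :: "4 \<Rightarrow> complex ^ 4 \<Rightarrow> complex ^ 2" where
  "ex_inv i x = v2 (2 * qf x - x $ 3 * x $ i) (x $ 3 * x $ i - qf x)"

lemma form_qf_coord: "form 2 qf" "form 2 (\<lambda>x :: complex ^ 4. x $ 3 * x $ i)"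
proof -
  have "form 2 (\<lambda>x. qf x)" unfolding qf_def by (intro form_add form_mult_linear form_coord)
  then show "form 2 qf" .
  show "form 2 (\<lambda>x :: complex ^ 4. x $ 3 * x $ i)" by (intro form_mult_linear form_coord)
qed

text \<open>A common factor of degree 2 would make the two quadrics proportional. A linear one
  divides x_3 x_i, so it vanishes at the two remaining coordinate points and hence at their sum,
  where \<open>qf\<close> is 1.\<close>

lemma qf_coord_coprime:
  assumes "i \<in> {0, 1, 2}" and g: "form k g" "form m p" "form m q" "k \<ge> 1"
    and e: "\<And>x. qf x = g x * p x" "\<And>x. x $ 3 * x $ i = g x * q x"
  shows False
proof -
  let ?e = "\<lambda>i. axis i (1 :: complex) :: complex ^ 4"
  have "k + m = 2"
  proof -
    \<comment> \<open>Scaling by 2 a point where \<open>qf\<close> is not 0 compares the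
      degrees.\<close>
    let ?x = "v4 1 1 0 0"
    have "qf (2 *s ?x) = 2 ^ (k + m) * qf ?x"
      unfolding e form_scale[OF g(1)] form_scale[OF g(2)] by (simp add: power_add)
    then have "(2::complex) ^ (k + m) = 2 ^ 2" by (simp add: qf_def)
    then have "(2::nat) ^ (k + m) = 2 ^ 2" by (metis of_nat_eq_iff of_nat_numeral of_nat_power)
    then show ?thesis using power_inject_exp[of "2::nat" "k + m" 2] by simp
  qed
  then consider "k = 2" "m = 0" | "k = 1" "m = 1" using g(4) by linarith
  then show False
  proof cases
    case 1
    then obtain c d where cd: "\<And>x. p x = c" "\<And>x. q x = d" using form_0_D g(2,3) by metis
    have "d = 0" using e(1)[of "v4 1 1 1 0"] e(2)[of "v4 1 1 1 0"] assms(1) by (auto simp: cd qf_def)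
    then show False using e(2)[of "v4 1 1 1 1"] assms(1) by (auto simp: cd)
  next
    case 2
    have lin: "g (x + y) = g x + g y" "q (x + y) = q x + q y" for x y
      using form_1_linear g(1,3) 2 by blast+
    have *: "g (?e j) = 0" if j: "j \<noteq> i" "j \<noteq> 3" for j
    proof -
      have i3: "i \<noteq> 3" using assms(1) by auto
      have "g (?e 3) * q (?e 3) = 0" "g (?e i) * q (?e i) = 0" "g (?e j) * q (?e j) = 0"
        "(g (?e 3) + g (?e i)) * (q (?e 3) + q (?e i)) = 1"
        "(g (?e 3) + g (?e j)) * (q (?e 3) + q (?e j)) = 0"
        "(g (?e i) + g (?e j)) * (q (?e i) + q (?e j)) = 0"
        unfolding lin[symmetric] e(2)[symmetric] using i3 j by (auto simp: axis_def)
      then show ?thesis by algebra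
    qed
    have "\<exists>j l. j \<noteq> i \<and> j \<noteq> 3 \<and> l \<noteq> i \<and> l \<noteq> 3 \<and> qf (?e j + ?e l) = 1"
      using assms(1)
    proof (elim insertE emptyE)
      assume "i = 0" then show ?thesis by (intro exI[of _ 1] exI[of _ 2]) (simp add: qf_def axis_def)
    next
      assume "i = 1" then show ?thesis by (intro exI[of _ 0] exI[of _ 2]) (simp add: qf_def axis_def)
    next
      assume "i = 2" then show ?thesis by (intro exI[of _ 0] exI[of _ 1]) (simp add: qf_def axis_def)
    qed
    then show False using * by (auto simp: e(1) lin)
  qed
qed

text \<open>The components span the same pencil as \<open>qf\<close> and x_3 x_i, so a common factor
  would divide these too.\<close>

lemma reduced_pair_ex_inv:
  assumes "i \<in> {0, 1, 2}"
  shows "reduced_pair 2 (ex_inv i)"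
  unfolding reduced_pair_def
proof (intro conjI)
  show "form 2 (\<lambda>x. ex_inv i x $ 0)" "form 2 (\<lambda>x. ex_inv i x $ 1)"
    unfolding ex_inv_def v2_nth by (intro form_diff form_cmult form_qf_coord)+
  show "no_common_factor (\<lambda>x. ex_inv i x $ 0) (\<lambda>x. ex_inv i x $ 1)"
    unfolding no_common_factor_def
  proof (rule notI, elim exE conjE)
    fix k m g p q
    assume g: "1 \<le> k" "form k g" "form m p" "form m q"
      and 0: "(\<lambda>x. ex_inv i x $ 0) = (\<lambda>x. g x * p x)" and 1: "(\<lambda>x. ex_inv i x $ 1) = (\<lambda>x. g x * q x)"
    have e: "2 * qf x - x $ 3 * x $ i = g x * p x" "x $ 3 * x $ i - qf x = g x * q x" for x
      using fun_cong[OF 0, of x] fun_cong[OF 1, of x] by (simp_all add: ex_inv_def)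
    show False
    proof (rule qf_coord_coprime[OF assms g(2) _ _ g(1)])
      show "form m (\<lambda>x. p x + q x)" "form m (\<lambda>x. p x + 2 * q x)"
        by (intro form_add form_cmult g)+
      show "qf x = g x * (p x + q x)" "x $ 3 * x $ i = g x * (p x + 2 * q x)" for x
        using e[of x] by algebra+
    qed
  qed
qed

lemma ex_param_ex_inv: "ex_param (ex_inv i x) = v2 (qf x) (x $ 3 * x $ i)"
  by (simp add: ex_param_def ex_inv_def vec_eq_2)

lemma ex_inv_ex_map:
  fixes s t u :: "complex ^ 2"
  defines "x \<equiv> trilin ex_map s t u"
  shows "ex_inv 0 x = (ex_param t $ 0 * ex_param u $ 0 * x $ 3) *s s"
    "ex_inv 1 x = (ex_param s $ 0 * ex_param u $ 0 * x $ 3) *s t"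
    "ex_inv 2 x = (ex_param s $ 0 * ex_param t $ 0 * x $ 3) *s u"
  unfolding x_def trilin_ex_map ex_inv_def qf_nf
  by (simp_all add: vec_eq_2) (simp_all add: nf_def ex_param_def algebra_simps)

lemma ex_map_ex_inv: "trilin ex_map (ex_inv 0 x) (ex_inv 1 x) (ex_inv 2 x) = ((qf x)\<^sup>2 * x $ 3) *s x"
  unfolding trilin_ex_map ex_param_ex_inv
  by (simp add: vec_eq_4 nf_def qf_def power2_eq_square algebra_simps)

lemma form_ex_param: "form 1 (\<lambda>s. ex_param s $ i)"
proof -
  have "\<forall>i. form 1 (\<lambda>s. ex_param s $ i)"
    by (simp add: all_2 ex_param_def del: One_nat_def) (intro conjI form_add form_cmult form_coord)
  then show ?thesis by blast
qed

lemma inverse_maps_ex: "inverse_maps ex_map (ex_inv 0) (ex_inv 1) (ex_inv 2)"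
  unfolding inverse_maps_def
proof (intro conjI)
  \<comment> \<open>Composing the maps multiplies s, t and u by three scalars; p is nonzero exactly
    where all scalars are.\<close>
  define p where "p s t u = ex_param s $ 0 * ex_param t $ 0 * ex_param u $ 0 * trilin ex_map s t u $ 3" for s t u
  define W where "W = {(pt s, pt t, pt u) | s t u. s \<noteq> 0 \<and> t \<noteq> 0 \<and> u \<noteq> 0 \<and> (\<forall>q\<in>{p}. q s t u = 0)}"
  have tri: "triform 2 2 2 p"
  proof -
    have "form 1 (\<lambda>s. trilin ex_map s t u $ 3)" "form 1 (\<lambda>t. trilin ex_map s t u $ 3)" "form 1 (\<lambda>u. trilin ex_map s t u $ 3)" for s t u
      unfolding trilin_ex_map nf_def v4_nth mult.assoc
    proof -
      show "form 1 (\<lambda>s. ex_param s $ 0 * (ex_param t $ 1 * ex_param u $ 1) + ex_param s $ 1 * (ex_param t $ 1 * ex_param u $ 0 + ex_param t $ 0 * ex_param u $ 1))"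
        by (subst (1 2) mult.commute) (intro form_add form_cmult form_ex_param)
      have "form 1 (\<lambda>t. ex_param s $ 0 * (ex_param u $ 1 * ex_param t $ 1) + ex_param s $ 1 * (ex_param u $ 0 * ex_param t $ 1 + ex_param u $ 1 * ex_param t $ 0))"
        by (intro form_add form_cmult form_ex_param)
      then show "form 1 (\<lambda>t. ex_param s $ 0 * (ex_param t $ 1 * ex_param u $ 1) + ex_param s $ 1 * (ex_param t $ 1 * ex_param u $ 0 + ex_param t $ 0 * ex_param u $ 1))"
        by (simp add: mult.commute)
      show "form 1 (\<lambda>u. ex_param s $ 0 * (ex_param t $ 1 * ex_param u $ 1) + ex_param s $ 1 * (ex_param t $ 1 * ex_param u $ 0 + ex_param t $ 0 * ex_param u $ 1))"
        by (intro form_add form_cmult form_ex_param)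
    qed
    note lin = form_mult_linear[OF form_ex_param this(1)] form_mult_linear[OF form_ex_param this(2)] form_mult_linear[OF form_ex_param this(3)]
    have "form 2 (\<lambda>s. p s t u)" for t u
      using form_cmult[OF lin(1), of "ex_param t $ 0 * ex_param u $ 0" 0 t u] by (simp add: p_def mult_ac)
    moreover have "form 2 (\<lambda>t. p s t u)" for s u
      using form_cmult[OF lin(2), of "ex_param s $ 0 * ex_param u $ 0" 0 s u] by (simp add: p_def mult_ac)
    moreover have "form 2 (\<lambda>u. p s t u)" for s t
      using form_cmult[OF lin(3), of "ex_param s $ 0 * ex_param t $ 0" 0 s t] by (simp add: p_def mult_ac)
    ultimately show ?thesis by (simp add: triform_def)
  qed
  show "\<exists>V. zariski_open3 V \<and> V \<noteq> {} \<and> (\<forall>s t u. s \<noteq> 0 \<and> t \<noteq> 0 \<and> u \<noteq> 0 \<and> (pt s, pt t, pt u) \<in> V \<longrightarrow>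
    (let x = trilin ex_map s t u in x \<noteq> 0 \<and> ex_inv 0 x \<noteq> 0 \<and> ex_inv 1 x \<noteq> 0 \<and> ex_inv 2 x \<noteq> 0 \<and>
      pt (ex_inv 0 x) = pt s \<and> pt (ex_inv 1 x) = pt t \<and> pt (ex_inv 2 x) = pt u))"
  proof (intro exI[of _ "- W"] conjI allI impI)
    have "zariski_closed3 W"
      unfolding zariski_closed3_def W_def using tri by (intro exI[of _ "{p}"]) auto
    then show "zariski_open3 (- W)" by (simp add: zariski_open3_def)
    let ?e = "axis 0 1 :: complex ^ 2"
    have e0: "?e \<noteq> 0" by (simp add: axis_eq_0_iff)
    have "p ?e ?e ?e \<noteq> 0" by (simp add: p_def trilin_ex_map nf_def ex_param_def axis_def)
    then have "(pt ?e, pt ?e, pt ?e) \<notin> W"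
      unfolding W_def using triform_zero_well_defined[OF tri e0 e0 e0] by blast
    then show "- W \<noteq> {}" by blast
    fix s t u :: "complex ^ 2"
    assume *: "s \<noteq> 0 \<and> t \<noteq> 0 \<and> u \<noteq> 0 \<and> (pt s, pt t, pt u) \<in> - W"
    then have p: "p s t u \<noteq> 0" unfolding W_def by blast
    define x where "x = trilin ex_map s t u"
    have "x \<noteq> 0" using p by (auto simp: p_def x_def)
    moreover have "c *s v \<noteq> 0 \<and> pt (c *s v) = pt v" if "c \<noteq> 0" "v \<noteq> 0" for c and v :: "complex ^ 2"
      using that pt_eq_iff[of v "c *s v"] by auto
    ultimately show "let x = trilin ex_map s t u in x \<noteq> 0 \<and> ex_inv 0 x \<noteq> 0 \<and> ex_inv 1 x \<noteq> 0 \<and> ex_inv 2 x \<noteq> 0 \<and>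
      pt (ex_inv 0 x) = pt s \<and> pt (ex_inv 1 x) = pt t \<and> pt (ex_inv 2 x) = pt u"
      using * p ex_inv_ex_map[of s t u] by (simp add: Let_def x_def p_def)
  qed
  \<comment> \<open>In the other order the composition multiplies x by q^2 x_3, so this surface is
    removed.\<close>
  define W' where "W' = zero_locus {\<lambda>x :: complex ^ 4. qf x * x $ 3}"
  have f: "form (2 + 1) (\<lambda>x. qf x * x $ 3)"
    by (rule form_mult[OF form_qf_coord(1) form_coord])
  show "\<exists>V. zariski_open V \<and> V \<noteq> {} \<and> (\<forall>x. x \<noteq> 0 \<and> pt x \<in> V \<longrightarrow>
    ex_inv 0 x \<noteq> 0 \<and> ex_inv 1 x \<noteq> 0 \<and> ex_inv 2 x \<noteq> 0 \<and>
    trilin ex_map (ex_inv 0 x) (ex_inv 1 x) (ex_inv 2 x) \<noteq> 0 \<and> pt (trilin ex_map (ex_inv 0 x) (ex_inv 1 x) (ex_inv 2 x)) = pt x)"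
  proof (intro exI[of _ "- W'"] conjI allI impI)
    have "zariski_closed W'"
      unfolding zariski_closed_def W'_def using f by (intro exI[of _ "{\<lambda>x. qf x * x $ 3}"]) auto
    then show "zariski_open (- W')" by (simp add: zariski_open_def)
    have "pt (v4 1 1 1 1) \<notin> W'"
      unfolding W'_def by (subst pt_in_zero_locus[OF _ f]) (simp_all add: v4_zero_iff qf_def)
    then show "- W' \<noteq> {}" by blast
    fix x :: "complex ^ 4"
    assume *: "x \<noteq> 0 \<and> pt x \<in> - W'"
    then have q: "qf x \<noteq> 0" "x $ 3 \<noteq> 0" using pt_in_zero_locus[OF _ f, of x] by (auto simp: W'_def)
    then have "ex_inv i x \<noteq> 0" for i
      using ex_param_ex_inv[of i x] by (auto simp: ex_param_def vec_eq_2)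
    then show "ex_inv 0 x \<noteq> 0" "ex_inv 1 x \<noteq> 0" "ex_inv 2 x \<noteq> 0" by blast+
    show "trilin ex_map (ex_inv 0 x) (ex_inv 1 x) (ex_inv 2 x) \<noteq> 0"
      "pt (trilin ex_map (ex_inv 0 x) (ex_inv 1 x) (ex_inv 2 x)) = pt x"
      unfolding ex_map_ex_inv using q * pt_eq_iff[of x "((qf x)\<^sup>2 * x $ 3) *s x"] by auto
  qed
qed

theorem proposition6p2:
  shows "\<exists>U :: (4 \<times> 2 \<times> 2 \<times> 2) proj set. zariski_open U \<and>
    (\<exists>F. F \<noteq> 0 \<and> pt F \<in> U \<and> birational_of_type 2 2 2 F \<and> real_control_points F) \<and>
    (\<forall>F. F \<noteq> 0 \<and> pt F \<in> U \<and> birational_of_type 2 2 2 F \<longrightarrow>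
       nondegenerate F \<and> tripod F \<and>
       (\<exists>s t u A C. tripod_config F s t u A C \<and>
          Sigma_surf F 0 \<inter> Sigma_surf F 1 = t \<union> u \<union> C \<and>
          T_surf F 0 \<inter> T_surf F 1 = s \<union> u \<union> C \<and>
          Y_surf F 0 \<inter> Y_surf F 1 = s \<union> t \<union> C))"
proof -
  let ?p = "\<lambda>F. face_dets F * invariant_defect F"
  obtain d where d: "form d ?p" using form_face_dets_invariant_defect by blast
  define U where "U = - zero_locus {?p}"
  have "zariski_closed (zero_locus {?p})"
    unfolding zariski_closed_def using d by (intro exI[of _ "{?p}"]) auto
  then have "zariski_open U" by (simp add: zariski_open_def U_def)
  have U: "pt F \<in> U \<longleftrightarrow> face_dets F \<noteq> 0 \<and> invariant_defect F \<noteq> 0" if "F \<noteq> 0" for F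
    using pt_in_zero_locus[OF that d] by (simp add: U_def)
  have ex0: "ex_map \<noteq> 0"
  proof
    assume "ex_map = 0"
    then have "ex_map $ (0, 0, 0, 0) = 0" by simp
    then show False by (simp add: ex_map_def nf_def ex_param_def axis_def)
  qed
  have "birational_of_type 2 2 2 ex_map"
    unfolding birational_of_type_def
    using reduced_pair_ex_inv inverse_maps_ex by blast
  then have "\<exists>F. F \<noteq> 0 \<and> pt F \<in> U \<and> birational_of_type 2 2 2 F \<and> real_control_points F"
    using ex0 U[OF ex0] ex_map_face_dets ex_map_invariant_defect ex_map_real by blast
  moreover have "nondegenerate F \<and> tripod F \<and>
       (\<exists>s t u A C. tripod_config F s t u A C \<and>
          Sigma_surf F 0 \<inter> Sigma_surf F 1 = t \<union> u \<union> C \<and>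
          T_surf F 0 \<inter> T_surf F 1 = s \<union> u \<union> C \<and>
          Y_surf F 0 \<inter> Y_surf F 1 = s \<union> t \<union> C)"
    if F: "F \<noteq> 0" "pt F \<in> U" "birational_of_type 2 2 2 F" for F
  proof -
    obtain H Hi f g h where "normal_form_map F H Hi f g h"
      using normal_form_of_birational[OF F(3)] U[OF F(1)] F(2) by blast
    note main = normal_form_map.tripod_main[OF this]
    show ?thesis unfolding tripod_def using main by blast
  qed
  ultimately show ?thesis using \<open>zariski_open U\<close> by blast
qed

end
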